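(* Let $k$ be a commutative Noetherian ring, $S$ a set, $G$ a group acting on $S$ via a group homomorphism $\rho: G \to \mathrm{Sym}(S)$, and let $\tilde{G} = \mathrm{Sym}(S)$. If the action of $G$ on $S$ is highly transitive, then there is an equivalence of categories $$k[S]G\text{-}\mathrm{Mod}^{\mathrm{dis}} \simeq k[S]\tilde{G}\text{-}\mathrm{Mod}^{\mathrm{dis}}.$$ Moreover, every finitely generated discrete $k[S]G$-module is Noetherian. In particular, $k[S]$ as a $k[S]G$-module is Noetherian.
   Context: $\mathrm{Sym}(S)$ is the group of all permutations of $S$. $k[S] = k[x_s \mid s \in S]$ is the polynomial ring with indeterminates indexed by $S$. A group $G$ acting on $S$ acts on $k[S]$ by $k$-algebra automorphisms via $g \cdot x_s = x_{g\cdot s}$. The skew group ring $k[S]G$ consists of finite sums of elements $ag$ ($a \in k[S]$, $g \in G$), with multiplication $(ag)(bh) = a (g\cdot b)\, gh$. All modules are left modules. $G$ is given the topology in which the pointwise stabilizers $\mathrm{Stab}_G(T)$ of finite subsets $T \subseteq S$ form a base of open neighbourhoods of the identity (a cofinal system of open subgroups); similarly for $\tilde G = \mathrm{Sym}(S)$ with its natural action on $S$. A $k[S]G$-module $V$ is discrete if the action of $G$ on $V$ (with the discrete topology on $V$) is continuous, i.e. for every $v \in V$ the stabilizer $\{g \in G \mid g\cdot v = v\}$ is open (equivalently, contains $\mathrm{Stab}_G(T)$ for some finite $T \subseteq S$). $k[S]G\text{-}\mathrm{Mod}^{\mathrm{dis}}$ is the category of discrete $k[S]G$-modules and $k[S]G$-module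 homomorphisms. The action of $G$ on $S$ is highly transitive if for every $n \in \mathbb{N}$ and any two $n$-tuples $(s_1,\dots,s_n)$, $(t_1,\dots,t_n)$ of pairwise distinct elements of $S$ there is $g \in G$ with $g\cdot s_i = t_i$ for all $i$. *)

theory Defs
  imports
    "HOL-Algebra.Module"
    "HOL-Algebra.Group_Action"
    "HOL-Algebra.Ring_Divisibility"
    "HOL-Analysis.Analysis"
begin

section \<open>Modules over a not necessarily commutative ring\<close>

text \<open>The library's \<^locale>\<open>module\<close> requires a commutative ring of scalars. The record of modules
  and the predicate \<^const>\<open>submodule\<close> do not, so they are reused. The record fields
  \<^const>\<open>monoid.mult\<close> and \<^const>\<open>monoid.one\<close> of a module carry no meaning.\<close>

locale left_module = R?: ring R + M?: abelian_group M
  for R :: "('r, 'c) ring_scheme" (structure) and M :: "('r, 'm, 'd) module_scheme" (structure) +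
  assumes smult_closed:
      "\<lbrakk>a \<in> carrier R; x \<in> carrier M\<rbrakk> \<Longrightarrow> a \<odot>\<^bsub>M\<^esub> x \<in> carrier M"
    and smult_l_distr:
      "\<lbrakk>a \<in> carrier R; b \<in> carrier R; x \<in> carrier M\<rbrakk> \<Longrightarrow>
        (a \<oplus> b) \<odot>\<^bsub>M\<^esub> x = a \<odot>\<^bsub>M\<^esub> x \<oplus>\<^bsub>M\<^esub> b \<odot>\<^bsub>M\<^esub> x"
    and smult_r_distr:
      "\<lbrakk>a \<in> carrier R; x \<in> carrier M; y \<in> carrier M\<rbrakk> \<Longrightarrow>
        a \<odot>\<^bsub>M\<^esub> (x \<oplus>\<^bsub>M\<^esub> y) = a \<odot>\<^bsub>M\<^esub> x \<oplus>\<^bsub>M\<^esub> a \<odot>\<^bsub>M\<^esub> y"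
    and smult_assoc:
      "\<lbrakk>a \<in> carrier R; b \<in> carrier R; x \<in> carrier M\<rbrakk> \<Longrightarrow>
        (a \<otimes> b) \<odot>\<^bsub>M\<^esub> x = a \<odot>\<^bsub>M\<^esub> (b \<odot>\<^bsub>M\<^esub> x)"
    and smult_one:
      "x \<in> carrier M \<Longrightarrow> \<one> \<odot>\<^bsub>M\<^esub> x = x"

text \<open>Homomorphisms are extensional functions, so that equality of morphisms is equality of
  functions.\<close>

definition module_homs ::
    "('r, 'c) ring_scheme \<Rightarrow> ('r, 'm, 'd) module_scheme \<Rightarrow> ('r, 'n, 'e) module_scheme \<Rightarrow> ('m \<Rightarrow> 'n) set"
  where "module_homs R M N =
    {f \<in> carrier M \<rightarrow>\<^sub>E carrier N.
       (\<forall>x\<in>carrier M. \<forall>y\<in>carrier M. f (x \<oplus>\<^bsub>M\<^esub> y) = f x \<oplus>\<^bsub>N\<^esub> f y) \<and>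
       (\<forall>a\<in>carrier R. \<forall>x\<in>carrier M. f (a \<odot>\<^bsub>M\<^esub> x) = a \<odot>\<^bsub>N\<^esub> f x)}"

definition generated_submodule ::
    "('r, 'c) ring_scheme \<Rightarrow> ('r, 'm, 'd) module_scheme \<Rightarrow> 'm set \<Rightarrow> 'm set"
  where "generated_submodule R M A = \<Inter>{N. submodule N R M \<and> A \<subseteq> N}"

definition fin_gen_module :: "('r, 'c) ring_scheme \<Rightarrow> ('r, 'm, 'd) module_scheme \<Rightarrow> bool"
  where "fin_gen_module R M \<longleftrightarrow>
    (\<exists>A \<subseteq> carrier M. finite A \<and> carrier M = generated_submodule R M A)"

locale noetherian_module = left_module R M
  for R :: "('r, 'c) ring_scheme" (structure) and M :: "('r, 'm, 'd) module_scheme" (structure) +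
  assumes submodule_fin_gen:
    "submodule N R M \<Longrightarrow> \<exists>A \<subseteq> carrier M. finite A \<and> N = generated_submodule R M A"

section \<open>The polynomial ring and its permutations\<close>

text \<open>Monomials are finite multisets of indeterminates, as in \<open>HOL-Algebra.Indexed_Polynomials\<close>,
  and a polynomial is given by its coefficients. Both the coefficient ring and the set of
  indeterminates are carrier sets, so the zero ring and the empty set are included.\<close>

definition poly_ring_on :: "('k, 'c) ring_scheme \<Rightarrow> 's set \<Rightarrow> ('s multiset \<Rightarrow> 'k) ring"
  where "poly_ring_on k S =
    \<lparr>carrier = {p. range p \<subseteq> carrier k \<and> finite {m. p m \<noteq> \<zero>\<^bsub>k\<^esub>} \<and>
                  (\<forall>m. p m \<noteq> \<zero>\<^bsub>k\<^esub> \<longrightarrow> set_mset m \<subseteq> S)},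
     monoid.mult = \<lambda>p q m. \<Oplus>\<^bsub>k\<^esub>a\<in>{a. a \<subseteq># m}. p a \<otimes>\<^bsub>k\<^esub> q (m - a),
     monoid.one = \<lambda>m. if m = {#} then \<one>\<^bsub>k\<^esub> else \<zero>\<^bsub>k\<^esub>,
     ring.zero = \<lambda>m. \<zero>\<^bsub>k\<^esub>,
     ring.add = \<lambda>p q m. p m \<oplus>\<^bsub>k\<^esub> q m\<rparr>"

definition poly_monom :: "('k, 'c) ring_scheme \<Rightarrow> 'k \<Rightarrow> 's multiset \<Rightarrow> ('s multiset \<Rightarrow> 'k)"
  where "poly_monom k c m = (\<lambda>m'. if m' = m then c else \<zero>\<^bsub>k\<^esub>)"

text \<open>For a permutation \<open>\<sigma>\<close> of \<open>S\<close>, the automorphism with \<open>x\<^sub>s \<mapsto> x\<^bsub>\<sigma> s\<^esub>\<close> carries the coefficient of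
  a monomial \<open>m\<close> to the monomial \<open>\<sigma> m\<close>; see \<open>perm_poly_monom\<close> below.\<close>

definition perm_poly ::
    "('k, 'c) ring_scheme \<Rightarrow> 's set \<Rightarrow> ('s \<Rightarrow> 's) \<Rightarrow> ('s multiset \<Rightarrow> 'k) \<Rightarrow> ('s multiset \<Rightarrow> 'k)"
  where "perm_poly k S \<sigma> p =
    (\<lambda>m. if set_mset m \<subseteq> S then p (image_mset (inv_into S \<sigma>) m) else \<zero>\<^bsub>k\<^esub>)"

lemma perm_poly_monom:
  assumes "\<sigma> \<in> Bij S" and m: "set_mset m \<subseteq> S"
  shows "perm_poly k S \<sigma> (poly_monom k c m) = poly_monom k c (image_mset \<sigma> m)"
proof
  fix m'
  have b: "bij_betw \<sigma> S S" using assms(1) by (simp add: Bij_def)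
  have inv1: "image_mset (inv_into S \<sigma>) (image_mset \<sigma> m) = m"
  proof -
    have "image_mset (inv_into S \<sigma> \<circ> \<sigma>) m = image_mset id m"
      by (rule image_mset_cong) (use m b in \<open>auto simp: bij_betw_inv_into_left\<close>)
    then show ?thesis by (simp add: multiset.map_comp)
  qed
  have inv2: "image_mset \<sigma> (image_mset (inv_into S \<sigma>) m') = m'" if "set_mset m' \<subseteq> S"
  proof -
    have "image_mset (\<sigma> \<circ> inv_into S \<sigma>) m' = image_mset id m'"
      by (rule image_mset_cong) (use that b in \<open>auto simp: bij_betw_inv_into_right\<close>)
    then show ?thesis by (simp add: multiset.map_comp)
  qed
  have "set_mset (image_mset \<sigma> m) \<subseteq> S"
    using m b by (auto simp: bij_betw_def)
  then show "perm_poly k S \<sigma> (poly_monom k c m) m' = poly_monom k c (image_mset \<sigma> m) m'"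
    using inv1 inv2 by (auto simp: perm_poly_def poly_monom_def)
qed

corollary perm_poly_var:
  "\<lbrakk>\<sigma> \<in> Bij S; s \<in> S\<rbrakk> \<Longrightarrow>
    perm_poly k S \<sigma> (poly_monom k \<one>\<^bsub>k\<^esub> {#s#}) = poly_monom k \<one>\<^bsub>k\<^esub> {#\<sigma> s#}"
  by (simp add: perm_poly_monom)

section \<open>Skew group rings\<close>

text \<open>An element \<open>\<Sum>\<^sub>g a\<^sub>g g\<close> is the finitely supported function \<open>g \<mapsto> a\<^sub>g\<close>, extended by zero outside
  the carrier of the group. The action of \<open>G\<close> on \<open>A\<close> is \<open>\<alpha>\<close>.\<close>

definition skew_group_ring ::
    "('a, 'c) ring_scheme \<Rightarrow> ('g, 'd) monoid_scheme \<Rightarrow> ('g \<Rightarrow> 'a \<Rightarrow> 'a) \<Rightarrow> ('g \<Rightarrow> 'a) ring"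
  where "skew_group_ring A G \<alpha> =
    \<lparr>carrier = {f. range f \<subseteq> carrier A \<and> finite {g. f g \<noteq> \<zero>\<^bsub>A\<^esub>} \<and> {g. f g \<noteq> \<zero>\<^bsub>A\<^esub>} \<subseteq> carrier G},
     monoid.mult = \<lambda>f h x. if x \<in> carrier G
       then \<Oplus>\<^bsub>A\<^esub>g\<in>{g. f g \<noteq> \<zero>\<^bsub>A\<^esub>}. f g \<otimes>\<^bsub>A\<^esub> \<alpha> g (h (inv\<^bsub>G\<^esub> g \<otimes>\<^bsub>G\<^esub> x))
       else \<zero>\<^bsub>A\<^esub>,
     monoid.one = \<lambda>x. if x = \<one>\<^bsub>G\<^esub> then \<one>\<^bsub>A\<^esub> else \<zero>\<^bsub>A\<^esub>,
     ring.zero = \<lambda>x. \<zero>\<^bsub>A\<^esub>,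
     ring.add = \<lambda>f h x. f x \<oplus>\<^bsub>A\<^esub> h x\<rparr>"

definition skew_elem :: "('a, 'c) ring_scheme \<Rightarrow> 'a \<Rightarrow> 'g \<Rightarrow> ('g \<Rightarrow> 'a)"
  where "skew_elem A a g = (\<lambda>x. if x = g then a else \<zero>\<^bsub>A\<^esub>)"

lemma skew_elem_mult:
  assumes "ring A" "group G" and ab: "a \<in> carrier A" "b \<in> carrier A"
    and gh: "g \<in> carrier G" "h \<in> carrier G"
    and \<alpha>: "\<alpha> g \<in> carrier A \<rightarrow> carrier A" "\<alpha> g \<zero>\<^bsub>A\<^esub> = \<zero>\<^bsub>A\<^esub>"
  shows "skew_elem A a g \<otimes>\<^bsub>skew_group_ring A G \<alpha>\<^esub> skew_elem A b h =
    skew_elem A (a \<otimes>\<^bsub>A\<^esub> \<alpha> g b) (g \<otimes>\<^bsub>G\<^esub> h)"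
proof
  fix x
  interpret A: ring A by fact
  interpret G: group G by fact
  have gb: "\<alpha> g b \<in> carrier A" using \<alpha>(1) ab(2) by blast
  have eq: "inv\<^bsub>G\<^esub> g \<otimes>\<^bsub>G\<^esub> x = h \<longleftrightarrow> x = g \<otimes>\<^bsub>G\<^esub> h" if "x \<in> carrier G"
    using that gh by (metis G.inv_solve_left)
  show "(skew_elem A a g \<otimes>\<^bsub>skew_group_ring A G \<alpha>\<^esub> skew_elem A b h) x =
      skew_elem A (a \<otimes>\<^bsub>A\<^esub> \<alpha> g b) (g \<otimes>\<^bsub>G\<^esub> h) x"
  proof (cases "a = \<zero>\<^bsub>A\<^esub>")
    case True
    then show ?thesis using gb by (auto simp: skew_group_ring_def skew_elem_def)
  next
    case False
    then have supp: "{g'. skew_elem A a g g' \<noteq> \<zero>\<^bsub>A\<^esub>} = {g}"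
      by (auto simp: skew_elem_def)
    show ?thesis
    proof (cases "x \<in> carrier G")
      case True
      have "a \<otimes>\<^bsub>A\<^esub> \<alpha> g (skew_elem A b h (inv\<^bsub>G\<^esub> g \<otimes>\<^bsub>G\<^esub> x)) =
          skew_elem A (a \<otimes>\<^bsub>A\<^esub> \<alpha> g b) (g \<otimes>\<^bsub>G\<^esub> h) x"
        using eq[OF True] \<alpha>(2) ab by (auto simp: skew_elem_def)
      moreover have "skew_elem A (a \<otimes>\<^bsub>A\<^esub> \<alpha> g b) (g \<otimes>\<^bsub>G\<^esub> h) x \<in> carrier A"
        using ab gb by (auto simp: skew_elem_def)
      ultimately show ?thesis
        using True supp by (simp add: skew_group_ring_def A.finsum_insert)
          (simp add: skew_elem_def)
    next
      case False
      then show ?thesis using gh by (auto simp: skew_group_ring_def skew_elem_def)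
    qed
  qed
qed

text \<open>The coefficient ring as a left module over the skew group ring:
  \<open>(\<Sum>\<^sub>g a\<^sub>g g) \<cdot> p = \<Sum>\<^sub>g a\<^sub>g (g \<cdot> p)\<close>.\<close>

definition skew_regular_module ::
    "('a, 'c) ring_scheme \<Rightarrow> ('g \<Rightarrow> 'a \<Rightarrow> 'a) \<Rightarrow> ('g \<Rightarrow> 'a, 'a) module"
  where "skew_regular_module A \<alpha> =
    \<lparr>carrier = carrier A, monoid.mult = monoid.mult A, monoid.one = monoid.one A,
     ring.zero = ring.zero A, ring.add = ring.add A,
     module.smult = \<lambda>f p. \<Oplus>\<^bsub>A\<^esub>g\<in>{g. f g \<noteq> \<zero>\<^bsub>A\<^esub>}. f g \<otimes>\<^bsub>A\<^esub> \<alpha> g p\<rparr>"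

text \<open>Below, \<open>G\<close> acts on \<open>S\<close> through \<open>\<phi>\<close>, a homomorphism into \<^term>\<open>BijGroup S\<close>, the group of all
  permutations of \<open>S\<close>.\<close>

definition skew_poly_ring ::
    "('k, 'c) ring_scheme \<Rightarrow> 's set \<Rightarrow> ('g, 'd) monoid_scheme \<Rightarrow> ('g \<Rightarrow> 's \<Rightarrow> 's) \<Rightarrow>
      ('g \<Rightarrow> 's multiset \<Rightarrow> 'k) ring"
  where "skew_poly_ring k S G \<phi> =
    skew_group_ring (poly_ring_on k S) G (\<lambda>g. perm_poly k S (\<phi> g))"

definition skew_poly_module ::
    "('k, 'c) ring_scheme \<Rightarrow> 's set \<Rightarrow> ('g \<Rightarrow> 's \<Rightarrow> 's) \<Rightarrow>
      ('g \<Rightarrow> 's multiset \<Rightarrow> 'k, 's multiset \<Rightarrow> 'k) module"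
  where "skew_poly_module k S \<phi> =
    skew_regular_module (poly_ring_on k S) (\<lambda>g. perm_poly k S (\<phi> g))"

section \<open>Discrete modules\<close>

definition pointwise_stabilizer ::
    "('g, 'd) monoid_scheme \<Rightarrow> ('g \<Rightarrow> 's \<Rightarrow> 's) \<Rightarrow> 's set \<Rightarrow> 'g set"
  where "pointwise_stabilizer G \<phi> T = {g \<in> carrier G. \<forall>t\<in>T. \<phi> g t = t}"

text \<open>The group topology with the pointwise stabilizers of finite sets as a base of neighbourhoods
  of the identity; the left cosets of these subgroups form a base of it.\<close>

definition stabilizer_topology ::
    "'s set \<Rightarrow> ('g, 'd) monoid_scheme \<Rightarrow> ('g \<Rightarrow> 's \<Rightarrow> 's) \<Rightarrow> 'g topology"
  where "stabilizer_topology S G \<phi> = topology_generated_by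
    {g <#\<^bsub>G\<^esub> pointwise_stabilizer G \<phi> T | g T. g \<in> carrier G \<and> finite T \<and> T \<subseteq> S}"

definition group_elem_action ::
    "('k, 'c) ring_scheme \<Rightarrow> 's set \<Rightarrow> ('g \<Rightarrow> 's multiset \<Rightarrow> 'k, 'm, 'e) module_scheme \<Rightarrow>
      'g \<Rightarrow> 'm \<Rightarrow> 'm"
  where "group_elem_action k S V g v =
    skew_elem (poly_ring_on k S) \<one>\<^bsub>poly_ring_on k S\<^esub> g \<odot>\<^bsub>V\<^esub> v"

definition discrete_module ::
    "('k, 'c) ring_scheme \<Rightarrow> 's set \<Rightarrow> ('g, 'd) monoid_scheme \<Rightarrow> ('g \<Rightarrow> 's \<Rightarrow> 's) \<Rightarrow>
      ('g \<Rightarrow> 's multiset \<Rightarrow> 'k, 'm, 'e) module_scheme \<Rightarrow> bool"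
  where "discrete_module k S G \<phi> V \<longleftrightarrow>
    left_module (skew_poly_ring k S G \<phi>) V \<and>
    continuous_map
      (prod_topology (stabilizer_topology S G \<phi>) (discrete_topology (carrier V)))
      (discrete_topology (carrier V))
      (\<lambda>(g, v). group_elem_action k S V g v)"

definition highly_transitive ::
    "'s set \<Rightarrow> ('g, 'd) monoid_scheme \<Rightarrow> ('g \<Rightarrow> 's \<Rightarrow> 's) \<Rightarrow> bool"
  where "highly_transitive S G \<phi> \<longleftrightarrow>
    (\<forall>ss ts. set ss \<subseteq> S \<and> set ts \<subseteq> S \<and> distinct ss \<and> distinct ts \<and> length ss = length ts \<longrightarrow>
      (\<exists>g\<in>carrier G. map (\<phi> g) ss = ts))"

section \<open>Categories and equivalences\<close>

text \<open>Composition takes the three objects involved as arguments, since extensional functions do not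
  determine their domain and codomain; \<open>Comp C X Y Z g f\<close> is \<open>g \<circ> f : X \<rightarrow> Y \<rightarrow> Z\<close>.\<close>

record ('o, 'a) category =
  Obj :: "'o set"
  Hom :: "'o \<Rightarrow> 'o \<Rightarrow> 'a set"
  Ident :: "'o \<Rightarrow> 'a"
  Comp :: "'o \<Rightarrow> 'o \<Rightarrow> 'o \<Rightarrow> 'a \<Rightarrow> 'a \<Rightarrow> 'a"

definition is_category :: "('o, 'a) category \<Rightarrow> bool"
  where "is_category C \<longleftrightarrow>
    (\<forall>X\<in>Obj C. Ident C X \<in> Hom C X X) \<and>
    (\<forall>X\<in>Obj C. \<forall>Y\<in>Obj C. \<forall>Z\<in>Obj C. \<forall>f\<in>Hom C X Y. \<forall>g\<in>Hom C Y Z.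
      Comp C X Y Z g f \<in> Hom C X Z) \<and>
    (\<forall>X\<in>Obj C. \<forall>Y\<in>Obj C. \<forall>f\<in>Hom C X Y.
      Comp C X X Y f (Ident C X) = f \<and> Comp C X Y Y (Ident C Y) f = f) \<and>
    (\<forall>W\<in>Obj C. \<forall>X\<in>Obj C. \<forall>Y\<in>Obj C. \<forall>Z\<in>Obj C.
      \<forall>f\<in>Hom C W X. \<forall>g\<in>Hom C X Y. \<forall>h\<in>Hom C Y Z.
        Comp C W Y Z h (Comp C W X Y g f) = Comp C W X Z (Comp C X Y Z h g) f)"

definition is_functor ::
    "('o, 'a) category \<Rightarrow> ('p, 'b) category \<Rightarrow> ('o \<Rightarrow> 'p) \<Rightarrow> ('o \<Rightarrow> 'o \<Rightarrow> 'a \<Rightarrow> 'b) \<Rightarrow> bool"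
  where "is_functor C D F Fm \<longleftrightarrow>
    (\<forall>X\<in>Obj C. F X \<in> Obj D) \<and>
    (\<forall>X\<in>Obj C. \<forall>Y\<in>Obj C. \<forall>f\<in>Hom C X Y. Fm X Y f \<in> Hom D (F X) (F Y)) \<and>
    (\<forall>X\<in>Obj C. Fm X X (Ident C X) = Ident D (F X)) \<and>
    (\<forall>X\<in>Obj C. \<forall>Y\<in>Obj C. \<forall>Z\<in>Obj C. \<forall>f\<in>Hom C X Y. \<forall>g\<in>Hom C Y Z.
      Fm X Z (Comp C X Y Z g f) = Comp D (F X) (F Y) (F Z) (Fm Y Z g) (Fm X Y f))"

definition is_isomorphism :: "('o, 'a) category \<Rightarrow> 'o \<Rightarrow> 'o \<Rightarrow> 'a \<Rightarrow> bool"
  where "is_isomorphism C X Y f \<longleftrightarrow> f \<in> Hom C X Y \<and>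
    (\<exists>g\<in>Hom C Y X. Comp C X Y X g f = Ident C X \<and> Comp C Y X Y f g = Ident C Y)"

definition naturally_isomorphic ::
    "('o, 'a) category \<Rightarrow> ('p, 'b) category \<Rightarrow>
      ('o \<Rightarrow> 'p) \<Rightarrow> ('o \<Rightarrow> 'o \<Rightarrow> 'a \<Rightarrow> 'b) \<Rightarrow> ('o \<Rightarrow> 'p) \<Rightarrow> ('o \<Rightarrow> 'o \<Rightarrow> 'a \<Rightarrow> 'b) \<Rightarrow> bool"
  where "naturally_isomorphic C D F Fm H Hm \<longleftrightarrow>
    (\<exists>\<eta>. (\<forall>X\<in>Obj C. is_isomorphism D (F X) (H X) (\<eta> X)) \<and>
      (\<forall>X\<in>Obj C. \<forall>Y\<in>Obj C. \<forall>f\<in>Hom C X Y.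
        Comp D (F X) (F Y) (H Y) (\<eta> Y) (Fm X Y f) = Comp D (F X) (H X) (H Y) (Hm X Y f) (\<eta> X)))"

definition equivalent_categories :: "('o, 'a) category \<Rightarrow> ('p, 'b) category \<Rightarrow> bool"
  where "equivalent_categories C D \<longleftrightarrow>
    is_category C \<and> is_category D \<and>
    (\<exists>F Fm H Hm.
      is_functor C D F Fm \<and> is_functor D C H Hm \<and>
      naturally_isomorphic C C (\<lambda>X. X) (\<lambda>X Y f. f)
        (\<lambda>X. H (F X)) (\<lambda>X Y f. Hm (F X) (F Y) (Fm X Y f)) \<and>
      naturally_isomorphic D D (\<lambda>X. F (H X)) (\<lambda>X Y f. Fm (H X) (H Y) (Hm X Y f))
        (\<lambda>X. X) (\<lambda>X Y f. f))"

text \<open>The type \<open>'m\<close> plays the role of the universe from which the underlying sets of modules are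
  taken.\<close>

definition discrete_module_category ::
    "('k, 'c) ring_scheme \<Rightarrow> 's set \<Rightarrow> ('g, 'd) monoid_scheme \<Rightarrow> ('g \<Rightarrow> 's \<Rightarrow> 's) \<Rightarrow>
      (('g \<Rightarrow> 's multiset \<Rightarrow> 'k, 'm) module, 'm \<Rightarrow> 'm) category"
  where "discrete_module_category k S G \<phi> =
    \<lparr>Obj = {V. discrete_module k S G \<phi> V},
     Hom = module_homs (skew_poly_ring k S G \<phi>),
     Ident = \<lambda>V. \<lambda>v\<in>carrier V. v,
     Comp = \<lambda>U V W g f. compose (carrier U) g f\<rparr>"

end

theory Submission
  imports Defs "HOL-Library.Ramsey" "HOL-Library.Sublist"
begin

text \<open>The equivalence holds because a highly transitive group has dense image in the group of all
  permutations: on a finite set \<open>T \<subseteq> S\<close> every permutation \<open>\<sigma>\<close> agrees with some \<open>g \<in> G\<close>. A vector \<open>v\<close> of a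
  discrete module is fixed by the pointwise stabilizer of a finite set \<open>T\<close>, so \<open>g v\<close> depends only on
  the restriction of \<open>g\<close> to \<open>T\<close>, and \<open>\<sigma> v = g v\<close> is well defined (\<open>ext_act_eq\<close>). Enlarging
  \<open>T\<close>, one sees that this is an action of all permutations, semilinear since a polynomial involves
  finitely many indeterminates. Extending the action in this way and restricting it
  along \<open>\<rho>\<close> keep the underlying sets and the homomorphisms, and they are inverse to each other up to
  natural isomorphisms whose components are identity maps.

  The Noetherian property is a Groebner basis argument. Let \<open>v\<^sub>1, \<dots>, v\<^sub>r\<close> generate \<open>V\<close>, all fixed by the
  stabilizer of \<open>{t\<^sub>1, \<dots>, t\<^sub>n}\<close>. Over \<open>k\<close>, the module \<open>V\<close> is spanned by the elements
  \<open>x\<^sup>m g v\<^sub>i\<close>, and such an element is determined by \<open>m\<close>, by \<open>i\<close> and by the points \<open>g t\<^sub>j\<close>. Arrange the points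
  that occur in an element of \<open>V\<close> in a list \<open>D\<close>. Each summand \<open>x\<^sup>m g v\<^sub>i\<close> is then encoded by a word with one
  letter for every entry of \<open>D\<close>: the letter records the exponent of that point in \<open>m\<close> and which
  of the \<open>t\<^sub>j\<close>, if any, is sent there. An order embedding of the positions of a word \<open>u\<close> into those of
  \<open>u'\<close> that keeps the labels and does not lower the exponents is realised by multiplication with some
  \<open>x\<^sup>c h\<close>, \<open>h \<in> G\<close>, because high transitivity allows the points of one list to be moved to prescribed
  points of the other (\<open>symbol_multiplier\<close>). This multiplication respects the lexicographic order of
  words; for this it matters that a word has a letter even for the points absent from its own summand.
  Embeddability is a well-quasi-order by Higman's lemma (\<open>higman\<close>), so leading coefficients
  can be compared as in Hilbert's basis theorem (\<open>submodule_finitely_generated\<close>).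

  The polynomial ring itself is a discrete module generated by \<open>1\<close>.\<close>

section \<open>Rings and modules of finitely supported functions\<close>

text \<open>Both the polynomial ring, with \<open>X\<close> the monomials in \<open>S\<close>, and the skew group ring, with \<open>X\<close> the
  group, have this additive structure, and in both the multiplication is determined by the products
  of functions supported at one point.\<close>

locale finitely_supported = A: abelian_group A
  for A :: "('a, 'c) ring_scheme" and X :: "'x set" and M :: "('x \<Rightarrow> 'a, 'e) ring_scheme" (structure) +
  assumes carrier_eq:
      "carrier M = {f. range f \<subseteq> carrier A \<and> finite {x. f x \<noteq> \<zero>\<^bsub>A\<^esub>} \<and> {x. f x \<noteq> \<zero>\<^bsub>A\<^esub>} \<subseteq> X}"
    and add_eq: "f \<oplus> h = (\<lambda>x. f x \<oplus>\<^bsub>A\<^esub> h x)"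
    and zero_eq: "\<zero> = (\<lambda>x. \<zero>\<^bsub>A\<^esub>)"
begin

lemma value_closed: "f \<in> carrier M \<Longrightarrow> f x \<in> carrier A"
  by (auto simp: carrier_eq)

lemma single_closed: "a \<in> carrier A \<Longrightarrow> x \<in> X \<Longrightarrow> skew_elem A a x \<in> carrier M"
  by (auto simp: carrier_eq skew_elem_def)

lemma abelian_group: "abelian_group M"
proof (rule abelian_groupI)
  fix f h assume f: "f \<in> carrier M" and h: "h \<in> carrier M"
  have "{x. f x \<oplus>\<^bsub>A\<^esub> h x \<noteq> \<zero>\<^bsub>A\<^esub>} \<subseteq> {x. f x \<noteq> \<zero>\<^bsub>A\<^esub>} \<union> {x. h x \<noteq> \<zero>\<^bsub>A\<^esub>}"
    by auto
  moreover have "finite ({x. f x \<noteq> \<zero>\<^bsub>A\<^esub>} \<union> {x. h x \<noteq> \<zero>\<^bsub>A\<^esub>})"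
    using f h by (simp add: carrier_eq)
  ultimately have "finite {x. f x \<oplus>\<^bsub>A\<^esub> h x \<noteq> \<zero>\<^bsub>A\<^esub>}"
      "{x. f x \<oplus>\<^bsub>A\<^esub> h x \<noteq> \<zero>\<^bsub>A\<^esub>} \<subseteq> X"
    using f h finite_subset by (auto simp: carrier_eq)
  then show "f \<oplus> h \<in> carrier M"
    using f h by (simp add: carrier_eq add_eq image_subset_iff)
next
  fix f assume f: "f \<in> carrier M"
  show "\<exists>h\<in>carrier M. h \<oplus> f = \<zero>"
  proof (rule bexI[of _ "\<lambda>x. \<ominus>\<^bsub>A\<^esub> f x"])
    have "(\<ominus>\<^bsub>A\<^esub> f x \<noteq> \<zero>\<^bsub>A\<^esub>) = (f x \<noteq> \<zero>\<^bsub>A\<^esub>)" for x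
      using value_closed[OF f, of x] by (metis A.add.inv_eq_1_iff)
    then show "(\<lambda>x. \<ominus>\<^bsub>A\<^esub> f x) \<in> carrier M"
      using f by (auto simp: carrier_eq image_subset_iff)
  qed (use value_closed[OF f] in \<open>simp add: add_eq zero_eq A.l_neg\<close>)
qed (auto simp: add_eq zero_eq value_closed A.a_ac, auto simp: carrier_eq)

sublocale abelian_group M
  by (rule abelian_group)

lemma add_single:
  assumes "a \<in> carrier A" "b \<in> carrier A"
  shows "skew_elem A (a \<oplus>\<^bsub>A\<^esub> b) x = skew_elem A a x \<oplus> skew_elem A b x"
  using assms by (auto simp: skew_elem_def add_eq)

lemma zero_single: "skew_elem A \<zero>\<^bsub>A\<^esub> x = \<zero>"
  by (auto simp: skew_elem_def zero_eq)

text \<open>Finitely supported functions are sums of functions supported at one point, so an additive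
  property need only be checked for the latter.\<close>

lemma single_induct [consumes 1, case_names single zero add]:
  assumes f: "f \<in> carrier M"
    and single: "\<And>a x. a \<in> carrier A \<Longrightarrow> x \<in> X \<Longrightarrow> P (skew_elem A a x)"
    and zero: "P \<zero>"
    and add: "\<And>f h. f \<in> carrier M \<Longrightarrow> h \<in> carrier M \<Longrightarrow> P f \<Longrightarrow> P h \<Longrightarrow> P (f \<oplus> h)"
  shows "P f"
proof -
  have "P f" if "f \<in> carrier M" "{x. f x \<noteq> \<zero>\<^bsub>A\<^esub>} \<subseteq> U" "finite U" for U f
    using that(3,1,2)
  proof (induction U arbitrary: f rule: finite_induct)
    case empty
    then have "f = \<zero>" by (auto simp: zero_eq)
    then show ?case using zero by simp
  next
    case (insert u U)
    show ?case
    proof (cases "f u = \<zero>\<^bsub>A\<^esub>")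
      case True
      then show ?thesis using insert by (metis (mono_tags, lifting) mem_Collect_eq subset_insert)
    next
      case False
      define h where "h = f(u := \<zero>\<^bsub>A\<^esub>)"
      have "{x. h x \<noteq> \<zero>\<^bsub>A\<^esub>} \<subseteq> {x. f x \<noteq> \<zero>\<^bsub>A\<^esub>}" by (auto simp: h_def)
      then have h: "h \<in> carrier M"
        using insert.prems(1) finite_subset[of "{x. h x \<noteq> \<zero>\<^bsub>A\<^esub>}"]
        by (auto simp: carrier_eq h_def image_subset_iff)
      have u: "u \<in> X" and fu: "f u \<in> carrier A"
        using False insert.prems(1) by (auto simp: carrier_eq)
      have "f = skew_elem A (f u) u \<oplus> h"
        using fu insert.prems(1) by (auto simp: add_eq skew_elem_def h_def value_closed)
      moreover have "P h"
        by (rule insert.IH[OF h]) (use insert.prems(2) in \<open>auto simp: h_def\<close>)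
      ultimately show ?thesis
        using add[OF single_closed[OF fu u] h] single[OF fu u] by simp
    qed
  qed
  then show ?thesis using f by (auto simp: carrier_eq)
qed

text \<open>Consequently the associative and the unit laws of a biadditive multiplication need only be
  checked at functions supported at one point.\<close>

lemma ring_if_single_laws:
  assumes closed: "\<And>f h. f \<in> carrier M \<Longrightarrow> h \<in> carrier M \<Longrightarrow> f \<otimes> h \<in> carrier M"
    and one: "\<one> \<in> carrier M"
    and l_distr: "\<And>f g h. f \<in> carrier M \<Longrightarrow> g \<in> carrier M \<Longrightarrow> h \<in> carrier M \<Longrightarrow>
        (f \<oplus> g) \<otimes> h = f \<otimes> h \<oplus> g \<otimes> h"
    and r_distr: "\<And>f g h. f \<in> carrier M \<Longrightarrow> g \<in> carrier M \<Longrightarrow> h \<in> carrier M \<Longrightarrow>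
        h \<otimes> (f \<oplus> g) = h \<otimes> f \<oplus> h \<otimes> g"
    and assoc: "\<And>a b c x y z. \<lbrakk>a \<in> carrier A; b \<in> carrier A; c \<in> carrier A; x \<in> X; y \<in> X; z \<in> X\<rbrakk> \<Longrightarrow>
        (skew_elem A a x \<otimes> skew_elem A b y) \<otimes> skew_elem A c z =
        skew_elem A a x \<otimes> (skew_elem A b y \<otimes> skew_elem A c z)"
    and l_one: "\<And>a x. a \<in> carrier A \<Longrightarrow> x \<in> X \<Longrightarrow> \<one> \<otimes> skew_elem A a x = skew_elem A a x"
    and r_one: "\<And>a x. a \<in> carrier A \<Longrightarrow> x \<in> X \<Longrightarrow> skew_elem A a x \<otimes> \<one> = skew_elem A a x"
  shows "ring M"
proof (rule ringI)
  show "abelian_group M" by (rule abelian_group)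
  have l_null: "\<zero> \<otimes> f = \<zero>" if "f \<in> carrier M" for f
    using l_distr[OF zero_closed zero_closed that] closed[OF zero_closed that]
    by (metis add.r_cancel_one' l_zero zero_closed)
  have r_null: "f \<otimes> \<zero> = \<zero>" if "f \<in> carrier M" for f
    using r_distr[OF zero_closed zero_closed that] closed[OF that zero_closed]
    by (metis add.r_cancel_one' l_zero zero_closed)
  have l_one': "\<one> \<otimes> f = f" if "f \<in> carrier M" for f
    using that by (induction rule: single_induct) (simp_all add: l_one r_null one r_distr)
  have r_one': "f \<otimes> \<one> = f" if "f \<in> carrier M" for f
    using that by (induction rule: single_induct) (simp_all add: r_one l_null one l_distr)
  have as1: "(f \<otimes> skew_elem A b y) \<otimes> skew_elem A c z =
      f \<otimes> (skew_elem A b y \<otimes> skew_elem A c z)"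
    if "f \<in> carrier M" "b \<in> carrier A" "c \<in> carrier A" "y \<in> X" "z \<in> X" for f b c y z
    using that
    by (induction rule: single_induct) (simp_all add: assoc l_null single_closed closed l_distr)
  have as2: "(f \<otimes> g) \<otimes> skew_elem A c z = f \<otimes> (g \<otimes> skew_elem A c z)"
    if "g \<in> carrier M" "f \<in> carrier M" "c \<in> carrier A" "z \<in> X" for f g c z
    using that
    by (induction rule: single_induct)
      (simp_all add: as1 l_null r_null single_closed closed l_distr r_distr)
  have as3: "(f \<otimes> g) \<otimes> h = f \<otimes> (g \<otimes> h)"
    if "h \<in> carrier M" "f \<in> carrier M" "g \<in> carrier M" for f g h
    using that
    by (induction rule: single_induct) (simp_all add: as2 r_null closed r_distr)
  show "monoid M"
    by (rule monoidI) (simp_all add: closed one as3 l_one' r_one')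
qed (simp_all add: l_distr r_distr)

end

section \<open>The polynomial ring\<close>

lemma poly_monom_eq_skew_elem: "poly_monom k c m = skew_elem k c m"
  by (simp add: poly_monom_def skew_elem_def)

lemma finite_multisets_below: "finite {m. m \<subseteq># (l :: 'x multiset)}"
proof (rule finite_subset)
  show "{m. m \<subseteq># l} \<subseteq> mset ` {xs. set xs \<subseteq> set_mset l \<and> length xs \<le> size l}"
  proof
    fix m assume "m \<in> {m. m \<subseteq># l}"
    moreover obtain xs where "m = mset xs" using ex_mset by metis
    ultimately show "m \<in> mset ` {xs. set xs \<subseteq> set_mset l \<and> length xs \<le> size l}"
      using set_mset_mono[of m l] size_mset_mono[of m l] by auto
  qed
qed (simp add: finite_lists_length_le)

context cring
begin

lemma finitely_supported_poly_ring:
  "finitely_supported R {m. set_mset m \<subseteq> S} (poly_ring_on R S)"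
  by unfold_locales (auto simp: poly_ring_on_def)

lemma poly_monom_closed:
  "c \<in> carrier R \<Longrightarrow> set_mset m \<subseteq> S \<Longrightarrow> poly_monom R c m \<in> carrier (poly_ring_on R S)"
  using finitely_supported.single_closed[OF finitely_supported_poly_ring]
  by (simp add: poly_monom_eq_skew_elem)

lemma poly_mult_eq:
  "p \<otimes>\<^bsub>poly_ring_on R S\<^esub> q = (\<lambda>m. \<Oplus>a\<in>{a. a \<subseteq># m}. p a \<otimes> q (m - a))"
  by (simp add: poly_ring_on_def)

lemma poly_add_eq: "p \<oplus>\<^bsub>poly_ring_on R S\<^esub> q = (\<lambda>m. p m \<oplus> q m)"
  by (simp add: poly_ring_on_def)

lemma poly_one_eq: "\<one>\<^bsub>poly_ring_on R S\<^esub> = poly_monom R \<one> {#}"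
  by (simp add: poly_ring_on_def poly_monom_def)

lemma poly_monom_mult:
  assumes "a \<in> carrier R" "b \<in> carrier R"
  shows "poly_monom R a m \<otimes>\<^bsub>poly_ring_on R S\<^esub> poly_monom R b n = poly_monom R (a \<otimes> b) (m + n)"
proof
  fix l
  have "(\<Oplus>x\<in>{x. x \<subseteq># l}. poly_monom R a m x \<otimes> poly_monom R b n (l - x)) =
      (\<Oplus>x\<in>{x. x \<subseteq># l}. if m = x then a \<otimes> poly_monom R b n (l - x) else \<zero>)"
    by (rule finsum_cong') (use assms in \<open>auto simp: poly_monom_def\<close>)
  also have "\<dots> = (if m \<subseteq># l then a \<otimes> poly_monom R b n (l - m) else \<zero>)"
  proof (cases "m \<subseteq># l")
    case True
    then show ?thesis
      using finsum_singleton[of m "{x. x \<subseteq># l}" "\<lambda>x. a \<otimes> poly_monom R b n (l - x)"] assms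
      by (simp add: finite_multisets_below poly_monom_def)
  next
    case False
    then have "(\<Oplus>x\<in>{x. x \<subseteq># l}. if m = x then a \<otimes> poly_monom R b n (l - x) else \<zero>) =
        (\<Oplus>x\<in>{x. x \<subseteq># l}. \<zero>)"
      by (intro finsum_cong') auto
    then show ?thesis using False by simp
  qed
  also have "\<dots> = poly_monom R (a \<otimes> b) (m + n) l"
    using assms by (auto simp: poly_monom_def)
  finally show "(poly_monom R a m \<otimes>\<^bsub>poly_ring_on R S\<^esub> poly_monom R b n) l =
      poly_monom R (a \<otimes> b) (m + n) l"
    by (simp add: poly_mult_eq)
qed

lemma cring_poly_ring: "cring (poly_ring_on R S)"
proof -
  let ?P = "poly_ring_on R S"
  interpret P: finitely_supported R "{m. set_mset m \<subseteq> S}" ?P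
    by (rule finitely_supported_poly_ring)
  have closed: "p \<otimes>\<^bsub>?P\<^esub> q \<in> carrier ?P" if p: "p \<in> carrier ?P" and q: "q \<in> carrier ?P" for p q
  proof -
    have val: "(\<Oplus>a\<in>{a. a \<subseteq># m}. p a \<otimes> q (m - a)) \<in> carrier R" for m
      by (rule finsum_closed) (use P.value_closed[OF p] P.value_closed[OF q] in auto)
    have supp: "{m. (p \<otimes>\<^bsub>?P\<^esub> q) m \<noteq> \<zero>} \<subseteq>
        (\<lambda>(a, b). a + b) ` ({m. p m \<noteq> \<zero>} \<times> {m. q m \<noteq> \<zero>})" (is "_ \<subseteq> ?U")
    proof
      fix m assume m: "m \<in> {m. (p \<otimes>\<^bsub>?P\<^esub> q) m \<noteq> \<zero>}"
      have "\<exists>a. a \<subseteq># m \<and> p a \<otimes> q (m - a) \<noteq> \<zero>"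
      proof (rule ccontr)
        assume "\<not> ?thesis"
        then have "(\<Oplus>a\<in>{a. a \<subseteq># m}. p a \<otimes> q (m - a)) = (\<Oplus>a\<in>{a. a \<subseteq># m}. \<zero>)"
          by (intro finsum_cong') auto
        then show False using m by (simp add: poly_mult_eq)
      qed
      then obtain a where a: "a \<subseteq># m" "p a \<otimes> q (m - a) \<noteq> \<zero>" by blast
      then have "p a \<noteq> \<zero>" "q (m - a) \<noteq> \<zero>"
        using P.value_closed[OF p] P.value_closed[OF q] by auto
      then show "m \<in> ?U" using a(1) by (auto intro!: image_eqI[of _ _ "(a, m - a)"])
    qed
    have "finite {m. (p \<otimes>\<^bsub>?P\<^esub> q) m \<noteq> \<zero>}"
      by (rule finite_subset[OF supp]) (use p q in \<open>auto simp: P.carrier_eq\<close>)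
    moreover have "?U \<subseteq> {m. set_mset m \<subseteq> S}"
      using p q by (fastforce simp: P.carrier_eq)
    ultimately show ?thesis
      unfolding P.carrier_eq using subset_trans[OF supp] val by (simp add: poly_mult_eq image_subset_iff)
  qed
  have l_distr: "(p \<oplus>\<^bsub>?P\<^esub> q) \<otimes>\<^bsub>?P\<^esub> r = p \<otimes>\<^bsub>?P\<^esub> r \<oplus>\<^bsub>?P\<^esub> q \<otimes>\<^bsub>?P\<^esub> r"
    if "p \<in> carrier ?P" "q \<in> carrier ?P" "r \<in> carrier ?P" for p q r
  proof
    fix m
    have c: "p x \<in> carrier R" "q x \<in> carrier R" "r x \<in> carrier R" for x
      using that by (auto intro: P.value_closed)
    have "(\<Oplus>a\<in>{a. a \<subseteq># m}. (p a \<oplus> q a) \<otimes> r (m - a)) =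
        (\<Oplus>a\<in>{a. a \<subseteq># m}. p a \<otimes> r (m - a) \<oplus> q a \<otimes> r (m - a))"
      by (rule finsum_cong') (use c in \<open>auto simp: l_distr\<close>)
    then show "((p \<oplus>\<^bsub>?P\<^esub> q) \<otimes>\<^bsub>?P\<^esub> r) m = (p \<otimes>\<^bsub>?P\<^esub> r \<oplus>\<^bsub>?P\<^esub> q \<otimes>\<^bsub>?P\<^esub> r) m"
      using c by (simp add: poly_mult_eq poly_add_eq finsum_addf Pi_def)
  qed
  have r_distr: "r \<otimes>\<^bsub>?P\<^esub> (p \<oplus>\<^bsub>?P\<^esub> q) = r \<otimes>\<^bsub>?P\<^esub> p \<oplus>\<^bsub>?P\<^esub> r \<otimes>\<^bsub>?P\<^esub> q"
    if "p \<in> carrier ?P" "q \<in> carrier ?P" "r \<in> carrier ?P" for p q r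
  proof
    fix m
    have c: "p x \<in> carrier R" "q x \<in> carrier R" "r x \<in> carrier R" for x
      using that by (auto intro: P.value_closed)
    have "(\<Oplus>a\<in>{a. a \<subseteq># m}. r a \<otimes> (p (m - a) \<oplus> q (m - a))) =
        (\<Oplus>a\<in>{a. a \<subseteq># m}. r a \<otimes> p (m - a) \<oplus> r a \<otimes> q (m - a))"
      by (rule finsum_cong') (use c in \<open>auto simp: r_distr\<close>)
    then show "(r \<otimes>\<^bsub>?P\<^esub> (p \<oplus>\<^bsub>?P\<^esub> q)) m = (r \<otimes>\<^bsub>?P\<^esub> p \<oplus>\<^bsub>?P\<^esub> r \<otimes>\<^bsub>?P\<^esub> q) m"
      using c by (simp add: poly_mult_eq poly_add_eq finsum_addf Pi_def)
  qed
  have "ring ?P"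
  proof (rule P.ring_if_single_laws)
    show "\<one>\<^bsub>?P\<^esub> \<in> carrier ?P" by (simp add: poly_one_eq poly_monom_closed)
  qed (simp_all add: closed l_distr r_distr poly_one_eq poly_monom_mult m_assoc ac_simps
      flip: poly_monom_eq_skew_elem)
  then interpret ring ?P .
  have comm1: "p \<otimes>\<^bsub>?P\<^esub> poly_monom R b n = poly_monom R b n \<otimes>\<^bsub>?P\<^esub> p"
    if "p \<in> carrier ?P" "b \<in> carrier R" "set_mset n \<subseteq> S" for p b n
    using that
  proof (induction rule: P.single_induct)
    case (single a m)
    then show ?case
      by (simp add: poly_monom_mult m_comm ac_simps flip: poly_monom_eq_skew_elem)
  qed (simp_all add: poly_monom_closed l_distr r_distr)
  have comm: "q \<otimes>\<^bsub>?P\<^esub> p = p \<otimes>\<^bsub>?P\<^esub> q" if "p \<in> carrier ?P" "q \<in> carrier ?P" for p q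
    using that
  proof (induction rule: P.single_induct)
    case (single a m)
    then show ?case using comm1 by (simp flip: poly_monom_eq_skew_elem)
  qed (simp_all add: l_distr r_distr)
  show ?thesis
    by (unfold_locales) (simp add: comm)
qed


context
  fixes S :: "'s set"
begin

abbreviation "PS \<equiv> poly_ring_on R S"

lemma perm_poly_add:
  "perm_poly R S \<sigma> (p \<oplus>\<^bsub>PS\<^esub> q) =
    perm_poly R S \<sigma> p \<oplus>\<^bsub>PS\<^esub> perm_poly R S \<sigma> q"
  by (auto simp: perm_poly_def poly_ring_on_def)

lemma perm_poly_zero: "perm_poly R S \<sigma> \<zero>\<^bsub>PS\<^esub> = \<zero>\<^bsub>PS\<^esub>"
  by (auto simp: perm_poly_def poly_ring_on_def)

lemma poly_induct [consumes 1, case_names monom zero add]: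
  assumes "p \<in> carrier (PS)"
    and "\<And>c m. c \<in> carrier R \<Longrightarrow> set_mset m \<subseteq> S \<Longrightarrow> P (poly_monom R c m)"
    and "P \<zero>\<^bsub>PS\<^esub>"
    and "\<And>p q. p \<in> carrier (PS) \<Longrightarrow> q \<in> carrier (PS) \<Longrightarrow> P p \<Longrightarrow> P q \<Longrightarrow>
      P (p \<oplus>\<^bsub>PS\<^esub> q)"
  shows "P p"
  using finitely_supported.single_induct[OF finitely_supported_poly_ring, of p S P] assms
  by (simp add: poly_monom_eq_skew_elem)

lemma perm_poly_closed:
  assumes "\<sigma> \<in> Bij S" "p \<in> carrier (PS)"
  shows "perm_poly R S \<sigma> p \<in> carrier (PS)"
proof -
  interpret P: cring "PS" by (rule cring_poly_ring)
  show ?thesis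
    using assms(2)
  proof (induction rule: poly_induct)
    case (monom c m)
    moreover from this have "set_mset (image_mset \<sigma> m) \<subseteq> S"
      using Bij_imp_funcset[OF assms(1)] by (auto simp: Pi_iff subset_iff)
    ultimately show ?case
      by (simp add: perm_poly_monom[OF assms(1)] poly_monom_closed)
  qed (simp_all add: perm_poly_zero perm_poly_add)
qed

lemma perm_poly_mult:
  assumes \<sigma>: "\<sigma> \<in> Bij S" and p: "p \<in> carrier (PS)" and q: "q \<in> carrier (PS)"
  shows "perm_poly R S \<sigma> (p \<otimes>\<^bsub>PS\<^esub> q) =
    perm_poly R S \<sigma> p \<otimes>\<^bsub>PS\<^esub> perm_poly R S \<sigma> q"
proof -
  interpret P: cring "PS" by (rule cring_poly_ring)
  note closed = perm_poly_closed[OF \<sigma>]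
  have 1: "perm_poly R S \<sigma> (p \<otimes>\<^bsub>PS\<^esub> poly_monom R b n) =
      perm_poly R S \<sigma> p \<otimes>\<^bsub>PS\<^esub> perm_poly R S \<sigma> (poly_monom R b n)"
    if b: "b \<in> carrier R" "set_mset n \<subseteq> S" for b n
    using p
  proof (induction rule: poly_induct)
    case (monom a m)
    then show ?case
      using b by (simp add: poly_monom_mult perm_poly_monom[OF \<sigma>])
  qed (use b in \<open>simp_all add: perm_poly_zero perm_poly_add poly_monom_closed P.l_distr closed\<close>)
  show ?thesis
    using q
    by (induction rule: poly_induct)
      (simp_all add: 1 p perm_poly_zero perm_poly_add P.r_distr closed)
qed

lemma perm_poly_one: "\<sigma> \<in> Bij S \<Longrightarrow> perm_poly R S \<sigma> \<one>\<^bsub>PS\<^esub> = \<one>\<^bsub>PS\<^esub>"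
  by (simp add: poly_one_eq perm_poly_monom)

lemma perm_poly_compose:
  assumes \<sigma>: "\<sigma> \<in> Bij S" and \<tau>: "\<tau> \<in> Bij S" and "p \<in> carrier (PS)"
  shows "perm_poly R S (compose S \<sigma> \<tau>) p = perm_poly R S \<sigma> (perm_poly R S \<tau> p)"
  using assms(3)
proof (induction rule: poly_induct)
  case (monom a m)
  have "image_mset (compose S \<sigma> \<tau>) m = image_mset \<sigma> (image_mset \<tau> m)"
    unfolding multiset.map_comp
    by (rule image_mset_cong) (use monom in \<open>auto simp: compose_def\<close>)
  moreover have "set_mset (image_mset \<tau> m) \<subseteq> S"
    using Bij_imp_funcset[OF \<tau>] monom by auto
  ultimately show ?case
    using monom by (simp add: perm_poly_monom \<sigma> \<tau> compose_Bij)
qed (simp_all add: perm_poly_zero perm_poly_add)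

lemma perm_poly_id:
  assumes "p \<in> carrier (PS)"
  shows "perm_poly R S (\<lambda>s\<in>S. s) p = p"
  using assms
proof (induction rule: poly_induct)
  case (monom a m)
  have "image_mset (\<lambda>s\<in>S. s) m = image_mset id m"
    by (rule image_mset_cong) (use monom in auto)
  then show ?case
    using monom by (simp add: perm_poly_monom[OF id_Bij] del: restrict_apply)
qed (simp_all add: perm_poly_zero perm_poly_add)

end

end

section \<open>Skew group rings\<close>

locale skew_action = A: ring A + G: group G
  for A :: "('a, 'c) ring_scheme" and G :: "('g, 'd) monoid_scheme" (structure) and \<alpha> :: "'g \<Rightarrow> 'a \<Rightarrow> 'a" +
  assumes act_closed [simp]: "\<lbrakk>g \<in> carrier G; a \<in> carrier A\<rbrakk> \<Longrightarrow> \<alpha> g a \<in> carrier A"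
    and act_add: "\<lbrakk>g \<in> carrier G; a \<in> carrier A; b \<in> carrier A\<rbrakk> \<Longrightarrow> \<alpha> g (a \<oplus>\<^bsub>A\<^esub> b) = \<alpha> g a \<oplus>\<^bsub>A\<^esub> \<alpha> g b"
    and act_mult: "\<lbrakk>g \<in> carrier G; a \<in> carrier A; b \<in> carrier A\<rbrakk> \<Longrightarrow> \<alpha> g (a \<otimes>\<^bsub>A\<^esub> b) = \<alpha> g a \<otimes>\<^bsub>A\<^esub> \<alpha> g b"
    and act_one: "g \<in> carrier G \<Longrightarrow> \<alpha> g \<one>\<^bsub>A\<^esub> = \<one>\<^bsub>A\<^esub>"
    and act_comp: "\<lbrakk>g \<in> carrier G; h \<in> carrier G; a \<in> carrier A\<rbrakk> \<Longrightarrow> \<alpha> (g \<otimes> h) a = \<alpha> g (\<alpha> h a)"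
    and act_unit: "a \<in> carrier A \<Longrightarrow> \<alpha> \<one> a = a"
begin

abbreviation "RG \<equiv> skew_group_ring A G \<alpha>"

lemma act_zero: "g \<in> carrier G \<Longrightarrow> \<alpha> g \<zero>\<^bsub>A\<^esub> = \<zero>\<^bsub>A\<^esub>"
  using act_add[of g "\<zero>\<^bsub>A\<^esub>" "\<zero>\<^bsub>A\<^esub>"] act_closed[of g "\<zero>\<^bsub>A\<^esub>"]
  by (metis A.add.r_cancel_one' A.l_zero A.zero_closed)

abbreviation supp :: "('g \<Rightarrow> 'a) \<Rightarrow> 'g set"
  where "supp f \<equiv> {g. f g \<noteq> \<zero>\<^bsub>A\<^esub>}"

sublocale RG: finitely_supported A "carrier G" RG
  by unfold_locales (auto simp: skew_group_ring_def)

lemma skew_mult_superset: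
  assumes f: "f \<in> carrier RG" and h: "h \<in> carrier RG"
    and U: "finite U" "supp f \<subseteq> U" "U \<subseteq> carrier G" and x: "x \<in> carrier G"
  shows "(f \<otimes>\<^bsub>RG\<^esub> h) x = (\<Oplus>\<^bsub>A\<^esub>g\<in>U. f g \<otimes>\<^bsub>A\<^esub> \<alpha> g (h (inv g \<otimes> x)))"
proof -
  have "(\<Oplus>\<^bsub>A\<^esub>g\<in>supp f. f g \<otimes>\<^bsub>A\<^esub> \<alpha> g (h (inv g \<otimes> x))) =
      (\<Oplus>\<^bsub>A\<^esub>g\<in>U. f g \<otimes>\<^bsub>A\<^esub> \<alpha> g (h (inv g \<otimes> x)))"
    by (rule A.add.finprod_mono_neutral_cong_left)
      (use U RG.value_closed[OF f] RG.value_closed[OF h] in auto)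
  then show ?thesis using x by (simp add: skew_group_ring_def)
qed

lemma finite_support: "f \<in> carrier RG \<Longrightarrow> finite (supp f)"
  and support_subset: "f \<in> carrier RG \<Longrightarrow> supp f \<subseteq> carrier G"
  by (auto simp: RG.carrier_eq)

lemma skew_mult_outside: "x \<notin> carrier G \<Longrightarrow> (f \<otimes>\<^bsub>RG\<^esub> h) x = \<zero>\<^bsub>A\<^esub>"
  by (simp add: skew_group_ring_def)

lemma skew_mult_closed:
  assumes f: "f \<in> carrier RG" and h: "h \<in> carrier RG"
  shows "f \<otimes>\<^bsub>RG\<^esub> h \<in> carrier RG"
proof -
  let ?term = "\<lambda>x g. f g \<otimes>\<^bsub>A\<^esub> \<alpha> g (h (inv g \<otimes> x))"
  have val: "?term x g \<in> carrier A" if "g \<in> supp f" for x g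
    using that RG.value_closed[OF f] RG.value_closed[OF h] support_subset[OF f] by auto
  have supp: "supp (f \<otimes>\<^bsub>RG\<^esub> h) \<subseteq>
      (\<lambda>(g, y). g \<otimes> y) ` (supp f \<times> supp h)"
  proof
    fix x assume x: "x \<in> supp (f \<otimes>\<^bsub>RG\<^esub> h)"
    then have xG: "x \<in> carrier G" using skew_mult_outside by blast
    have "\<exists>g. f g \<noteq> \<zero>\<^bsub>A\<^esub> \<and> ?term x g \<noteq> \<zero>\<^bsub>A\<^esub>"
    proof (rule ccontr)
      assume "\<not> ?thesis"
      then have "(\<Oplus>\<^bsub>A\<^esub>g\<in>supp f. ?term x g) = (\<Oplus>\<^bsub>A\<^esub>g\<in>supp f. \<zero>\<^bsub>A\<^esub>)"
        by (intro A.finsum_cong') auto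
      then show False using x xG by (simp add: skew_group_ring_def)
    qed
    then obtain g where g: "f g \<noteq> \<zero>\<^bsub>A\<^esub>" "?term x g \<noteq> \<zero>\<^bsub>A\<^esub>" by blast
    then have gG: "g \<in> carrier G" using support_subset[OF f] by blast
    then have "h (inv g \<otimes> x) \<noteq> \<zero>\<^bsub>A\<^esub>"
      using g act_zero RG.value_closed[OF f] by auto
    moreover have "x = g \<otimes> (inv g \<otimes> x)"
      using gG xG by (simp flip: G.m_assoc)
    ultimately show "x \<in> (\<lambda>(g, y). g \<otimes> y) ` (supp f \<times> supp h)"
      using g(1) by (auto intro!: image_eqI[of _ _ "(g, inv g \<otimes> x)"])
  qed
  have "finite (supp (f \<otimes>\<^bsub>RG\<^esub> h))"
    by (rule finite_subset[OF supp]) (use finite_support[OF f] finite_support[OF h] in simp)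
  moreover have "(f \<otimes>\<^bsub>RG\<^esub> h) x \<in> carrier A" for x
    using val by (auto simp: skew_group_ring_def intro!: A.finsum_closed)
  moreover have "supp (f \<otimes>\<^bsub>RG\<^esub> h) \<subseteq> carrier G"
    using skew_mult_outside by blast
  ultimately show ?thesis
    unfolding RG.carrier_eq by (simp add: image_subset_iff)
qed

lemma single_mult:
  "\<lbrakk>a \<in> carrier A; b \<in> carrier A; g \<in> carrier G; h \<in> carrier G\<rbrakk> \<Longrightarrow>
    skew_elem A a g \<otimes>\<^bsub>RG\<^esub> skew_elem A b h = skew_elem A (a \<otimes>\<^bsub>A\<^esub> \<alpha> g b) (g \<otimes> h)"
  by (rule skew_elem_mult) (auto simp: A.ring_axioms G.group_axioms act_zero)

lemma one_eq: "\<one>\<^bsub>RG\<^esub> = skew_elem A \<one>\<^bsub>A\<^esub> \<one>"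
  by (simp add: skew_group_ring_def skew_elem_def)

lemma ring_RG: "ring RG"
proof (rule RG.ring_if_single_laws)
  show "f \<otimes>\<^bsub>RG\<^esub> h \<in> carrier RG" if "f \<in> carrier RG" "h \<in> carrier RG" for f h
    by (rule skew_mult_closed[OF that])
  show "\<one>\<^bsub>RG\<^esub> \<in> carrier RG"
    by (simp add: one_eq RG.single_closed)
next
  fix f g h assume f: "f \<in> carrier RG" and g: "g \<in> carrier RG" and h: "h \<in> carrier RG"
  show "(f \<oplus>\<^bsub>RG\<^esub> g) \<otimes>\<^bsub>RG\<^esub> h = f \<otimes>\<^bsub>RG\<^esub> h \<oplus>\<^bsub>RG\<^esub> g \<otimes>\<^bsub>RG\<^esub> h"
  proof
    fix x
    show "((f \<oplus>\<^bsub>RG\<^esub> g) \<otimes>\<^bsub>RG\<^esub> h) x = (f \<otimes>\<^bsub>RG\<^esub> h \<oplus>\<^bsub>RG\<^esub> g \<otimes>\<^bsub>RG\<^esub> h) x"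
    proof (cases "x \<in> carrier G")
      case True
      define U where "U = supp f \<union> supp g"
      have U: "finite U" "U \<subseteq> carrier G" "supp f \<subseteq> U" "supp g \<subseteq> U"
          "supp (f \<oplus>\<^bsub>RG\<^esub> g) \<subseteq> U"
        using finite_support[OF f] finite_support[OF g] support_subset[OF f] support_subset[OF g]
        by (auto simp: U_def RG.add_eq)
      have c: "y \<in> U \<Longrightarrow> \<alpha> y (h (inv y \<otimes> x)) \<in> carrier A" "f y \<in> carrier A" "g y \<in> carrier A" for y
        using U RG.value_closed f g h by auto
      have "(\<Oplus>\<^bsub>A\<^esub>y\<in>U. (f y \<oplus>\<^bsub>A\<^esub> g y) \<otimes>\<^bsub>A\<^esub> \<alpha> y (h (inv y \<otimes> x))) =
          (\<Oplus>\<^bsub>A\<^esub>y\<in>U. f y \<otimes>\<^bsub>A\<^esub> \<alpha> y (h (inv y \<otimes> x)) \<oplus>\<^bsub>A\<^esub> g y \<otimes>\<^bsub>A\<^esub> \<alpha> y (h (inv y \<otimes> x)))"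
        by (rule A.finsum_cong') (use c in \<open>auto simp: A.l_distr\<close>)
      also have "\<dots> = (\<Oplus>\<^bsub>A\<^esub>y\<in>U. f y \<otimes>\<^bsub>A\<^esub> \<alpha> y (h (inv y \<otimes> x))) \<oplus>\<^bsub>A\<^esub>
          (\<Oplus>\<^bsub>A\<^esub>y\<in>U. g y \<otimes>\<^bsub>A\<^esub> \<alpha> y (h (inv y \<otimes> x)))"
        by (rule A.finsum_addf) (use c in auto)
      finally show ?thesis
        using skew_mult_superset[OF _ h U(1) _ U(2) True] U(3-5) f g
        by (simp add: RG.add_eq RG.a_closed[unfolded RG.add_eq])
    qed (simp add: skew_mult_outside RG.add_eq)
  qed
  show "h \<otimes>\<^bsub>RG\<^esub> (f \<oplus>\<^bsub>RG\<^esub> g) = h \<otimes>\<^bsub>RG\<^esub> f \<oplus>\<^bsub>RG\<^esub> h \<otimes>\<^bsub>RG\<^esub> g"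
  proof
    fix x
    show "(h \<otimes>\<^bsub>RG\<^esub> (f \<oplus>\<^bsub>RG\<^esub> g)) x = (h \<otimes>\<^bsub>RG\<^esub> f \<oplus>\<^bsub>RG\<^esub> h \<otimes>\<^bsub>RG\<^esub> g) x"
    proof (cases "x \<in> carrier G")
      case True
      let ?U = "supp h"
      have c: "h y \<in> carrier A" "f y \<in> carrier A" "g y \<in> carrier A" for y
        using RG.value_closed f g h by auto
      have U: "y \<in> ?U \<Longrightarrow> y \<in> carrier G" for y using support_subset[OF h] by auto
      have "(\<Oplus>\<^bsub>A\<^esub>y\<in>?U. h y \<otimes>\<^bsub>A\<^esub> \<alpha> y (f (inv y \<otimes> x) \<oplus>\<^bsub>A\<^esub> g (inv y \<otimes> x))) =
          (\<Oplus>\<^bsub>A\<^esub>y\<in>?U. h y \<otimes>\<^bsub>A\<^esub> \<alpha> y (f (inv y \<otimes> x)) \<oplus>\<^bsub>A\<^esub> h y \<otimes>\<^bsub>A\<^esub> \<alpha> y (g (inv y \<otimes> x)))"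
        by (rule A.finsum_cong') (use c U in \<open>auto simp: A.r_distr act_add\<close>)
      also have "\<dots> = (\<Oplus>\<^bsub>A\<^esub>y\<in>?U. h y \<otimes>\<^bsub>A\<^esub> \<alpha> y (f (inv y \<otimes> x))) \<oplus>\<^bsub>A\<^esub>
          (\<Oplus>\<^bsub>A\<^esub>y\<in>?U. h y \<otimes>\<^bsub>A\<^esub> \<alpha> y (g (inv y \<otimes> x)))"
        by (rule A.finsum_addf) (use c U in auto)
      finally show ?thesis
        using True by (simp add: skew_group_ring_def)
    qed (simp add: skew_mult_outside RG.add_eq)
  qed
next
  fix a b c x y z
  assume "a \<in> carrier A" "b \<in> carrier A" "c \<in> carrier A" "x \<in> carrier G" "y \<in> carrier G" "z \<in> carrier G"
  then show "(skew_elem A a x \<otimes>\<^bsub>RG\<^esub> skew_elem A b y) \<otimes>\<^bsub>RG\<^esub> skew_elem A c z =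
      skew_elem A a x \<otimes>\<^bsub>RG\<^esub> (skew_elem A b y \<otimes>\<^bsub>RG\<^esub> skew_elem A c z)"
    by (simp add: single_mult act_mult act_comp A.m_assoc G.m_assoc)
qed (simp_all add: one_eq single_mult act_unit act_one)

end

section \<open>Modules over skew group rings\<close>

context left_module
begin

lemma smult_l_null [simp]: "x \<in> carrier M \<Longrightarrow> \<zero>\<^bsub>R\<^esub> \<odot>\<^bsub>M\<^esub> x = \<zero>\<^bsub>M\<^esub>"
  using smult_l_distr[of "\<zero>\<^bsub>R\<^esub>" "\<zero>\<^bsub>R\<^esub>" x] smult_closed[of "\<zero>\<^bsub>R\<^esub>" x]
  by (metis M.add.r_cancel_one' R.l_zero R.zero_closed)

lemma smult_r_null [simp]: "a \<in> carrier R \<Longrightarrow> a \<odot>\<^bsub>M\<^esub> \<zero>\<^bsub>M\<^esub> = \<zero>\<^bsub>M\<^esub>"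
  using smult_r_distr[of a "\<zero>\<^bsub>M\<^esub>" "\<zero>\<^bsub>M\<^esub>"] smult_closed[of a "\<zero>\<^bsub>M\<^esub>"]
  by (metis M.add.r_cancel_one' M.l_zero M.zero_closed)

lemma smult_minus_one:
  assumes "x \<in> carrier M"
  shows "(\<ominus>\<^bsub>R\<^esub> \<one>\<^bsub>R\<^esub>) \<odot>\<^bsub>M\<^esub> x = \<ominus>\<^bsub>M\<^esub> x"
proof -
  have "(\<ominus>\<^bsub>R\<^esub> \<one>\<^bsub>R\<^esub>) \<odot>\<^bsub>M\<^esub> x \<oplus>\<^bsub>M\<^esub> x = \<zero>\<^bsub>M\<^esub>"
    using smult_l_distr[of "\<ominus>\<^bsub>R\<^esub> \<one>\<^bsub>R\<^esub>" "\<one>\<^bsub>R\<^esub>" x] assms by (simp add: smult_one R.l_neg)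
  then show ?thesis
    using assms by (intro M.minus_equality[symmetric]) (simp_all add: smult_closed)
qed

lemma submoduleI:
  assumes "N \<subseteq> carrier M" "\<zero>\<^bsub>M\<^esub> \<in> N"
    and "\<And>x y. x \<in> N \<Longrightarrow> y \<in> N \<Longrightarrow> x \<oplus>\<^bsub>M\<^esub> y \<in> N"
    and "\<And>a x. a \<in> carrier R \<Longrightarrow> x \<in> N \<Longrightarrow> a \<odot>\<^bsub>M\<^esub> x \<in> N"
  shows "submodule N R M"
proof (intro submodule.intro subgroup.intro submodule_axioms.intro)
  show "inv\<^bsub>add_monoid M\<^esub> x \<in> N" if "x \<in> N" for x
    using smult_minus_one[of x] assms(4)[of "\<ominus>\<^bsub>R\<^esub> \<one>\<^bsub>R\<^esub>" x] that assms(1)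
    by (auto simp: a_inv_def)
qed (use assms in auto)

lemma submoduleD:
  assumes "submodule N R M"
  shows "N \<subseteq> carrier M" "\<zero>\<^bsub>M\<^esub> \<in> N"
    "\<And>x y. x \<in> N \<Longrightarrow> y \<in> N \<Longrightarrow> x \<oplus>\<^bsub>M\<^esub> y \<in> N"
    "\<And>a x. a \<in> carrier R \<Longrightarrow> x \<in> N \<Longrightarrow> a \<odot>\<^bsub>M\<^esub> x \<in> N"
proof -
  interpret N: submodule N R M by fact
  show sub: "N \<subseteq> carrier M" using N.subset by simp
  show "\<zero>\<^bsub>M\<^esub> \<in> N" using N.one_closed by simp
  show "x \<oplus>\<^bsub>M\<^esub> y \<in> N" if "x \<in> N" "y \<in> N" for x y using N.m_closed[OF that] by simp
  show "a \<odot>\<^bsub>M\<^esub> x \<in> N" if "a \<in> carrier R" "x \<in> N" for a x using N.smult_closed[OF that] .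
qed

lemma submodule_minus: "submodule N R M \<Longrightarrow> x \<in> N \<Longrightarrow> y \<in> N \<Longrightarrow> x \<ominus>\<^bsub>M\<^esub> y \<in> N"
  using submoduleD[of N] smult_minus_one[of y] R.a_inv_closed[OF R.one_closed]
  unfolding a_minus_def by (metis subsetD)

lemma submodule_carrier: "submodule (carrier M) R M"
  by (rule submoduleI) (auto simp: smult_closed)

lemma generated_subset: "A \<subseteq> generated_submodule R M A"
  by (auto simp: generated_submodule_def)

lemma generated_minimal: "submodule N R M \<Longrightarrow> A \<subseteq> N \<Longrightarrow> generated_submodule R M A \<subseteq> N"
  by (auto simp: generated_submodule_def)

lemma submodule_generated:
  assumes "A \<subseteq> carrier M"
  shows "submodule (generated_submodule R M A) R M"
proof (rule submoduleI)
  show "generated_submodule R M A \<subseteq> carrier M"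
    by (rule generated_minimal[OF submodule_carrier assms])
qed (auto simp: generated_submodule_def dest: submoduleD)

end

lemma noetherian_moduleI:
  assumes "left_module R M"
    and "\<And>N. submodule N R M \<Longrightarrow> \<exists>A \<subseteq> carrier M. finite A \<and> N = generated_submodule R M A"
  shows "noetherian_module R M"
  using assms by (simp add: noetherian_module_def noetherian_module_axioms_def)

context skew_action
begin

text \<open>A module over the skew group ring amounts to a module over the coefficient ring with a
  semilinear action of the group. Every module over a skew group ring constructed below comes from such
  data \<open>s\<close> and \<open>t\<close>; associativity is checked on the generators \<open>a g\<close>, where it is semilinearity.\<close>

lemma left_module_if_semilinear_action:
  fixes M :: "('g \<Rightarrow> 'a, 'm, 'e) module_scheme" and s :: "'a \<Rightarrow> 'm \<Rightarrow> 'm" and t :: "'g \<Rightarrow> 'm \<Rightarrow> 'm"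
  assumes M: "abelian_group M"
    and s_closed: "\<And>a v. a \<in> carrier A \<Longrightarrow> v \<in> carrier M \<Longrightarrow> s a v \<in> carrier M"
    and s_l_distr: "\<And>a b v. a \<in> carrier A \<Longrightarrow> b \<in> carrier A \<Longrightarrow> v \<in> carrier M \<Longrightarrow>
      s (a \<oplus>\<^bsub>A\<^esub> b) v = s a v \<oplus>\<^bsub>M\<^esub> s b v"
    and s_r_distr: "\<And>a v w. a \<in> carrier A \<Longrightarrow> v \<in> carrier M \<Longrightarrow> w \<in> carrier M \<Longrightarrow>
      s a (v \<oplus>\<^bsub>M\<^esub> w) = s a v \<oplus>\<^bsub>M\<^esub> s a w"
    and s_assoc: "\<And>a b v. a \<in> carrier A \<Longrightarrow> b \<in> carrier A \<Longrightarrow> v \<in> carrier M \<Longrightarrow>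
      s (a \<otimes>\<^bsub>A\<^esub> b) v = s a (s b v)"
    and s_one: "\<And>v. v \<in> carrier M \<Longrightarrow> s \<one>\<^bsub>A\<^esub> v = v"
    and t_closed: "\<And>g v. g \<in> carrier G \<Longrightarrow> v \<in> carrier M \<Longrightarrow> t g v \<in> carrier M"
    and t_add: "\<And>g v w. g \<in> carrier G \<Longrightarrow> v \<in> carrier M \<Longrightarrow> w \<in> carrier M \<Longrightarrow>
      t g (v \<oplus>\<^bsub>M\<^esub> w) = t g v \<oplus>\<^bsub>M\<^esub> t g w"
    and t_comp: "\<And>g h v. g \<in> carrier G \<Longrightarrow> h \<in> carrier G \<Longrightarrow> v \<in> carrier M \<Longrightarrow>
      t (g \<otimes> h) v = t g (t h v)"
    and t_one: "\<And>v. v \<in> carrier M \<Longrightarrow> t \<one> v = v"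
    and semilinear: "\<And>g a v. g \<in> carrier G \<Longrightarrow> a \<in> carrier A \<Longrightarrow> v \<in> carrier M \<Longrightarrow>
      t g (s a v) = s (\<alpha> g a) (t g v)"
    and smult: "\<And>f v. f \<in> carrier RG \<Longrightarrow> v \<in> carrier M \<Longrightarrow>
      f \<odot>\<^bsub>M\<^esub> v = (\<Oplus>\<^bsub>M\<^esub>g\<in>supp f. s (f g) (t g v))"
  shows "left_module RG M"
    and "\<And>a g v. a \<in> carrier A \<Longrightarrow> g \<in> carrier G \<Longrightarrow> v \<in> carrier M \<Longrightarrow>
      skew_elem A a g \<odot>\<^bsub>M\<^esub> v = s a (t g v)"
proof -
  interpret M: abelian_group M by fact
  have s_zero: "s \<zero>\<^bsub>A\<^esub> v = \<zero>\<^bsub>M\<^esub>" if "v \<in> carrier M" for v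
    using s_l_distr[of "\<zero>\<^bsub>A\<^esub>" "\<zero>\<^bsub>A\<^esub>" v] s_closed[of "\<zero>\<^bsub>A\<^esub>" v] that
    by (metis M.add.r_cancel_one' A.l_zero A.zero_closed)
  show single: "skew_elem A a g \<odot>\<^bsub>M\<^esub> v = s a (t g v)"
    if "a \<in> carrier A" "g \<in> carrier G" "v \<in> carrier M" for a g v
  proof (cases "a = \<zero>\<^bsub>A\<^esub>")
    case True
    then show ?thesis
      using that smult[OF RG.single_closed[OF that(1,2)] that(3)]
      by (simp add: skew_elem_def s_zero t_closed)
  next
    case False
    then have "{x. skew_elem A a g x \<noteq> \<zero>\<^bsub>A\<^esub>} = {g}" by (auto simp: skew_elem_def)
    then show ?thesis
      using that smult[OF RG.single_closed[OF that(1,2)] that(3)]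
      by (simp add: skew_elem_def s_closed t_closed)
  qed
  have superset: "f \<odot>\<^bsub>M\<^esub> v = (\<Oplus>\<^bsub>M\<^esub>g\<in>U. s (f g) (t g v))"
    if "f \<in> carrier RG" "v \<in> carrier M" "finite U" "supp f \<subseteq> U" "U \<subseteq> carrier G" for f v U
    unfolding smult[OF that(1,2)]
    by (rule M.add.finprod_mono_neutral_cong_left)
      (use that RG.value_closed[OF that(1)] in \<open>auto simp: s_closed t_closed s_zero\<close>)
  have closed: "f \<odot>\<^bsub>M\<^esub> v \<in> carrier M" if "f \<in> carrier RG" "v \<in> carrier M" for f v
    unfolding smult[OF that]
    by (rule M.finsum_closed)
      (use that RG.value_closed[OF that(1)] support_subset[OF that(1)] in \<open>auto simp: s_closed t_closed\<close>)
  have distr_l: "(f \<oplus>\<^bsub>RG\<^esub> h) \<odot>\<^bsub>M\<^esub> v = f \<odot>\<^bsub>M\<^esub> v \<oplus>\<^bsub>M\<^esub> h \<odot>\<^bsub>M\<^esub> v"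
    if f: "f \<in> carrier RG" and h: "h \<in> carrier RG" and v: "v \<in> carrier M" for f h v
  proof -
    define U where "U = supp f \<union> supp h"
    have U: "finite U" "U \<subseteq> carrier G" "supp f \<subseteq> U" "supp h \<subseteq> U"
        "supp (f \<oplus>\<^bsub>RG\<^esub> h) \<subseteq> U"
      using finite_support[OF f] finite_support[OF h] support_subset[OF f] support_subset[OF h]
      by (auto simp: U_def RG.add_eq)
    have c: "f y \<in> carrier A" "h y \<in> carrier A" "y \<in> U \<Longrightarrow> t y v \<in> carrier M" for y
      using U RG.value_closed f h t_closed v by auto
    have "(\<Oplus>\<^bsub>M\<^esub>g\<in>U. s (f g \<oplus>\<^bsub>A\<^esub> h g) (t g v)) = (\<Oplus>\<^bsub>M\<^esub>g\<in>U. s (f g) (t g v) \<oplus>\<^bsub>M\<^esub> s (h g) (t g v))"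
      by (rule M.finsum_cong') (use c in \<open>auto simp: s_l_distr s_closed\<close>)
    also have "\<dots> = (\<Oplus>\<^bsub>M\<^esub>g\<in>U. s (f g) (t g v)) \<oplus>\<^bsub>M\<^esub> (\<Oplus>\<^bsub>M\<^esub>g\<in>U. s (h g) (t g v))"
      by (rule M.finsum_addf) (use c in \<open>auto simp: s_closed\<close>)
    finally show ?thesis
      using superset[OF f v U(1,3,2)] superset[OF h v U(1,4,2)]
        superset[OF RG.a_closed[OF f h] v U(1,5,2)] by (simp add: RG.add_eq)
  qed
  have distr_r: "f \<odot>\<^bsub>M\<^esub> (v \<oplus>\<^bsub>M\<^esub> w) = f \<odot>\<^bsub>M\<^esub> v \<oplus>\<^bsub>M\<^esub> f \<odot>\<^bsub>M\<^esub> w"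
    if f: "f \<in> carrier RG" and v: "v \<in> carrier M" and w: "w \<in> carrier M" for f v w
  proof -
    let ?U = "supp f"
    have c: "f y \<in> carrier A" "y \<in> ?U \<Longrightarrow> y \<in> carrier G" for y
      using RG.value_closed[OF f] support_subset[OF f] by auto
    have "(\<Oplus>\<^bsub>M\<^esub>g\<in>?U. s (f g) (t g (v \<oplus>\<^bsub>M\<^esub> w))) = (\<Oplus>\<^bsub>M\<^esub>g\<in>?U. s (f g) (t g v) \<oplus>\<^bsub>M\<^esub> s (f g) (t g w))"
      by (rule M.finsum_cong') (use c v w in \<open>auto simp: s_r_distr t_add s_closed t_closed\<close>)
    also have "\<dots> = (\<Oplus>\<^bsub>M\<^esub>g\<in>?U. s (f g) (t g v)) \<oplus>\<^bsub>M\<^esub> (\<Oplus>\<^bsub>M\<^esub>g\<in>?U. s (f g) (t g w))"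
      by (rule M.finsum_addf) (use c v w in \<open>auto simp: s_closed t_closed\<close>)
    finally show ?thesis
      using smult[OF f] v w by simp
  qed
  have null: "\<zero>\<^bsub>RG\<^esub> \<odot>\<^bsub>M\<^esub> v = \<zero>\<^bsub>M\<^esub>" if "v \<in> carrier M" for v
    using distr_l[OF RG.zero_closed RG.zero_closed that] closed[OF RG.zero_closed that]
    by (metis M.add.r_cancel_one' RG.l_zero RG.zero_closed)
  have null_r: "f \<odot>\<^bsub>M\<^esub> \<zero>\<^bsub>M\<^esub> = \<zero>\<^bsub>M\<^esub>" if "f \<in> carrier RG" for f
    using distr_r[OF that M.zero_closed M.zero_closed] closed[OF that M.zero_closed]
    by (metis M.add.r_cancel_one' M.l_zero M.zero_closed)
  interpret ring RG by (rule ring_RG)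
  have assoc1: "(f \<otimes>\<^bsub>RG\<^esub> skew_elem A b h) \<odot>\<^bsub>M\<^esub> v = f \<odot>\<^bsub>M\<^esub> (skew_elem A b h \<odot>\<^bsub>M\<^esub> v)"
    if "f \<in> carrier RG" "b \<in> carrier A" "h \<in> carrier G" "v \<in> carrier M" for f b h v
    using that
    by (induction rule: RG.single_induct)
      (simp_all add: single single_mult s_assoc semilinear t_comp s_closed t_closed null closed distr_l l_distr
        RG.single_closed)
  have assoc: "(f \<otimes>\<^bsub>RG\<^esub> h) \<odot>\<^bsub>M\<^esub> v = f \<odot>\<^bsub>M\<^esub> (h \<odot>\<^bsub>M\<^esub> v)"
    if "h \<in> carrier RG" "f \<in> carrier RG" "v \<in> carrier M" for f h v
    using that
    by (induction rule: RG.single_induct)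
      (simp_all add: assoc1 null null_r closed distr_r distr_l r_distr)
  show "left_module RG M"
    by (intro left_module.intro left_module_axioms.intro)
      (simp_all add: ring_RG M closed distr_l distr_r assoc one_eq single s_one t_one)
qed

lemma module_homsI:
  assumes M: "left_module RG M" and N: "left_module RG N" and f: "f \<in> carrier M \<rightarrow>\<^sub>E carrier N"
    and add: "\<And>x y. x \<in> carrier M \<Longrightarrow> y \<in> carrier M \<Longrightarrow> f (x \<oplus>\<^bsub>M\<^esub> y) = f x \<oplus>\<^bsub>N\<^esub> f y"
    and single: "\<And>a g x. a \<in> carrier A \<Longrightarrow> g \<in> carrier G \<Longrightarrow> x \<in> carrier M \<Longrightarrow>
      f (skew_elem A a g \<odot>\<^bsub>M\<^esub> x) = skew_elem A a g \<odot>\<^bsub>N\<^esub> f x"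
  shows "f \<in> module_homs RG M N"
proof -
  interpret M: left_module RG M by fact
  interpret N: left_module RG N by fact
  have c: "f x \<in> carrier N" if "x \<in> carrier M" for x using f that by auto
  have zero: "f \<zero>\<^bsub>M\<^esub> = \<zero>\<^bsub>N\<^esub>"
    using add[of "\<zero>\<^bsub>M\<^esub>" "\<zero>\<^bsub>M\<^esub>"] c[of "\<zero>\<^bsub>M\<^esub>"]
    by (metis N.M.add.r_cancel_one' M.M.l_zero M.M.zero_closed)
  have "f (r \<odot>\<^bsub>M\<^esub> x) = r \<odot>\<^bsub>N\<^esub> f x" if "r \<in> carrier RG" "x \<in> carrier M" for r x
    using that
    by (induction rule: RG.single_induct)
      (simp_all add: single zero c add M.smult_closed M.smult_l_distr N.smult_l_distr)
  then show ?thesis using f add by (simp add: module_homs_def)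
qed

end

section \<open>Higman's lemma\<close>

text \<open>For a quasi-order this says that it is a well-quasi-order.\<close>

definition almost_full_on :: "('a \<Rightarrow> 'a \<Rightarrow> bool) \<Rightarrow> 'a set \<Rightarrow> bool"
  where "almost_full_on P A \<longleftrightarrow> (\<forall>f. (\<forall>i::nat. f i \<in> A) \<longrightarrow> (\<exists>i j. i < j \<and> P (f i) (f j)))"

lemma almost_full_onD:
  assumes "almost_full_on P A" "\<And>i::nat. f i \<in> A"
  obtains i j where "i < j" "P (f i) (f j)"
  using assms unfolding almost_full_on_def by blast

text \<open>Colour a pair of indices by whether the entries increase; a set of indices homogeneous for the
  other colour would be a sequence without an increasing pair.\<close>

lemma almost_full_on_subsequence:
  assumes P: "almost_full_on P A" and f: "\<And>i::nat. f i \<in> A"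
  obtains \<phi> :: "nat \<Rightarrow> nat" where "strict_mono \<phi>" "\<And>i j. i < j \<Longrightarrow> P (f (\<phi> i)) (f (\<phi> j))"
proof -
  define col where "col X = (if P (f (Min X)) (f (Max X)) then 0 else 1 :: nat)" for X
  have "\<exists>Y t. Y \<subseteq> (UNIV :: nat set) \<and> infinite Y \<and> t < 2 \<and> (\<forall>x\<in>Y. \<forall>y\<in>Y. x \<noteq> y \<longrightarrow> col {x, y} = t)"
    by (rule Ramsey2) (auto simp: col_def)
  then obtain Y t where Y: "infinite Y" "\<forall>x\<in>Y. \<forall>y\<in>Y. x \<noteq> y \<longrightarrow> col {x, y} = t"
    by (elim exE conjE)
  let ?e = "enumerate Y"
  have mono: "?e i < ?e j" if "i < j" for i j
    using strict_mono_enumerate[OF Y(1)] that by (simp add: strict_mono_def)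
  have col: "t = (if P (f (?e i)) (f (?e j)) then 0 else 1)" if "i < j" for i j
    using Y(2)[rule_format, of "?e i" "?e j"] mono[OF that] enumerate_in_set[OF Y(1)]
    by (simp add: col_def)
  have "t = 0"
    by (rule almost_full_onD[OF P, of "\<lambda>i. f (?e i)"]) (use f col in auto)
  then have "P (f (?e i)) (f (?e j))" if "i < j" for i j
    using col[OF that] by (simp split: if_splits)
  then show thesis
    using that[of ?e] strict_mono_enumerate[OF Y(1)] by blast
qed

lemma almost_full_on_times:
  assumes "almost_full_on P A" "almost_full_on Q B"
  shows "almost_full_on (\<lambda>x y. P (fst x) (fst y) \<and> Q (snd x) (snd y)) (A \<times> B)"
  unfolding almost_full_on_def
proof (intro allI impI)
  fix f :: "nat \<Rightarrow> 'a \<times> 'b" assume f: "\<forall>i. f i \<in> A \<times> B"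
  obtain \<phi> :: "nat \<Rightarrow> nat" where \<phi>: "strict_mono \<phi>" "\<And>i j. i < j \<Longrightarrow> P (fst (f (\<phi> i))) (fst (f (\<phi> j)))"
    using almost_full_on_subsequence[OF assms(1), of "\<lambda>i. fst (f i)"] f by (auto simp: mem_Times_iff)
  obtain i j where "i < j" "Q (snd (f (\<phi> i))) (snd (f (\<phi> j)))"
    using almost_full_onD[OF assms(2), of "\<lambda>i. snd (f (\<phi> i))"] f by (auto simp: mem_Times_iff)
  then show "\<exists>i j. i < j \<and> P (fst (f i)) (fst (f j)) \<and> Q (snd (f i)) (snd (f j))"
    using \<phi> strict_monoD by blast
qed

lemma almost_full_on_finite: "finite A \<Longrightarrow> almost_full_on (=) A"
  unfolding almost_full_on_def
proof (intro allI impI)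
  fix f :: "nat \<Rightarrow> 'a" assume "finite A" "\<forall>i. f i \<in> A"
  then have "\<not> inj f"
    by (metis finite_subset image_subsetI infinite_UNIV_nat finite_imageD)
  then obtain i j where "i \<noteq> j" "f i = f j" by (auto simp: inj_def)
  then show "\<exists>i j. i < j \<and> f i = f j"
    by (metis linorder_neqE_nat)
qed

lemma almost_full_on_nat: "almost_full_on (\<le>) (A :: nat set)"
  unfolding almost_full_on_def
proof (intro allI impI)
  fix f :: "nat \<Rightarrow> nat"
  obtain i where "\<forall>j. f i \<le> f j"
    using ex_has_least_nat[of "\<lambda>_. True" 0 f] by auto
  then show "\<exists>i j. i < j \<and> f i \<le> f j" by blast
qed

lemma almost_full_on_mono:
  "almost_full_on P A \<Longrightarrow> B \<subseteq> A \<Longrightarrow> (\<And>x y. x \<in> B \<Longrightarrow> y \<in> B \<Longrightarrow> P x y \<Longrightarrow> Q x y) \<Longrightarrow> almost_full_on Q B"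
  unfolding almost_full_on_def by (metis subsetD)

text \<open>Nash-Williams' minimal bad sequence: among the sequences without an increasing pair take one
  whose entries are successively as short as possible. Along a subsequence with increasing heads,
  replacing the lists by their tails gives another such sequence, with a shorter entry.\<close>

theorem higman:
  assumes P: "almost_full_on P A"
  shows "almost_full_on (list_emb P) (lists A)"
proof (rule ccontr)
  define bad where "bad f \<longleftrightarrow> (\<forall>i::nat. f i \<in> lists A) \<and> (\<forall>i j. i < j \<longrightarrow> \<not> list_emb P (f i) (f j))" for f
  define minimal where "minimal n f \<longleftrightarrow> bad f \<and> (\<forall>h. bad h \<and> (\<forall>i<n. h i = f i) \<longrightarrow> length (f n) \<le> length (h n))"
    for n f
  have refine: "\<exists>h. minimal n h \<and> (\<forall>i<n. h i = f i)" if "bad f" for f n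
  proof -
    obtain h where h: "bad h" "\<forall>i<n. h i = f i"
        "\<forall>h'. bad h' \<and> (\<forall>i<n. h' i = f i) \<longrightarrow> length (h n) \<le> length (h' n)"
      using ex_has_least_nat[of "\<lambda>h. bad h \<and> (\<forall>i<n. h i = f i)" f "\<lambda>h. length (h n)"] \<open>bad f\<close> by auto
    then show ?thesis by (intro exI[of _ h]) (simp add: minimal_def)
  qed
  assume "\<not> ?thesis"
  then obtain f0 where "bad f0" by (auto simp: almost_full_on_def bad_def)
  then have "\<exists>g. \<forall>n. minimal n (g n) \<and> (\<forall>i<Suc n. g (Suc n) i = g n i)"
    using refine[of f0 0] refine by (intro dependent_nat_choice) (auto simp: minimal_def)
  then obtain g where g: "minimal n (g n)" "i < Suc n \<Longrightarrow> g (Suc n) i = g n i" for n i by metis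
  define m where "m n = g n n" for n
  have m: "g n i = m i" if "i \<le> n" for n i
    using that by (induction n rule: dec_induct) (simp_all add: m_def g(2))
  have bad_m: "bad m"
    unfolding bad_def
  proof (intro conjI allI impI)
    show "m i \<in> lists A" for i using g(1)[of i] by (auto simp: m_def minimal_def bad_def)
    show "\<not> list_emb P (m i) (m j)" if "i < j" for i j
      using g(1)[of j] m[of i j] m[of j j] that by (metis bad_def less_imp_le minimal_def order_refl)
  qed
  have min_m: "length (m n) \<le> length (h n)" if "bad h" "\<And>i. i < n \<Longrightarrow> h i = m i" for h n
    using g(1)[of n] that m[of _ n] by (auto simp: minimal_def)
  have ne: "m n \<noteq> []" for n
    using bad_m by (metis bad_def lessI list_emb_Nil)
  have hd: "hd (m n) \<in> A" and tl: "tl (m n) \<in> lists A" for n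
    using bad_m ne[of n] by (auto simp: bad_def in_lists_conv_set dest: list.set_sel)
  obtain \<phi> :: "nat \<Rightarrow> nat" where \<phi>: "strict_mono \<phi>" "\<And>i j. i < j \<Longrightarrow> P (hd (m (\<phi> i))) (hd (m (\<phi> j)))"
    using almost_full_on_subsequence[OF P, of "\<lambda>n. hd (m n)"] hd by blast
  define h where "h i = (if i < \<phi> 0 then m i else tl (m (\<phi> (i - \<phi> 0))))" for i
  have "bad h"
    unfolding bad_def
  proof (intro conjI allI impI)
    show "h i \<in> lists A" for i using bad_m tl by (auto simp: h_def bad_def)
    fix i j :: nat assume "i < j"
    consider "j < \<phi> 0" | "i < \<phi> 0" "\<phi> 0 \<le> j" | "\<phi> 0 \<le> i" using \<open>i < j\<close> by linarith
    then show "\<not> list_emb P (h i) (h j)"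
    proof cases
      case 1
      then show ?thesis using bad_m \<open>i < j\<close> by (simp add: h_def bad_def)
    next
      case 2
      let ?k = "\<phi> (j - \<phi> 0)"
      have "i < ?k" using 2 strict_mono_less_eq[OF \<phi>(1)] by (meson le0 less_le_trans)
      then have "\<not> list_emb P (m i) (hd (m ?k) # tl (m ?k))" using bad_m ne by (simp add: bad_def)
      then show ?thesis using 2 by (auto simp: h_def)
    next
      case 3
      let ?k = "\<phi> (i - \<phi> 0)" and ?l = "\<phi> (j - \<phi> 0)"
      have "i - \<phi> 0 < j - \<phi> 0" using 3 \<open>i < j\<close> by simp
      then have "?k < ?l" "P (hd (m ?k)) (hd (m ?l))" using \<phi> by (auto dest: strict_monoD)
      then have "\<not> list_emb P (hd (m ?k) # tl (m ?k)) (hd (m ?l) # tl (m ?l))"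
        using bad_m ne by (simp add: bad_def)
      then show ?thesis using 3 \<open>i < j\<close> \<open>P (hd (m ?k)) (hd (m ?l))\<close> by (auto simp: h_def)
    qed
  qed
  then have "length (m (\<phi> 0)) \<le> length (h (\<phi> 0))"
    by (rule min_m) (simp add: h_def)
  then show False using ne[of "\<phi> 0"] by (cases "m (\<phi> 0)") (simp_all add: h_def)
qed

section \<open>A Noetherian criterion\<close>

text \<open>The span over a set \<open>K\<close> of scalars, which below is the image of the coefficient ring \<open>k\<close> in the much
  larger ring of scalars of \<open>M\<close>.\<close>

inductive_set scalar_span :: "('r, 'm, 'd) module_scheme \<Rightarrow> 'r set \<Rightarrow> 'm set \<Rightarrow> 'm set"
  for M K U where
  zero: "\<zero>\<^bsub>M\<^esub> \<in> scalar_span M K U"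
| add: "c \<in> K \<Longrightarrow> u \<in> U \<Longrightarrow> y \<in> scalar_span M K U \<Longrightarrow> c \<odot>\<^bsub>M\<^esub> u \<oplus>\<^bsub>M\<^esub> y \<in> scalar_span M K U"

lemma scalar_span_mono: "U \<subseteq> U' \<Longrightarrow> x \<in> scalar_span M K U \<Longrightarrow> x \<in> scalar_span M K U'"
  by (rotate_tac, induction rule: scalar_span.induct) (auto intro: scalar_span.intros)

context left_module
begin

lemma scalar_span_closed:
  assumes "K \<subseteq> carrier R" "U \<subseteq> carrier M" "x \<in> scalar_span M K U"
  shows "x \<in> carrier M"
  using assms(3) by induction (use assms(1,2) in \<open>simp_all add: smult_closed subset_iff\<close>)

lemma scalar_span_add:
  assumes "K \<subseteq> carrier R" "U \<subseteq> carrier M" "x \<in> scalar_span M K U" "y \<in> scalar_span M K U"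
  shows "x \<oplus>\<^bsub>M\<^esub> y \<in> scalar_span M K U"
  using assms(3)
proof induction
  case zero
  then show ?case using assms(4) scalar_span_closed[OF assms(1,2)] by simp
next
  case (add c u z)
  then have "c \<odot>\<^bsub>M\<^esub> u \<oplus>\<^bsub>M\<^esub> (z \<oplus>\<^bsub>M\<^esub> y) \<in> scalar_span M K U" by (blast intro: scalar_span.add)
  moreover have "c \<odot>\<^bsub>M\<^esub> u \<in> carrier M" "z \<in> carrier M" "y \<in> carrier M"
    using add assms scalar_span_closed[OF assms(1,2)] by (simp_all add: smult_closed subset_iff)
  ultimately show ?case by (simp add: M.a_assoc)
qed

lemma scalar_span_scalar:
  assumes K: "K \<subseteq> carrier R" and U: "U \<subseteq> carrier M" and mult: "\<And>c d. c \<in> K \<Longrightarrow> d \<in> K \<Longrightarrow> c \<otimes>\<^bsub>R\<^esub> d \<in> K"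
    and c: "c \<in> K" and x: "x \<in> scalar_span M K U"
  shows "c \<odot>\<^bsub>M\<^esub> x \<in> scalar_span M K U"
  using x
proof induction
  case zero
  have "c \<in> carrier R" using c K by blast
  then show ?case by (simp add: scalar_span.zero)
next
  case (add d u z)
  have "c \<in> carrier R" "d \<in> carrier R" "u \<in> carrier M" "z \<in> carrier M"
    using add c K U scalar_span_closed[OF K U] by auto
  then have "c \<odot>\<^bsub>M\<^esub> (d \<odot>\<^bsub>M\<^esub> u \<oplus>\<^bsub>M\<^esub> z) = (c \<otimes>\<^bsub>R\<^esub> d) \<odot>\<^bsub>M\<^esub> u \<oplus>\<^bsub>M\<^esub> c \<odot>\<^bsub>M\<^esub> z"
    by (simp add: smult_r_distr smult_closed smult_assoc)
  then show ?case using scalar_span.add[OF mult[OF c add(1)] add(2) add.IH] by simp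
qed

lemma scalar_span_smult:
  assumes K: "K \<subseteq> carrier R" and U: "U \<subseteq> carrier M" "U' \<subseteq> carrier M" and r: "r \<in> carrier R"
    and commute: "\<And>c. c \<in> K \<Longrightarrow> r \<otimes>\<^bsub>R\<^esub> c = c \<otimes>\<^bsub>R\<^esub> r"
    and maps: "\<And>u. u \<in> U \<Longrightarrow> r \<odot>\<^bsub>M\<^esub> u \<in> U'"
    and x: "x \<in> scalar_span M K U"
  shows "r \<odot>\<^bsub>M\<^esub> x \<in> scalar_span M K U'"
  using x
proof induction
  case zero
  then show ?case using r by (auto intro: scalar_span.zero)
next
  case (add c u z)
  have "u \<in> carrier M" "c \<in> carrier R" "z \<in> carrier M"
    using add K U scalar_span_closed[OF K U(1)] by auto
  then have "r \<odot>\<^bsub>M\<^esub> (c \<odot>\<^bsub>M\<^esub> u \<oplus>\<^bsub>M\<^esub> z) = c \<odot>\<^bsub>M\<^esub> (r \<odot>\<^bsub>M\<^esub> u) \<oplus>\<^bsub>M\<^esub> r \<odot>\<^bsub>M\<^esub> z"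
    using r commute[OF add(1)] by (simp add: smult_r_distr smult_closed flip: smult_assoc)
  then show ?case using add maps by (auto intro: scalar_span.add)
qed

end

text \<open>An abstract Groebner setting. The elements \<open>hat b\<close> play the role of the monomials of a polynomial
  ring over \<open>k\<close>, \<open>less\<close> that of the monomial order, \<open>le\<close> that of divisibility (a well-quasi-order by
  Dickson's lemma), and the multiplier \<open>r\<close> that of the monomial by which \<open>hat b\<close> is
  multiplied to reach its multiple \<open>hat b'\<close>. The order is total only on suitable subsets of \<open>B\<close>: below a
  given symbol, and on a set of symbols spanning a given element.\<close>

locale ordered_spanning_family = left_module R M + k: cring k + k: noetherian_ring k + \<kappa>: ring_hom_ring k R \<kappa>
  for R :: "('r, 'c) ring_scheme" and M :: "('r, 'm, 'd) module_scheme" (structure)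
    and k :: "('k, 'e) ring_scheme" and \<kappa> :: "'k \<Rightarrow> 'r" +
  fixes B :: "'b set" and hat :: "'b \<Rightarrow> 'm" and less :: "'b \<Rightarrow> 'b \<Rightarrow> bool" and le :: "'b \<Rightarrow> 'b \<Rightarrow> bool"
  assumes hat_closed: "b \<in> B \<Longrightarrow> hat b \<in> carrier M"
    and less_trans: "less a b \<Longrightarrow> less b c \<Longrightarrow> less a c"
    and wf_less: "wfP less"
    and less_total_below: "\<lbrakk>a \<in> B; b \<in> B; c \<in> B; less a c; less b c\<rbrakk> \<Longrightarrow> a = b \<or> less a b \<or> less b a"
    and spanning: "x \<in> carrier M \<Longrightarrow> \<exists>X\<subseteq>B. totalp_on X less \<and> x \<in> scalar_span M (\<kappa> ` carrier k) (hat ` X)"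
    and le: "almost_full_on le B"
    and multiplier: "\<lbrakk>b \<in> B; b' \<in> B; le b b'\<rbrakk> \<Longrightarrow>
      \<exists>r\<in>carrier R. (\<forall>a\<in>carrier k. r \<otimes>\<^bsub>R\<^esub> \<kappa> a = \<kappa> a \<otimes>\<^bsub>R\<^esub> r) \<and> r \<odot> hat b = hat b' \<and>
        (\<forall>c\<in>B. less c b \<longrightarrow> (\<exists>c'\<in>B. less c' b' \<and> r \<odot> hat c = hat c'))"
begin

definition below :: "'b \<Rightarrow> 'm set"
  where "below b = scalar_span M (\<kappa> ` carrier k) (hat ` {c \<in> B. less c b})"

text \<open>This is a relation, not a leading coefficient function, because the elements \<open>hat b\<close> may be linearly
  dependent over \<open>k\<close>; an element can have several leading terms.\<close>

definition leading :: "'b \<Rightarrow> 'k \<Rightarrow> 'm \<Rightarrow> bool"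
  where "leading b a x \<longleftrightarrow> a \<in> carrier k \<and> (\<exists>z\<in>below b. x = \<kappa> a \<odot> hat b \<oplus> z)"

lemma K_closed: "\<kappa> ` carrier k \<subseteq> carrier R"
  by auto

lemma below_closed: "x \<in> below b \<Longrightarrow> x \<in> carrier M"
  unfolding below_def by (rule scalar_span_closed[OF K_closed]) (auto simp: hat_closed)

lemma below_zero: "\<zero> \<in> below b"
  unfolding below_def by (rule scalar_span.zero)

lemma below_add: "x \<in> below b \<Longrightarrow> y \<in> below b \<Longrightarrow> x \<oplus> y \<in> below b"
  unfolding below_def by (rule scalar_span_add[OF K_closed]) (auto simp: hat_closed)

lemma below_smult: "a \<in> carrier k \<Longrightarrow> x \<in> below b \<Longrightarrow> \<kappa> a \<odot> x \<in> below b"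
  unfolding below_def
  by (rule scalar_span_scalar[OF K_closed])
    (auto simp: hat_closed simp flip: \<kappa>.hom_mult)

lemma below_minus: "x \<in> below b \<Longrightarrow> y \<in> below b \<Longrightarrow> x \<ominus> y \<in> below b"
  using below_add[of x b "\<kappa> (\<ominus>\<^bsub>k\<^esub> \<one>\<^bsub>k\<^esub>) \<odot> y"] below_smult[of "\<ominus>\<^bsub>k\<^esub> \<one>\<^bsub>k\<^esub>" y b] below_closed[of y b]
  by (simp add: a_minus_def smult_minus_one)

lemma below_hat: "a \<in> carrier k \<Longrightarrow> c \<in> B \<Longrightarrow> less c b \<Longrightarrow> y \<in> below b \<Longrightarrow>
    \<kappa> a \<odot> hat c \<oplus> y \<in> below b"
  unfolding below_def by (rule scalar_span.add) auto

lemma below_mono: "less b c \<Longrightarrow> x \<in> below b \<Longrightarrow> x \<in> below c"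
  unfolding below_def by (rule scalar_span_mono) (auto intro: less_trans)

lemma leading_exists:
  assumes X: "X \<subseteq> B" "totalp_on X less" and x: "x \<in> scalar_span M (\<kappa> ` carrier k) (hat ` X)" "x \<noteq> \<zero>"
  shows "\<exists>b\<in>X. \<exists>a. leading b a x"
  using x
proof induction
  case zero
  then show ?case by simp
next
  case (add d u y)
  then obtain a c where d: "d = \<kappa> a" "a \<in> carrier k" and u: "u = hat c" "c \<in> X" by auto
  then have c: "c \<in> B" using X by blast
  show ?case
  proof (cases "y = \<zero>")
    case True
    then have "leading c a (d \<odot> u \<oplus> y)" using d u below_zero by (auto simp: leading_def)
    then show ?thesis using u by blast
  next
    case False
    then obtain c' a' z where c': "c' \<in> X" and a': "a' \<in> carrier k" and z: "z \<in> below c'"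
        and y: "y = \<kappa> a' \<odot> hat c' \<oplus> z"
      using add.IH by (auto simp: leading_def)
    have c'B: "c' \<in> B" using c' X by blast
    have closed: "\<kappa> a \<odot> hat c \<in> carrier M" "\<kappa> a' \<odot> hat c' \<in> carrier M" "z \<in> carrier M"
      using c c'B d a' hat_closed below_closed[OF z] by (auto simp: smult_closed)
    consider "c = c'" | "less c c'" | "less c' c"
      using X(2) u(2) c' by (auto simp: totalp_on_def)
    then show ?thesis
    proof cases
      case 1
      have "d \<odot> u \<oplus> y = \<kappa> (a \<oplus>\<^bsub>k\<^esub> a') \<odot> hat c \<oplus> z"
        using 1 d u y closed a' c hat_closed by (simp add: smult_l_distr M.a_assoc)
      then have "leading c (a \<oplus>\<^bsub>k\<^esub> a') (d \<odot> u \<oplus> y)"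
        unfolding leading_def using 1 z k.a_closed[OF d(2) a'] by blast
      then show ?thesis using u by blast
    next
      case 2
      have "d \<odot> u \<oplus> y = \<kappa> a' \<odot> hat c' \<oplus> (\<kappa> a \<odot> hat c \<oplus> z)"
        using d u y closed by (simp add: M.a_lcomm)
      moreover have "\<kappa> a \<odot> hat c \<oplus> z \<in> below c'" using below_hat[OF d(2) c 2 z] .
      ultimately show ?thesis using c' a' by (auto simp: leading_def)
    next
      case 3
      have "y \<in> below c" unfolding y using below_hat[OF a' c'B 3 below_mono[OF 3 z]] .
      then show ?thesis using d u by (auto simp: leading_def)
    qed
  qed
qed

text \<open>If \<open>N\<close> is not finitely generated, choose successively elements of \<open>N\<close> outside the submodule
  generated by their predecessors, each time with a minimal leading symbol. Along a
  subsequence the leading symbols increase for \<open>le\<close>, and there some leading coefficient lies in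
  the ideal of the preceding ones, as \<open>k\<close> is Noetherian. Multiplying the predecessors so that their leading
  symbols become that of the current element, one can cancel its leading term, which contradicts
  minimality.\<close>

theorem submodule_finitely_generated:
  assumes N: "submodule N R M"
  shows "\<exists>A\<subseteq>carrier M. finite A \<and> N = generated_submodule R M A"
proof (rule ccontr)
  assume not_fg: "\<not> ?thesis"
  let ?gen = "generated_submodule R M"
  note N_sub = submoduleD(1)[OF N]
  define missed where "missed A b a x \<longleftrightarrow> b \<in> B \<and> leading b a x \<and> x \<in> N \<and> x \<notin> ?gen A" for A b a x
  have ex_missed: "\<exists>b a x. missed A b a x" if A: "finite A" "A \<subseteq> N" for A
  proof -
    have "?gen A \<subseteq> N" by (rule generated_minimal[OF N A(2)])
    moreover have "?gen A \<noteq> N" using not_fg A N_sub by blast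
    ultimately obtain x where x: "x \<in> N" "x \<notin> ?gen A" by blast
    then have "x \<noteq> \<zero>"
      using submoduleD(2)[OF submodule_generated, of A] A N_sub by blast
    moreover obtain X where "X \<subseteq> B" "totalp_on X less" "x \<in> scalar_span M (\<kappa> ` carrier k) (hat ` X)"
      using spanning x N_sub by blast
    ultimately show ?thesis
      using leading_exists[of X x] x by (auto simp: missed_def)
  qed
  have "\<exists>t. case t of (b, a, x) \<Rightarrow> missed A b a x \<and> (\<forall>c a' x'. less c b \<longrightarrow> \<not> missed A c a' x')"
    if A: "finite A" "A \<subseteq> N" for A
  proof -
    obtain b0 a0 x0 where "missed A b0 a0 x0" using ex_missed[OF A] by blast
    then have "b0 \<in> {b. \<exists>a x. missed A b a x}" by blast
    then obtain b where "b \<in> {b. \<exists>a x. missed A b a x}"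
        "\<And>c. less c b \<Longrightarrow> c \<notin> {b. \<exists>a x. missed A b a x}"
      by (rule wfE_min[to_pred, OF wf_less]) blast
    then show ?thesis by auto
  qed
  note ex_least = this
  define F where "F A = (SOME t. case t of (b, a, x) \<Rightarrow>
      missed A b a x \<and> (\<forall>c a' x'. less c b \<longrightarrow> \<not> missed A c a' x'))" for A
  have F: "case F A of (b, a, x) \<Rightarrow> missed A b a x \<and> (\<forall>c a' x'. less c b \<longrightarrow> \<not> missed A c a' x')"
    if A: "finite A" "A \<subseteq> N" for A
    unfolding F_def by (rule someI_ex[OF ex_least[OF A]])
  define As where "As = rec_nat {} (\<lambda>_ A. insert (snd (snd (F A))) A)"
  have As_0: "As 0 = {}" and As_Suc: "As (Suc n) = insert (snd (snd (F (As n)))) (As n)" for n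
    by (simp_all add: As_def)
  define b where "b n = fst (F (As n))" for n
  define a where "a n = fst (snd (F (As n)))" for n
  define x where "x n = snd (snd (F (As n)))" for n
  have As: "finite (As n) \<and> As n \<subseteq> N" for n
  proof (induction n)
    case (Suc n)
    then show ?case using F[of "As n"] by (auto simp: As_Suc missed_def split: prod.splits)
  qed (simp add: As_0)
  have missed: "missed (As n) (b n) (a n) (x n)" and least: "less c (b n) \<Longrightarrow> \<not> missed (As n) c a' x'" for n c a' x'
    using F[of "As n"] As[of n] by (auto simp: b_def a_def x_def split: prod.splits)
  have As_mono: "m \<le> n \<Longrightarrow> As m \<subseteq> As n" for m n
    by (rule lift_Suc_mono_le[of As]) (auto simp: As_Suc)
  have x_in_As: "x m \<in> As n" if "m < n" for m n
    using As_mono[of "Suc m" n] that by (auto simp: As_Suc x_def)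
  obtain \<phi> :: "nat \<Rightarrow> nat" where \<phi>: "strict_mono \<phi>" "\<And>i j. i < j \<Longrightarrow> le (b (\<phi> i)) (b (\<phi> j))"
    using almost_full_on_subsequence[OF le, of b] missed by (auto simp: missed_def)
  have a_closed: "a n \<in> carrier k" for n using missed[of n] by (auto simp: missed_def leading_def)
  define J where "J n = genideal k ((\<lambda>i. a (\<phi> i)) ` {..<n})" for n
  have J_sub: "(\<lambda>i. a (\<phi> i)) ` {..<n} \<subseteq> J n" for n
    unfolding J_def by (rule k.genideal_self) (auto simp: a_closed)
  have J_ideal: "ideal (J n) k" for n
    unfolding J_def by (rule k.genideal_ideal) (auto simp: a_closed)
  have J_mono: "J m \<subseteq> J n" if "m \<le> n" for m n
    unfolding J_def
    by (rule k.genideal_minimal) (use J_ideal[of n] J_sub[of n] that in \<open>auto simp: J_def\<close>)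
  have "\<Union>(range J) \<in> range J"
  proof (rule k.ideal_chain_is_trivial)
    show "subset.chain {I. ideal I k} (range J)"
      using J_ideal J_mono by (auto simp: subset_chain_def) (meson nat_le_linear subsetD)
  qed simp
  then obtain n where n: "\<Union>(range J) = J n" by auto
  then have a_J: "a (\<phi> n) \<in> J n" using J_sub[of "Suc n"] by auto
  let ?A = "As (\<phi> n)" and ?b = "b (\<phi> n)"
  have b_B: "b m \<in> B" for m using missed[of m] by (auto simp: missed_def)
  have gen: "submodule (?gen ?A) R M" using As[of "\<phi> n"] N_sub by (intro submodule_generated) auto
  \<comment> \<open>the coefficients at the symbol \<open>b (\<phi> n)\<close> that the elements chosen before can produce; an ideal
    containing their leading coefficients, so no explicit linear combination has to be written down\<close>
  define L where "L = {c \<in> carrier k. \<exists>y\<in>?gen ?A. \<exists>z\<in>below ?b. y = \<kappa> c \<odot> hat ?b \<oplus> z}"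
  note hb = hat_closed[OF b_B[of "\<phi> n"]]
  have L_smult: "d \<otimes>\<^bsub>k\<^esub> c \<in> L" if "c \<in> L" "d \<in> carrier k" for c d
  proof -
    obtain y z where "c \<in> carrier k" "y \<in> ?gen ?A" "z \<in> below ?b" "y = \<kappa> c \<odot> hat ?b \<oplus> z"
      using \<open>c \<in> L\<close> by (auto simp: L_def)
    moreover from this have "\<kappa> d \<odot> y = \<kappa> (d \<otimes>\<^bsub>k\<^esub> c) \<odot> hat ?b \<oplus> \<kappa> d \<odot> z"
      using hb that below_closed by (simp add: smult_r_distr smult_closed smult_assoc)
    moreover have "\<kappa> d \<odot> y \<in> ?gen ?A"
      using submoduleD(4)[OF gen] \<open>y \<in> ?gen ?A\<close> that by simp
    ultimately show ?thesis using that below_smult[of d z ?b] unfolding L_def by blast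
  qed
  have L_add: "c \<oplus>\<^bsub>k\<^esub> d \<in> L" if "c \<in> L" "d \<in> L" for c d
  proof -
    obtain y z where yz: "c \<in> carrier k" "y \<in> ?gen ?A" "z \<in> below ?b" "y = \<kappa> c \<odot> hat ?b \<oplus> z"
      using \<open>c \<in> L\<close> by (auto simp: L_def)
    obtain y' z' where yz': "d \<in> carrier k" "y' \<in> ?gen ?A" "z' \<in> below ?b" "y' = \<kappa> d \<odot> hat ?b \<oplus> z'"
      using \<open>d \<in> L\<close> by (auto simp: L_def)
    have "y \<oplus> y' = \<kappa> (c \<oplus>\<^bsub>k\<^esub> d) \<odot> hat ?b \<oplus> (z \<oplus> z')"
      using yz yz' hb below_closed by (simp add: smult_l_distr smult_closed M.a_ac)
    moreover have "y \<oplus> y' \<in> ?gen ?A" using submoduleD(3)[OF gen] yz yz' by simp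
    ultimately show ?thesis using yz yz' below_add[of z ?b z'] unfolding L_def by blast
  qed
  have L_zero: "\<zero>\<^bsub>k\<^esub> \<in> L"
    using submoduleD(2)[OF gen] below_zero[of ?b] hb by (force simp: L_def)
  have L_sub: "L \<subseteq> carrier k" by (auto simp: L_def)
  have "ideal L k"
  proof (rule idealI)
    show "subgroup L (add_monoid k)"
    proof (rule subgroup.intro)
      fix c assume c: "c \<in> L"
      then have "\<ominus>\<^bsub>k\<^esub> c = (\<ominus>\<^bsub>k\<^esub> \<one>\<^bsub>k\<^esub>) \<otimes>\<^bsub>k\<^esub> c" using L_sub by (auto simp: k.l_minus)
      then show "inv\<^bsub>add_monoid k\<^esub> c \<in> L" using L_smult[OF c, of "\<ominus>\<^bsub>k\<^esub> \<one>\<^bsub>k\<^esub>"] by (simp add: a_inv_def)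
    qed (use L_add L_zero L_sub in auto)
  qed (use L_smult L_sub k.m_comm k.ring_axioms in \<open>simp_all add: subset_iff\<close>)
  moreover have "(\<lambda>i. a (\<phi> i)) ` {..<n} \<subseteq> L"
  proof clarify
    fix i assume i: "i < n"
    obtain z where z: "z \<in> below (b (\<phi> i))" "x (\<phi> i) = \<kappa> (a (\<phi> i)) \<odot> hat (b (\<phi> i)) \<oplus> z"
      using missed[of "\<phi> i"] by (auto simp: missed_def leading_def)
    obtain r where r: "r \<in> carrier R" "\<forall>a\<in>carrier k. r \<otimes>\<^bsub>R\<^esub> \<kappa> a = \<kappa> a \<otimes>\<^bsub>R\<^esub> r" "r \<odot> hat (b (\<phi> i)) = hat ?b"
        "\<forall>c\<in>B. less c (b (\<phi> i)) \<longrightarrow> (\<exists>c'\<in>B. less c' ?b \<and> r \<odot> hat c = hat c')"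
      using multiplier[OF b_B b_B \<phi>(2)[OF i]] by blast
    have "r \<odot> x (\<phi> i) = \<kappa> (a (\<phi> i)) \<odot> hat ?b \<oplus> r \<odot> z"
      using z r(1-3) a_closed hat_closed[OF b_B] below_closed[OF z(1)]
      by (simp add: smult_r_distr smult_closed flip: smult_assoc) (simp add: smult_assoc hat_closed[OF b_B])
    moreover have "r \<odot> z \<in> below ?b"
      unfolding below_def
      by (rule scalar_span_smult[OF K_closed _ _ r(1) _ _ z(1)[unfolded below_def]])
        (use r(2,4) in \<open>auto simp: hat_closed\<close>)
    moreover have "r \<odot> x (\<phi> i) \<in> ?gen ?A"
      using x_in_As[of "\<phi> i" "\<phi> n"] strict_monoD[OF \<phi>(1) i] generated_subset[of ?A]
        submoduleD(4)[OF gen r(1)] by blast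
    ultimately show "a (\<phi> i) \<in> L" using a_closed by (auto simp: L_def)
  qed
  ultimately have "J n \<subseteq> L" unfolding J_def by (rule k.genideal_minimal)
  then obtain y z where y: "y \<in> ?gen ?A" and z: "z \<in> below ?b" and yz: "y = \<kappa> (a (\<phi> n)) \<odot> hat ?b \<oplus> z"
    using a_J by (auto simp: L_def)
  let ?x = "x (\<phi> n)"
  obtain z' where z': "z' \<in> below ?b" "?x = \<kappa> (a (\<phi> n)) \<odot> hat ?b \<oplus> z'"
    using missed[of "\<phi> n"] by (auto simp: missed_def leading_def)
  have yN: "y \<in> N" using generated_minimal[OF N, of ?A] As[of "\<phi> n"] y by blast
  have xN: "?x \<in> N" "?x \<notin> ?gen ?A" using missed[of "\<phi> n"] by (auto simp: missed_def)
  have xy_closed: "?x \<in> carrier M" "y \<in> carrier M" using yN xN N_sub by auto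
  have diff_N: "?x \<ominus> y \<in> N" by (rule submodule_minus[OF N xN(1) yN])
  have diff_gen: "?x \<ominus> y \<notin> ?gen ?A"
  proof
    assume "?x \<ominus> y \<in> ?gen ?A"
    then have "(?x \<ominus> y) \<oplus> y \<in> ?gen ?A" using submoduleD(3)[OF gen] y by blast
    then show False using xN(2) xy_closed by (simp add: a_minus_def M.a_assoc M.l_neg)
  qed
  have "?x \<ominus> y = z' \<ominus> z"
  proof -
    have c: "\<kappa> (a (\<phi> n)) \<odot> hat ?b \<in> carrier M" "z \<in> carrier M" "z' \<in> carrier M"
      using hb a_closed below_closed z z' by (auto simp: smult_closed)
    then show ?thesis
      unfolding z'(2) yz a_minus_def
      by (simp add: M.minus_add M.a_ac) (simp add: M.a_assoc[symmetric] M.r_neg)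
  qed
  then have "?x \<ominus> y \<in> below ?b" using below_minus[OF z'(1) z] by simp
  moreover have "?x \<ominus> y \<noteq> \<zero>" using diff_gen submoduleD(2)[OF gen] by metis
  moreover have "totalp_on {c \<in> B. less c ?b} less"
    using less_total_below[OF _ _ b_B[of "\<phi> n"]] by (auto simp: totalp_on_def)
  ultimately have "\<exists>c\<in>{c \<in> B. less c ?b}. \<exists>a'. leading c a' (?x \<ominus> y)"
    unfolding below_def by (intro leading_exists) auto
  then obtain c a' where "c \<in> B" "less c ?b" "leading c a' (?x \<ominus> y)" by blast
  then show False using least[of c "\<phi> n" a' "?x \<ominus> y"] diff_N diff_gen by (simp add: missed_def)
qed

end

section \<open>Discrete modules\<close>

locale polynomial_action = k: cring k + group_action G S \<phi>
  for k :: "('k, 'c) ring_scheme" and S :: "'s set" and G :: "('g, 'd) monoid_scheme"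
    and \<phi> :: "'g \<Rightarrow> 's \<Rightarrow> 's"
begin

sublocale G: group G
  using group_hom by (simp add: group_hom_def)

lemma perm_Bij: "g \<in> carrier G \<Longrightarrow> \<phi> g \<in> Bij S"
  by (rule bij_prop0)

lemma perm_mult:
  assumes "g \<in> carrier G" "h \<in> carrier G"
  shows "\<phi> (g \<otimes>\<^bsub>G\<^esub> h) = compose S (\<phi> g) (\<phi> h)"
  using group_hom.hom_mult[OF group_hom assms] assms by (simp add: BijGroup_def perm_Bij)

lemma perm_one: "\<phi> \<one>\<^bsub>G\<^esub> = (\<lambda>s\<in>S. s)"
  by (simp add: id_eq_one)

lemma image_closed: "g \<in> carrier G \<Longrightarrow> s \<in> S \<Longrightarrow> \<phi> g s \<in> S"
  using element_image by blast

lemma perm_inv: "g \<in> carrier G \<Longrightarrow> s \<in> S \<Longrightarrow> \<phi> g s = t \<Longrightarrow> \<phi> (inv\<^bsub>G\<^esub> g) t = s"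
  by (rule orbit_sym_aux)

abbreviation "P \<equiv> poly_ring_on k S"
abbreviation "R \<equiv> skew_poly_ring k S G \<phi>"

sublocale P: cring P
  by (rule k.cring_poly_ring)

sublocale skew: skew_action P G "\<lambda>g. perm_poly k S (\<phi> g)"
  by unfold_locales
    (simp_all add: perm_Bij k.perm_poly_closed k.perm_poly_add k.perm_poly_mult k.perm_poly_one
      perm_mult k.perm_poly_compose perm_one k.perm_poly_id del: restrict_apply)

lemma R_eq: "R = skew_group_ring P G (\<lambda>g. perm_poly k S (\<phi> g))"
  by (simp add: skew_poly_ring_def)

abbreviation Stab :: "'s set \<Rightarrow> 'g set"
  where "Stab \<equiv> pointwise_stabilizer G \<phi>"

lemma stabilizer_mult_closed:
  "\<lbrakk>T \<subseteq> S; g \<in> Stab T; h \<in> Stab T\<rbrakk> \<Longrightarrow>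
    g \<otimes>\<^bsub>G\<^esub> h \<in> Stab T"
  by (auto simp: pointwise_stabilizer_def composition_rule subset_iff)

lemma one_in_stabilizer: "T \<subseteq> S \<Longrightarrow> \<one>\<^bsub>G\<^esub> \<in> Stab T"
  by (auto simp: pointwise_stabilizer_def perm_one)

lemma stabilizer_topology_neighbourhood:
  assumes "openin (stabilizer_topology S G \<phi>) U" and "g \<in> U"
  shows "\<exists>T. finite T \<and> T \<subseteq> S \<and> g <#\<^bsub>G\<^esub> Stab T \<subseteq> U"
proof -
  have "generate_topology_on
      {g <#\<^bsub>G\<^esub> Stab T | g T. g \<in> carrier G \<and> finite T \<and> T \<subseteq> S} U"
    using assms(1) unfolding stabilizer_topology_def openin_topology_generated_by_iff .
  then show ?thesis
    using assms(2)
  proof (induction arbitrary: g rule: generate_topology_on.induct)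
    case Empty
    then show ?case by simp
  next
    case (Int U V)
    then obtain T T' where T: "finite T" "T \<subseteq> S" "g <#\<^bsub>G\<^esub> Stab T \<subseteq> U"
        "finite T'" "T' \<subseteq> S" "g <#\<^bsub>G\<^esub> Stab T' \<subseteq> V"
      by (meson IntD1 IntD2)
    moreover have "g <#\<^bsub>G\<^esub> Stab (T \<union> T') \<subseteq> g <#\<^bsub>G\<^esub> Stab T"
        "g <#\<^bsub>G\<^esub> Stab (T \<union> T') \<subseteq> g <#\<^bsub>G\<^esub> Stab T'"
      by (auto simp: pointwise_stabilizer_def l_coset_def)
    ultimately have "g <#\<^bsub>G\<^esub> Stab (T \<union> T') \<subseteq> U \<inter> V" by blast
    moreover have "finite (T \<union> T')" "T \<union> T' \<subseteq> S" using T by simp_all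
    ultimately show ?case by blast
  next
    case (UN K)
    then obtain V T where "V \<in> K" "finite T" "T \<subseteq> S" "g <#\<^bsub>G\<^esub> Stab T \<subseteq> V"
      by (metis UnionE)
    then show ?case by blast
  next
    case (Basis V)
    then obtain h T where V: "V = h <#\<^bsub>G\<^esub> Stab T" and h: "h \<in> carrier G"
        and T: "finite T" "T \<subseteq> S" by auto
    obtain s where s: "s \<in> Stab T" "g = h \<otimes>\<^bsub>G\<^esub> s"
      using Basis(2) V by (auto simp: l_coset_def)
    have "g <#\<^bsub>G\<^esub> Stab T \<subseteq> V"
    proof
      fix x assume "x \<in> g <#\<^bsub>G\<^esub> Stab T"
      then obtain s' where s': "s' \<in> Stab T" "x = g \<otimes>\<^bsub>G\<^esub> s'"
        by (auto simp: l_coset_def)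
      then have "x = h \<otimes>\<^bsub>G\<^esub> (s \<otimes>\<^bsub>G\<^esub> s')"
        using s h by (simp add: pointwise_stabilizer_def G.m_assoc)
      then show "x \<in> V"
        using stabilizer_mult_closed[OF T(2) s(1) s'(1)] by (auto simp: V l_coset_def)
    qed
    then show ?case using T by blast
  qed
qed

lemma topspace_stabilizer_topology: "topspace (stabilizer_topology S G \<phi>) = carrier G"
proof -
  have "g \<in> g <#\<^bsub>G\<^esub> Stab {}" if "g \<in> carrier G" for g
    using that one_in_stabilizer[of "{}"] by (force simp: l_coset_def)
  then have "carrier G \<subseteq> topspace (stabilizer_topology S G \<phi>)"
    unfolding stabilizer_topology_def topology_generated_by_topspace by blast
  moreover have "topspace (stabilizer_topology S G \<phi>) \<subseteq> carrier G"
    unfolding stabilizer_topology_def topology_generated_by_topspace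
    by (auto simp: l_coset_def pointwise_stabilizer_def)
  ultimately show ?thesis by blast
qed

end

definition scalar_action ::
    "('k, 'c) ring_scheme \<Rightarrow> 's set \<Rightarrow> ('g, 'd) monoid_scheme \<Rightarrow>
      ('g \<Rightarrow> 's multiset \<Rightarrow> 'k, 'm, 'e) module_scheme \<Rightarrow> ('s multiset \<Rightarrow> 'k) \<Rightarrow> 'm \<Rightarrow> 'm"
  where "scalar_action k S G V p v = skew_elem (poly_ring_on k S) p \<one>\<^bsub>G\<^esub> \<odot>\<^bsub>V\<^esub> v"

locale polynomial_skew_module = polynomial_action k S G \<phi> + left_module "skew_poly_ring k S G \<phi>" V
  for k :: "('k, 'c) ring_scheme" and S :: "'s set" and G :: "('g, 'd) monoid_scheme"
    and \<phi> :: "'g \<Rightarrow> 's \<Rightarrow> 's" and V :: "('g \<Rightarrow> 's multiset \<Rightarrow> 'k, 'm, 'e) module_scheme" (structure)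
begin

abbreviation act :: "'g \<Rightarrow> 'm \<Rightarrow> 'm"
  where "act \<equiv> group_elem_action k S V"

abbreviation scale :: "('s multiset \<Rightarrow> 'k) \<Rightarrow> 'm \<Rightarrow> 'm"
  where "scale \<equiv> scalar_action k S G V"

lemma single_closed: "p \<in> carrier P \<Longrightarrow> g \<in> carrier G \<Longrightarrow> skew_elem P p g \<in> carrier R"
  unfolding R_eq by (rule skew.RG.single_closed)

lemma single_mult:
  "\<lbrakk>p \<in> carrier P; q \<in> carrier P; g \<in> carrier G; h \<in> carrier G\<rbrakk> \<Longrightarrow>
    skew_elem P p g \<otimes>\<^bsub>R\<^esub> skew_elem P q h =
    skew_elem P (p \<otimes>\<^bsub>P\<^esub> perm_poly k S (\<phi> g) q) (g \<otimes>\<^bsub>G\<^esub> h)"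
  unfolding R_eq by (rule skew.single_mult)

lemma single_smult_single:
  "\<lbrakk>p \<in> carrier P; q \<in> carrier P; g \<in> carrier G; h \<in> carrier G; v \<in> carrier V\<rbrakk> \<Longrightarrow>
    skew_elem P p g \<odot> (skew_elem P q h \<odot> v) =
    skew_elem P (p \<otimes>\<^bsub>P\<^esub> perm_poly k S (\<phi> g) q) (g \<otimes>\<^bsub>G\<^esub> h) \<odot> v"
  by (simp add: single_closed single_mult flip: smult_assoc)

lemma act_closed: "g \<in> carrier G \<Longrightarrow> v \<in> carrier V \<Longrightarrow> act g v \<in> carrier V"
  by (simp add: group_elem_action_def single_closed smult_closed)

lemma act_add: "g \<in> carrier G \<Longrightarrow> v \<in> carrier V \<Longrightarrow> w \<in> carrier V \<Longrightarrow>
    act g (v \<oplus> w) = act g v \<oplus> act g w"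
  by (simp add: group_elem_action_def single_closed smult_r_distr)

lemma act_mult: "g \<in> carrier G \<Longrightarrow> h \<in> carrier G \<Longrightarrow> v \<in> carrier V \<Longrightarrow>
    act (g \<otimes>\<^bsub>G\<^esub> h) v = act g (act h v)"
  by (simp add: group_elem_action_def single_smult_single skew.act_one)

lemma act_one: "v \<in> carrier V \<Longrightarrow> act \<one>\<^bsub>G\<^esub> v = v"
  using smult_one[of v] by (simp add: group_elem_action_def R_eq skew.one_eq)

lemma scale_closed: "p \<in> carrier P \<Longrightarrow> v \<in> carrier V \<Longrightarrow> scale p v \<in> carrier V"
  by (simp add: scalar_action_def single_closed smult_closed)

lemma scale_l_distr: "p \<in> carrier P \<Longrightarrow> q \<in> carrier P \<Longrightarrow> v \<in> carrier V \<Longrightarrow>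
    scale (p \<oplus>\<^bsub>P\<^esub> q) v = scale p v \<oplus> scale q v"
  using single_closed[of p "\<one>\<^bsub>G\<^esub>"] single_closed[of q "\<one>\<^bsub>G\<^esub>"]
  by (simp add: scalar_action_def skew.RG.add_single smult_l_distr flip: R_eq)

lemma scale_r_distr: "p \<in> carrier P \<Longrightarrow> v \<in> carrier V \<Longrightarrow> w \<in> carrier V \<Longrightarrow>
    scale p (v \<oplus> w) = scale p v \<oplus> scale p w"
  by (simp add: scalar_action_def single_closed smult_r_distr)

lemma scale_mult: "p \<in> carrier P \<Longrightarrow> q \<in> carrier P \<Longrightarrow> v \<in> carrier V \<Longrightarrow>
    scale (p \<otimes>\<^bsub>P\<^esub> q) v = scale p (scale q v)"
  by (simp add: scalar_action_def single_smult_single skew.act_unit)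

lemma scale_one: "v \<in> carrier V \<Longrightarrow> scale \<one>\<^bsub>P\<^esub> v = v"
  using act_one by (simp add: scalar_action_def group_elem_action_def)

lemma single_smult: "p \<in> carrier P \<Longrightarrow> g \<in> carrier G \<Longrightarrow> v \<in> carrier V \<Longrightarrow>
    skew_elem P p g \<odot> v = scale p (act g v)"
  by (simp add: scalar_action_def group_elem_action_def single_smult_single skew.act_unit)

lemma act_scale: "g \<in> carrier G \<Longrightarrow> p \<in> carrier P \<Longrightarrow> v \<in> carrier V \<Longrightarrow>
    act g (scale p v) = scale (perm_poly k S (\<phi> g) p) (act g v)"
  by (simp add: scalar_action_def group_elem_action_def single_smult_single skew.act_unit)

definition fixed_by :: "'s set \<Rightarrow> 'm \<Rightarrow> bool"
  where "fixed_by T v \<longleftrightarrow> finite T \<and> T \<subseteq> S \<and> (\<forall>g\<in>Stab T. act g v = v)"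

text \<open>Continuity of the action is local constancy, and by translation it may be tested at the
  identity of the group.\<close>

lemma discrete_module_iff: "discrete_module k S G \<phi> V \<longleftrightarrow> (\<forall>v\<in>carrier V. \<exists>T. fixed_by T v)"
proof
  assume "discrete_module k S G \<phi> V"
  then have cont: "continuous_map
      (prod_topology (stabilizer_topology S G \<phi>) (discrete_topology (carrier V)))
      (discrete_topology (carrier V)) (\<lambda>(g, v). act g v)"
    by (simp add: discrete_module_def)
  show "\<forall>v\<in>carrier V. \<exists>T. fixed_by T v"
  proof
    fix v assume v: "v \<in> carrier V"
    let ?W = "{x \<in> carrier G \<times> carrier V. (case x of (g, v) \<Rightarrow> act g v) \<in> {v}}"
    have "openin (prod_topology (stabilizer_topology S G \<phi>) (discrete_topology (carrier V))) ?W"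
      using openin_continuous_map_preimage[OF cont, of "{v}"] v
      by (simp add: topspace_stabilizer_topology)
    then have "(\<one>\<^bsub>G\<^esub>, v) \<in> ?W \<longrightarrow> (\<exists>U U'. openin (stabilizer_topology S G \<phi>) U \<and>
        openin (discrete_topology (carrier V)) U' \<and> \<one>\<^bsub>G\<^esub> \<in> U \<and> v \<in> U' \<and> U \<times> U' \<subseteq> ?W)"
      by (rule openin_prod_topology_alt[THEN iffD1, THEN spec, THEN spec])
    moreover have "(\<one>\<^bsub>G\<^esub>, v) \<in> ?W" using v by (simp add: act_one)
    ultimately obtain U U' where U: "openin (stabilizer_topology S G \<phi>) U" "\<one>\<^bsub>G\<^esub> \<in> U" "v \<in> U'" "U \<times> U' \<subseteq> ?W"
      by (elim impE exE conjE)
    obtain T where T: "finite T" "T \<subseteq> S" "\<one>\<^bsub>G\<^esub> <#\<^bsub>G\<^esub> Stab T \<subseteq> U"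
      using stabilizer_topology_neighbourhood[OF U(1,2)] by blast
    have "act g v = v" if g: "g \<in> Stab T" for g
    proof -
      have "g \<in> carrier G" using g by (simp add: pointwise_stabilizer_def)
      then have "g \<in> U" using g T(3) by (force simp: l_coset_def)
      then show ?thesis using U by auto
    qed
    then show "\<exists>T. fixed_by T v" using T by (auto simp: fixed_by_def)
  qed
next
  assume fixed: "\<forall>v\<in>carrier V. \<exists>T. fixed_by T v"
  have "openin (prod_topology (stabilizer_topology S G \<phi>) (discrete_topology (carrier V)))
      {x \<in> carrier G \<times> carrier V. (case x of (g, v) \<Rightarrow> act g v) \<in> U}" for U
    unfolding openin_prod_topology_alt
  proof (intro allI impI)
    fix g v assume "(g, v) \<in> {x \<in> carrier G \<times> carrier V. (case x of (g, v) \<Rightarrow> act g v) \<in> U}"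
    then have g: "g \<in> carrier G" and v: "v \<in> carrier V" and gv: "act g v \<in> U" by auto
    obtain T where T: "fixed_by T v" using fixed v by blast
    let ?N = "g <#\<^bsub>G\<^esub> Stab T"
    have "openin (stabilizer_topology S G \<phi>) ?N"
      unfolding stabilizer_topology_def
      by (rule topology_generated_by_Basis) (use g T in \<open>auto simp: fixed_by_def\<close>)
    moreover have "g \<in> ?N"
      using g T one_in_stabilizer[of T] by (force simp: l_coset_def fixed_by_def)
    moreover have "act x v \<in> U \<and> x \<in> carrier G" if x: "x \<in> ?N" for x
    proof -
      obtain s where s: "s \<in> Stab T" "x = g \<otimes>\<^bsub>G\<^esub> s"
        using x by (auto simp: l_coset_def)
      then have "s \<in> carrier G" "act s v = v" using T by (auto simp: pointwise_stabilizer_def fixed_by_def)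
      then show ?thesis using s(2) g v gv by (simp add: act_mult)
    qed
    ultimately show "\<exists>Ua Va. openin (stabilizer_topology S G \<phi>) Ua \<and>
        openin (discrete_topology (carrier V)) Va \<and> g \<in> Ua \<and> v \<in> Va \<and>
        Ua \<times> Va \<subseteq> {x \<in> carrier G \<times> carrier V. (case x of (g, v) \<Rightarrow> act g v) \<in> U}"
      using v by (intro exI[of _ ?N] exI[of _ "{v}"]) auto
  qed
  then show "discrete_module k S G \<phi> V"
    using left_module_axioms
    by (auto simp: discrete_module_def continuous_map_def topspace_stabilizer_topology act_closed)
qed

lemma fixed_by_mono: "fixed_by T v \<Longrightarrow> T \<subseteq> T' \<Longrightarrow> finite T' \<Longrightarrow> T' \<subseteq> S \<Longrightarrow> fixed_by T' v"
  unfolding fixed_by_def pointwise_stabilizer_def by blast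

text \<open>The action on a vector fixed by the stabilizer of \<open>T\<close> sees only the restriction to \<open>T\<close>.\<close>

lemma act_eq_if_agree:
  assumes T: "fixed_by T v" and v: "v \<in> carrier V" and g: "g \<in> carrier G" and h: "h \<in> carrier G"
    and agree: "\<And>t. t \<in> T \<Longrightarrow> \<phi> g t = \<phi> h t"
  shows "act g v = act h v"
proof -
  have "\<phi> (inv\<^bsub>G\<^esub> g \<otimes>\<^bsub>G\<^esub> h) t = t" if "t \<in> T" for t
    using that T g h agree[OF that] perm_inv[OF g, of t] by (auto simp: composition_rule fixed_by_def)
  then have "inv\<^bsub>G\<^esub> g \<otimes>\<^bsub>G\<^esub> h \<in> Stab T"
    using g h by (auto simp: pointwise_stabilizer_def)
  then have "act g (act (inv\<^bsub>G\<^esub> g \<otimes>\<^bsub>G\<^esub> h) v) = act g v"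
    using T by (simp add: fixed_by_def)
  then show ?thesis
    using g h v by (simp flip: act_mult G.m_assoc)
qed

lemma fixed_by_act:
  assumes T: "fixed_by T v" and v: "v \<in> carrier V" and g: "g \<in> carrier G"
  shows "fixed_by (\<phi> g ` T) (act g v)"
  unfolding fixed_by_def
proof (intro conjI ballI)
  show "finite (\<phi> g ` T)" "\<phi> g ` T \<subseteq> S" using T image_closed[OF g]
    by (auto simp: fixed_by_def)
  fix h assume h: "h \<in> Stab (\<phi> g ` T)"
  then have hG: "h \<in> carrier G" by (simp add: pointwise_stabilizer_def)
  have "act (h \<otimes>\<^bsub>G\<^esub> g) v = act g v"
    by (rule act_eq_if_agree[OF T v])
      (use h hG g T in \<open>simp_all add: composition_rule pointwise_stabilizer_def fixed_by_def subset_iff\<close>)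
  then show "act h (act g v) = act g v" using hG g v by (simp add: act_mult)
qed

end

text \<open>This holds because a polynomial involves finitely many indeterminates.\<close>

lemma (in cring) perm_poly_cong_finite:
  assumes "p \<in> carrier (poly_ring_on R S)"
  shows "\<exists>T. finite T \<and> T \<subseteq> S \<and> (\<forall>\<sigma>\<in>Bij S. \<forall>\<tau>\<in>Bij S. (\<forall>t\<in>T. \<sigma> t = \<tau> t) \<longrightarrow>
    perm_poly R S \<sigma> p = perm_poly R S \<tau> p)"
  using assms
proof (induction rule: poly_induct)
  case (monom a m)
  show ?case
  proof (intro exI[of _ "set_mset m"] conjI ballI impI)
    fix \<sigma> \<tau> assume *: "\<sigma> \<in> Bij S" "\<tau> \<in> Bij S" "\<forall>t\<in>set_mset m. \<sigma> t = \<tau> t"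
    then have "image_mset \<sigma> m = image_mset \<tau> m" by (intro image_mset_cong) blast
    then show "perm_poly R S \<sigma> (poly_monom R a m) = perm_poly R S \<tau> (poly_monom R a m)"
      using * monom by (simp add: perm_poly_monom)
  qed (use monom in simp_all)
next
  case zero
  then show ?case by (intro exI[of _ "{}"]) (simp add: perm_poly_zero)
next
  case (add p q)
  then obtain T T' where T: "finite T" "T \<subseteq> S" "finite T'" "T' \<subseteq> S"
    and p: "\<forall>\<sigma>\<in>Bij S. \<forall>\<tau>\<in>Bij S. (\<forall>t\<in>T. \<sigma> t = \<tau> t) \<longrightarrow> perm_poly R S \<sigma> p = perm_poly R S \<tau> p"
    and q: "\<forall>\<sigma>\<in>Bij S. \<forall>\<tau>\<in>Bij S. (\<forall>t\<in>T'. \<sigma> t = \<tau> t) \<longrightarrow> perm_poly R S \<sigma> q = perm_poly R S \<tau> q"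
    by blast
  show ?case
  proof (intro exI[of _ "T \<union> T'"] conjI ballI impI)
    fix \<sigma> \<tau> assume *: "\<sigma> \<in> Bij S" "\<tau> \<in> Bij S" "\<forall>t\<in>T \<union> T'. \<sigma> t = \<tau> t"
    then have "perm_poly R S \<sigma> p = perm_poly R S \<tau> p" "perm_poly R S \<sigma> q = perm_poly R S \<tau> q"
      using p q by blast+
    then show "perm_poly R S \<sigma> (p \<oplus>\<^bsub>poly_ring_on R S\<^esub> q) = perm_poly R S \<tau> (p \<oplus>\<^bsub>poly_ring_on R S\<^esub> q)"
      by (simp add: perm_poly_add)
  qed (use T in simp_all)
qed

section \<open>The equivalence of categories\<close>

text \<open>The module over the skew group ring with prescribed polynomial and group actions on the
  additive group of \<open>M\<close>.\<close>

definition semilinear_module ::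
    "('a, 'c) ring_scheme \<Rightarrow> ('r, 'm, 'e) module_scheme \<Rightarrow> ('a \<Rightarrow> 'm \<Rightarrow> 'm) \<Rightarrow> ('g \<Rightarrow> 'm \<Rightarrow> 'm) \<Rightarrow>
      ('g \<Rightarrow> 'a, 'm) module"
  where "semilinear_module A M s t =
    \<lparr>carrier = carrier M, monoid.mult = monoid.mult M, monoid.one = monoid.one M,
     ring.zero = ring.zero M, ring.add = ring.add M,
     module.smult = \<lambda>f v. \<Oplus>\<^bsub>M\<^esub>g\<in>{g. f g \<noteq> \<zero>\<^bsub>A\<^esub>}. s (f g) (t g v)\<rparr>"

lemma semilinear_module_simps [simp]:
  "carrier (semilinear_module A M s t) = carrier M"
  "\<zero>\<^bsub>semilinear_module A M s t\<^esub> = \<zero>\<^bsub>M\<^esub>"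
  "x \<oplus>\<^bsub>semilinear_module A M s t\<^esub> y = x \<oplus>\<^bsub>M\<^esub> y"
  by (simp_all add: semilinear_module_def)

lemma finsum_semilinear_module: "finsum (semilinear_module A M s t) = finsum M"
  by (intro ext) (simp add: finsum_def finprod_def semilinear_module_def)

lemma abelian_group_semilinear_module:
  assumes "abelian_group M"
  shows "abelian_group (semilinear_module A M s t)"
proof -
  interpret abelian_group M by fact
  show ?thesis
    by (rule abelian_groupI) (auto simp: a_ac intro!: bexI[where x = "\<ominus>\<^bsub>M\<^esub> x" for x] l_neg)
qed

context polynomial_skew_module
begin

text \<open>Extension to all permutations and restriction along a homomorphism are both instances: the additive
  group and the polynomial action stay, and only the acting group changes.\<close>

lemma change_group:
  fixes H :: "('h, 'f) monoid_scheme"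
  assumes H: "polynomial_action k S H \<psi>"
    and t_closed: "\<And>h v. h \<in> carrier H \<Longrightarrow> v \<in> carrier V \<Longrightarrow> t h v \<in> carrier V"
    and t_add: "\<And>h v w. h \<in> carrier H \<Longrightarrow> v \<in> carrier V \<Longrightarrow> w \<in> carrier V \<Longrightarrow>
      t h (v \<oplus> w) = t h v \<oplus> t h w"
    and t_mult: "\<And>g h v. g \<in> carrier H \<Longrightarrow> h \<in> carrier H \<Longrightarrow> v \<in> carrier V \<Longrightarrow>
      t (g \<otimes>\<^bsub>H\<^esub> h) v = t g (t h v)"
    and t_one: "\<And>v. v \<in> carrier V \<Longrightarrow> t \<one>\<^bsub>H\<^esub> v = v"
    and t_scale: "\<And>h p v. h \<in> carrier H \<Longrightarrow> p \<in> carrier P \<Longrightarrow> v \<in> carrier V \<Longrightarrow>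
      t h (scale p v) = scale (perm_poly k S (\<psi> h) p) (t h v)"
  shows "polynomial_skew_module k S H \<psi> (semilinear_module P V scale t)"
    and "\<And>h v. h \<in> carrier H \<Longrightarrow> v \<in> carrier V \<Longrightarrow>
      group_elem_action k S (semilinear_module P V scale t) h v = t h v"
    and "\<And>p v. p \<in> carrier P \<Longrightarrow> v \<in> carrier V \<Longrightarrow>
      scalar_action k S H (semilinear_module P V scale t) p v = scale p v"
proof -
  interpret H: polynomial_action k S H \<psi> by fact
  let ?W = "semilinear_module P V scale t"
  have W: "left_module H.skew.RG ?W"
    "\<And>p h v. p \<in> carrier P \<Longrightarrow> h \<in> carrier H \<Longrightarrow> v \<in> carrier ?W \<Longrightarrow>
      skew_elem P p h \<odot>\<^bsub>?W\<^esub> v = scale p (t h v)"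
    by (rule H.skew.left_module_if_semilinear_action[where s = scale and t = t];
      simp add: scale_closed scale_l_distr scale_r_distr scale_mult scale_one t_closed t_add t_mult t_one
        t_scale finsum_semilinear_module abelian_group_semilinear_module[OF M.abelian_group_axioms];
      simp add: semilinear_module_def)+
  show "polynomial_skew_module k S H \<psi> ?W"
    using H W(1) by (simp add: polynomial_skew_module_def H.R_eq)
  show "group_elem_action k S ?W h v = t h v" if "h \<in> carrier H" "v \<in> carrier V" for h v
    using that by (simp add: group_elem_action_def W(2) scale_one t_closed)
  show "scalar_action k S H ?W p v = scale p v" if "p \<in> carrier P" "v \<in> carrier V" for p v
    using that W(2)[of p "\<one>\<^bsub>H\<^esub>" v] by (simp add: scalar_action_def[of k S H] t_one)
qed

lemma module_homs_iff:
  assumes "polynomial_skew_module k S G \<phi> W"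
  shows "f \<in> module_homs R V W \<longleftrightarrow> f \<in> carrier V \<rightarrow>\<^sub>E carrier W \<and>
    (\<forall>x\<in>carrier V. \<forall>y\<in>carrier V. f (x \<oplus> y) = f x \<oplus>\<^bsub>W\<^esub> f y) \<and>
    (\<forall>p\<in>carrier P. \<forall>x\<in>carrier V. f (scale p x) = scalar_action k S G W p (f x)) \<and>
    (\<forall>g\<in>carrier G. \<forall>x\<in>carrier V. f (act g x) = group_elem_action k S W g (f x))"
    (is "?hom \<longleftrightarrow> ?rhs")
proof
  assume ?hom
  then show ?rhs
    by (simp add: module_homs_def scalar_action_def group_elem_action_def single_closed)
next
  interpret W: polynomial_skew_module k S G \<phi> W by fact
  assume rhs: ?rhs
  have "f (skew_elem P p g \<odot> x) = skew_elem P p g \<odot>\<^bsub>W\<^esub> f x"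
    if "p \<in> carrier P" "g \<in> carrier G" "x \<in> carrier V" for p g x
  proof -
    have "f x \<in> carrier W" using rhs that by auto
    then show ?thesis using rhs that by (simp add: single_smult W.single_smult act_closed)
  qed
  then show ?hom
    unfolding R_eq using rhs left_module_axioms W.left_module_axioms
    by (intro skew.module_homsI) (auto simp: R_eq)
qed

end

text \<open>This is density of the image of \<open>G\<close> in the group of permutations.\<close>

lemma (in polynomial_action) agreeing_element:
  assumes ht: "highly_transitive S G \<phi>" and \<sigma>: "\<sigma> \<in> Bij S" and T: "finite T" "T \<subseteq> S"
  shows "\<exists>g\<in>carrier G. \<forall>t\<in>T. \<phi> g t = \<sigma> t"
proof -
  obtain ts where ts: "set ts = T" "distinct ts" using finite_distinct_list[OF T(1)] by blast
  have "inj_on \<sigma> T"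
    using \<sigma> T(2) by (auto simp: Bij_def bij_betw_def intro: inj_on_subset)
  moreover have "\<sigma> ` T \<subseteq> S" using Bij_imp_funcset[OF \<sigma>] T(2) by auto
  ultimately obtain g where "g \<in> carrier G" "map (\<phi> g) ts = map \<sigma> ts"
    using ht ts T(2) unfolding highly_transitive_def by (metis distinct_map length_map set_map)
  then show ?thesis using ts by auto
qed

text \<open>The value does not depend on the choices of \<open>T\<close> and \<open>g\<close>; see \<open>ext_act_eq\<close> below.\<close>

definition extended_action ::
    "('k, 'c) ring_scheme \<Rightarrow> 's set \<Rightarrow> ('g, 'd) monoid_scheme \<Rightarrow> ('g \<Rightarrow> 's \<Rightarrow> 's) \<Rightarrow>
      ('g \<Rightarrow> 's multiset \<Rightarrow> 'k, 'm, 'e) module_scheme \<Rightarrow> ('s \<Rightarrow> 's) \<Rightarrow> 'm \<Rightarrow> 'm"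
  where "extended_action k S G \<phi> V \<sigma> v = (SOME w. \<exists>T g. polynomial_skew_module.fixed_by k S G \<phi> V T v \<and>
    g \<in> carrier G \<and> (\<forall>t\<in>T. \<phi> g t = \<sigma> t) \<and> w = group_elem_action k S V g v)"

locale highly_transitive_module = polynomial_skew_module k S G \<phi> V
  for k :: "('k, 'c) ring_scheme" and S :: "'s set" and G :: "('g, 'd) monoid_scheme"
    and \<phi> :: "'g \<Rightarrow> 's \<Rightarrow> 's" and V :: "('g \<Rightarrow> 's multiset \<Rightarrow> 'k, 'm, 'e) module_scheme" (structure) +
  assumes highly_transitive: "highly_transitive S G \<phi>"
    and discrete: "discrete_module k S G \<phi> V"
begin

abbreviation ext_act :: "('s \<Rightarrow> 's) \<Rightarrow> 'm \<Rightarrow> 'm"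
  where "ext_act \<equiv> extended_action k S G \<phi> V"

lemma ex_fixed_by: "v \<in> carrier V \<Longrightarrow> \<exists>T. fixed_by T v"
  using discrete discrete_module_iff by blast

lemma ex_agreeing:
  assumes "\<sigma> \<in> Bij S" and v: "v \<in> carrier V" and U: "finite U" "U \<subseteq> S"
  shows "\<exists>T g. U \<subseteq> T \<and> fixed_by T v \<and> g \<in> carrier G \<and> (\<forall>t\<in>T. \<phi> g t = \<sigma> t)"
proof -
  obtain T where T: "fixed_by T v" using ex_fixed_by[OF v] by blast
  then have fin: "finite (T \<union> U)" "T \<union> U \<subseteq> S" using U by (auto simp: fixed_by_def)
  obtain g where "g \<in> carrier G" "\<forall>t\<in>T \<union> U. \<phi> g t = \<sigma> t"
    using agreeing_element[OF highly_transitive assms(1) fin] by blast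
  then show ?thesis using fixed_by_mono[OF T Un_upper1 fin] by blast
qed

text \<open>Any two choices are compared with a third group element, which agrees with \<open>\<sigma>\<close> on the union of the
  two finite sets.\<close>

lemma ext_act_eq:
  assumes \<sigma>: "\<sigma> \<in> Bij S" and v: "v \<in> carrier V" and T: "fixed_by T v" and g: "g \<in> carrier G"
    and agree: "\<forall>t\<in>T. \<phi> g t = \<sigma> t"
  shows "ext_act \<sigma> v = act g v"
proof -
  have "\<exists>T' g'. fixed_by T' v \<and> g' \<in> carrier G \<and> (\<forall>t\<in>T'. \<phi> g' t = \<sigma> t) \<and> ext_act \<sigma> v = act g' v"
    unfolding extended_action_def by (rule someI[of _ "act g v"]) (use T g agree in blast)
  then obtain T' g' where T': "fixed_by T' v" "g' \<in> carrier G" "\<forall>t\<in>T'. \<phi> g' t = \<sigma> t" "ext_act \<sigma> v = act g' v"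
    by blast
  then have "finite (T \<union> T')" "T \<union> T' \<subseteq> S" using T by (auto simp: fixed_by_def)
  then obtain h where h: "h \<in> carrier G" "\<forall>t\<in>T \<union> T'. \<phi> h t = \<sigma> t"
    using agreeing_element[OF highly_transitive \<sigma>] by blast
  have "act g' v = act h v" by (rule act_eq_if_agree[OF T'(1) v T'(2) h(1)]) (use T' h in auto)
  moreover have "act g v = act h v" by (rule act_eq_if_agree[OF T v g h(1)]) (use agree h in auto)
  ultimately show ?thesis using T'(4) by simp
qed

lemma ext_act_closed:
  assumes "\<sigma> \<in> Bij S" "v \<in> carrier V"
  shows "ext_act \<sigma> v \<in> carrier V"
proof -
  obtain T g where "fixed_by T v" "g \<in> carrier G" "\<forall>t\<in>T. \<phi> g t = \<sigma> t"
    using ex_agreeing[OF assms finite.emptyI empty_subsetI] by blast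
  then show ?thesis using ext_act_eq[OF assms] assms by (simp add: act_closed)
qed

lemma ext_act_add:
  assumes \<sigma>: "\<sigma> \<in> Bij S" and v: "v \<in> carrier V" and w: "w \<in> carrier V"
  shows "ext_act \<sigma> (v \<oplus> w) = ext_act \<sigma> v \<oplus> ext_act \<sigma> w"
proof -
  obtain T where T: "fixed_by T v" using ex_fixed_by[OF v] by blast
  have vw: "v \<oplus> w \<in> carrier V" using v w by simp
  obtain T' where T': "fixed_by T' w" using ex_fixed_by[OF w] by blast
  have fin: "finite (T \<union> T')" "T \<union> T' \<subseteq> S" using T T' by (auto simp: fixed_by_def)
  obtain T'' g where T'': "T \<union> T' \<subseteq> T''" "fixed_by T'' (v \<oplus> w)" and g: "g \<in> carrier G"
      "\<forall>t\<in>T''. \<phi> g t = \<sigma> t"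
    using ex_agreeing[OF \<sigma> vw fin] by (elim exE conjE)
  have "ext_act \<sigma> (v \<oplus> w) = act g (v \<oplus> w)" by (rule ext_act_eq[OF \<sigma> vw T''(2) g])
  moreover have "ext_act \<sigma> v = act g v" by (rule ext_act_eq[OF \<sigma> v T g(1)]) (use T'' g in blast)
  moreover have "ext_act \<sigma> w = act g w" by (rule ext_act_eq[OF \<sigma> w T' g(1)]) (use T'' g in blast)
  ultimately show ?thesis using g v w by (simp add: act_add)
qed

text \<open>If \<open>T\<close> supports \<open>v\<close> and \<open>h\<close> agrees with \<open>\<tau>\<close> on \<open>T\<close>, then \<open>h T\<close> supports \<open>h v\<close>, so \<open>\<sigma>\<close> has to be
  approximated on \<open>h T\<close>.\<close>

lemma ext_act_compose:
  assumes \<sigma>: "\<sigma> \<in> Bij S" and \<tau>: "\<tau> \<in> Bij S" and v: "v \<in> carrier V"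
  shows "ext_act (compose S \<sigma> \<tau>) v = ext_act \<sigma> (ext_act \<tau> v)"
proof -
  obtain T h where T: "fixed_by T v" and h: "h \<in> carrier G" "\<forall>t\<in>T. \<phi> h t = \<tau> t"
    using ex_agreeing[OF \<tau> v finite.emptyI empty_subsetI] by blast
  have hv: "act h v \<in> carrier V" "fixed_by (\<phi> h ` T) (act h v)"
    using act_closed[OF h(1) v] fixed_by_act[OF T v h(1)] by auto
  then obtain g where g: "g \<in> carrier G" "\<forall>t\<in>\<phi> h ` T. \<phi> g t = \<sigma> t"
    using agreeing_element[OF highly_transitive \<sigma>, of "\<phi> h ` T"] by (auto simp: fixed_by_def)
  have T_S: "t \<in> T \<Longrightarrow> t \<in> S" for t using T by (auto simp: fixed_by_def)
  have "ext_act \<tau> v = act h v" by (rule ext_act_eq[OF \<tau> v T h])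
  moreover have "ext_act \<sigma> (act h v) = act g (act h v)"
    by (rule ext_act_eq[OF \<sigma> hv g(1)]) (use g in blast)
  moreover have "ext_act (compose S \<sigma> \<tau>) v = act (g \<otimes>\<^bsub>G\<^esub> h) v"
    by (rule ext_act_eq[OF compose_Bij[OF \<sigma> \<tau>] v T])
      (use g h T_S in \<open>simp_all add: compose_eq composition_rule\<close>)
  ultimately show ?thesis using g h v by (simp add: act_mult)
qed

lemma ext_act_perm:
  assumes "g \<in> carrier G" "v \<in> carrier V"
  shows "ext_act (\<phi> g) v = act g v"
proof -
  obtain T where T: "fixed_by T v" using ex_fixed_by assms by blast
  show ?thesis by (rule ext_act_eq[OF perm_Bij[OF assms(1)] assms(2) T assms(1)]) simp
qed

lemma ext_act_scale:
  assumes \<sigma>: "\<sigma> \<in> Bij S" and p: "p \<in> carrier P" and v: "v \<in> carrier V"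
  shows "ext_act \<sigma> (scale p v) = scale (perm_poly k S \<sigma> p) (ext_act \<sigma> v)"
proof -
  obtain U where U: "finite U" "U \<subseteq> S"
      "\<forall>\<sigma>\<in>Bij S. \<forall>\<tau>\<in>Bij S. (\<forall>t\<in>U. \<sigma> t = \<tau> t) \<longrightarrow> perm_poly k S \<sigma> p = perm_poly k S \<tau> p"
    using k.perm_poly_cong_finite[OF p] by blast
  obtain T where T: "fixed_by T v" using ex_fixed_by[OF v] by blast
  have pv: "scale p v \<in> carrier V" using scale_closed[OF p v] .
  have fin: "finite (T \<union> U)" "T \<union> U \<subseteq> S" using T U by (auto simp: fixed_by_def)
  obtain T'' g where T'': "T \<union> U \<subseteq> T''" "fixed_by T'' (scale p v)" and g: "g \<in> carrier G"
      "\<forall>t\<in>T''. \<phi> g t = \<sigma> t"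
    using ex_agreeing[OF \<sigma> pv fin] by (elim exE conjE)
  have "ext_act \<sigma> (scale p v) = act g (scale p v)" by (rule ext_act_eq[OF \<sigma> pv T''(2) g])
  moreover have "ext_act \<sigma> v = act g v" by (rule ext_act_eq[OF \<sigma> v T g(1)]) (use T'' g in blast)
  moreover have "perm_poly k S (\<phi> g) p = perm_poly k S \<sigma> p"
    using U(3) perm_Bij[OF g(1)] \<sigma> g(2) T''(1) by blast
  ultimately show ?thesis using g p v by (simp add: act_scale)
qed

end

lemma polynomial_action_BijGroup: "cring k \<Longrightarrow> polynomial_action k S (BijGroup S) (\<lambda>\<sigma>. \<sigma>)"
  by (simp add: polynomial_action_def group_action_def group_hom_def group_hom_axioms_def
      group_BijGroup hom_def)

lemma BijGroup_simps:
  "carrier (BijGroup S) = Bij S" "\<one>\<^bsub>BijGroup S\<^esub> = (\<lambda>s\<in>S. s)"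
  "\<sigma> \<in> Bij S \<Longrightarrow> \<tau> \<in> Bij S \<Longrightarrow> \<sigma> \<otimes>\<^bsub>BijGroup S\<^esub> \<tau> = compose S \<sigma> \<tau>"
  by (simp_all add: BijGroup_def)

definition extension_module where
  "extension_module k S G \<phi> V =
    semilinear_module (poly_ring_on k S) V (scalar_action k S G V) (extended_action k S G \<phi> V)"

definition restriction_module where
  "restriction_module k S \<phi> W = semilinear_module (poly_ring_on k S) W
    (scalar_action k S (BijGroup S) W) (\<lambda>g. group_elem_action k S W (\<phi> g))"

lemma extension_module_simps [simp]:
  "carrier (extension_module k S G \<phi> V) = carrier V"
  "x \<oplus>\<^bsub>extension_module k S G \<phi> V\<^esub> y = x \<oplus>\<^bsub>V\<^esub> y"
  by (simp_all add: extension_module_def)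

lemma restriction_module_simps [simp]:
  "carrier (restriction_module k S \<phi> W) = carrier W"
  "x \<oplus>\<^bsub>restriction_module k S \<phi> W\<^esub> y = x \<oplus>\<^bsub>W\<^esub> y"
  by (simp_all add: restriction_module_def)

context highly_transitive_module
begin

abbreviation "E \<equiv> extension_module k S G \<phi> V"

lemma
  shows extension: "polynomial_skew_module k S (BijGroup S) (\<lambda>\<sigma>. \<sigma>) E"
    and extension_act: "\<sigma> \<in> Bij S \<Longrightarrow> v \<in> carrier V \<Longrightarrow> group_elem_action k S E \<sigma> v = ext_act \<sigma> v"
    and extension_scale: "p \<in> carrier P \<Longrightarrow> v \<in> carrier V \<Longrightarrow>
      scalar_action k S (BijGroup S) E p v = scale p v"
proof -
  have one: "ext_act (\<lambda>s\<in>S. s) v = v" if "v \<in> carrier V" for v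
    using ext_act_perm[OF G.one_closed that] that by (simp add: perm_one act_one)
  note * = change_group[OF polynomial_action_BijGroup[OF k.cring_axioms], where t = ext_act]
  note rules = BijGroup_simps ext_act_closed ext_act_add ext_act_compose ext_act_scale one
  show "polynomial_skew_module k S (BijGroup S) (\<lambda>\<sigma>. \<sigma>) E"
    unfolding extension_module_def
    by (rule *(1)) (simp_all add: rules del: restrict_apply)
  show "group_elem_action k S E \<sigma> v = ext_act \<sigma> v" if "\<sigma> \<in> Bij S" "v \<in> carrier V"
    unfolding extension_module_def
    by (rule *(2)) (use that in \<open>simp_all add: rules del: restrict_apply\<close>)
  show "scalar_action k S (BijGroup S) E p v = scale p v" if "p \<in> carrier P" "v \<in> carrier V"
    unfolding extension_module_def
    by (rule *(3)) (use that in \<open>simp_all add: rules del: restrict_apply\<close>)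
qed

lemma discrete_extension: "discrete_module k S (BijGroup S) (\<lambda>\<sigma>. \<sigma>) E"
proof -
  interpret E: polynomial_skew_module k S "BijGroup S" "\<lambda>\<sigma>. \<sigma>" E by (rule extension)
  have "E.fixed_by T v" if T: "fixed_by T v" and v: "v \<in> carrier V" for T v
    unfolding E.fixed_by_def
  proof (intro conjI ballI)
    show "finite T" "T \<subseteq> S" using T by (simp_all add: fixed_by_def)
    fix \<sigma> assume \<sigma>: "\<sigma> \<in> pointwise_stabilizer (BijGroup S) (\<lambda>\<sigma>. \<sigma>) T"
    then have \<sigma>B: "\<sigma> \<in> Bij S" by (simp add: pointwise_stabilizer_def BijGroup_simps)
    have "ext_act \<sigma> v = act \<one>\<^bsub>G\<^esub> v"
      by (rule ext_act_eq[OF \<sigma>B v T]) (use \<sigma> T in \<open>auto simp: pointwise_stabilizer_def perm_one fixed_by_def\<close>)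
    then show "E.act \<sigma> v = v" using \<sigma>B v by (simp add: extension_act act_one)
  qed
  then show ?thesis
    using ex_fixed_by unfolding E.discrete_module_iff by auto blast
qed

end

context polynomial_action
begin

lemma
  assumes W: "polynomial_skew_module k S (BijGroup S) (\<lambda>\<sigma>. \<sigma>) W"
  shows restriction: "polynomial_skew_module k S G \<phi> (restriction_module k S \<phi> W)"
    and restriction_act: "g \<in> carrier G \<Longrightarrow> w \<in> carrier W \<Longrightarrow>
      group_elem_action k S (restriction_module k S \<phi> W) g w = group_elem_action k S W (\<phi> g) w"
    and restriction_scale: "p \<in> carrier P \<Longrightarrow> w \<in> carrier W \<Longrightarrow>
      scalar_action k S G (restriction_module k S \<phi> W) p w = scalar_action k S (BijGroup S) W p w"
proof -
  interpret W: polynomial_skew_module k S "BijGroup S" "\<lambda>\<sigma>. \<sigma>" W by fact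
  have perm: "\<phi> g \<in> carrier (BijGroup S)" if "g \<in> carrier G" for g
    using perm_Bij[OF that] by (simp add: BijGroup_simps)
  have mult: "\<phi> (g \<otimes>\<^bsub>G\<^esub> h) = \<phi> g \<otimes>\<^bsub>BijGroup S\<^esub> \<phi> h" if "g \<in> carrier G" "h \<in> carrier G" for g h
    using that perm_Bij by (simp add: BijGroup_simps perm_mult)
  have one: "\<phi> \<one>\<^bsub>G\<^esub> = \<one>\<^bsub>BijGroup S\<^esub>" by (simp add: BijGroup_simps perm_one)
  note * = W.change_group[OF polynomial_action_axioms, where t = "\<lambda>g. group_elem_action k S W (\<phi> g)"]
  note rules = perm mult one W.act_closed W.act_add W.act_mult W.act_one W.act_scale
  show "polynomial_skew_module k S G \<phi> (restriction_module k S \<phi> W)"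
    unfolding restriction_module_def by (rule *(1)) (simp_all add: rules)
  show "group_elem_action k S (restriction_module k S \<phi> W) g w = group_elem_action k S W (\<phi> g) w"
    if "g \<in> carrier G" "w \<in> carrier W"
    unfolding restriction_module_def by (rule *(2)) (use that in \<open>simp_all add: rules\<close>)
  show "scalar_action k S G (restriction_module k S \<phi> W) p w = scalar_action k S (BijGroup S) W p w"
    if "p \<in> carrier P" "w \<in> carrier W"
    unfolding restriction_module_def by (rule *(3)) (use that in \<open>simp_all add: rules\<close>)
qed

lemma fixed_by_restriction:
  assumes W: "polynomial_skew_module k S (BijGroup S) (\<lambda>\<sigma>. \<sigma>) W"
    and "polynomial_skew_module.fixed_by k S (BijGroup S) (\<lambda>\<sigma>. \<sigma>) W T w" and w: "w \<in> carrier W"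
  shows "polynomial_skew_module.fixed_by k S G \<phi> (restriction_module k S \<phi> W) T w"
proof -
  interpret W: polynomial_skew_module k S "BijGroup S" "\<lambda>\<sigma>. \<sigma>" W by fact
  interpret X: polynomial_skew_module k S G \<phi> "restriction_module k S \<phi> W" by (rule restriction[OF W])
  have "\<phi> g \<in> pointwise_stabilizer (BijGroup S) (\<lambda>\<sigma>. \<sigma>) T" if "g \<in> pointwise_stabilizer G \<phi> T" for g
    using that perm_Bij by (simp add: pointwise_stabilizer_def BijGroup_simps)
  then show ?thesis
    using assms(2) w
    by (auto simp: W.fixed_by_def X.fixed_by_def restriction_act[OF W] pointwise_stabilizer_def)
qed

lemma discrete_restriction:
  assumes W: "polynomial_skew_module k S (BijGroup S) (\<lambda>\<sigma>. \<sigma>) W"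
    and "discrete_module k S (BijGroup S) (\<lambda>\<sigma>. \<sigma>) W"
  shows "discrete_module k S G \<phi> (restriction_module k S \<phi> W)"
proof -
  interpret W: polynomial_skew_module k S "BijGroup S" "\<lambda>\<sigma>. \<sigma>" W by fact
  interpret X: polynomial_skew_module k S G \<phi> "restriction_module k S \<phi> W" by (rule restriction[OF W])
  show ?thesis
    unfolding X.discrete_module_iff
    using assms(2) fixed_by_restriction[OF W] unfolding W.discrete_module_iff by auto blast
qed

lemma polynomial_skew_module_if_discrete:
  "discrete_module k S G \<phi> V \<Longrightarrow> polynomial_skew_module k S G \<phi> V"
  by (simp add: polynomial_skew_module_def polynomial_action_axioms discrete_module_def)

end

context polynomial_action
begin

abbreviation category where
  "category \<equiv> discrete_module_category k S G \<phi>"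

lemma discrete_module_homs_iff:
  assumes "discrete_module k S G \<phi> V" "discrete_module k S G \<phi> W"
  shows "f \<in> module_homs R V W \<longleftrightarrow> f \<in> carrier V \<rightarrow>\<^sub>E carrier W \<and>
    (\<forall>x\<in>carrier V. \<forall>y\<in>carrier V. f (x \<oplus>\<^bsub>V\<^esub> y) = f x \<oplus>\<^bsub>W\<^esub> f y) \<and>
    (\<forall>p\<in>carrier P. \<forall>x\<in>carrier V. f (scalar_action k S G V p x) = scalar_action k S G W p (f x)) \<and>
    (\<forall>g\<in>carrier G. \<forall>x\<in>carrier V. f (group_elem_action k S V g x) = group_elem_action k S W g (f x))"
  using assms[THEN polynomial_skew_module_if_discrete] by (rule polynomial_skew_module.module_homs_iff)

lemma is_category_discrete:
  "is_category (category :: (('g \<Rightarrow> 's multiset \<Rightarrow> 'k, 'm) module, 'm \<Rightarrow> 'm) category)"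
proof -
  have "compose (carrier X) g f \<in> module_homs R X Z"
    if "f \<in> module_homs R X Y" "g \<in> module_homs R Y Z" "discrete_module k S G \<phi> X"
    for X Y Z :: "('g \<Rightarrow> 's multiset \<Rightarrow> 'k, 'm) module" and f g
  proof -
    interpret X: polynomial_skew_module k S G \<phi> X by (rule polynomial_skew_module_if_discrete[OF that(3)])
    show ?thesis
      using that X.smult_closed by (auto simp: module_homs_def compose_eq PiE_iff Pi_iff compose_def)
  qed
  moreover have "(\<lambda>v\<in>carrier X. v) \<in> module_homs R X X" if "discrete_module k S G \<phi> X"
    for X :: "('g \<Rightarrow> 's multiset \<Rightarrow> 'k, 'm) module"
  proof -
    interpret X: polynomial_skew_module k S G \<phi> X by (rule polynomial_skew_module_if_discrete[OF that])
    show ?thesis using X.smult_closed by (auto simp: module_homs_def)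
  qed
  moreover have "compose (carrier W) h (compose (carrier W) g f) = compose (carrier W) (compose (carrier X) h g) f"
    if "f \<in> module_homs R W X" for W X :: "('g \<Rightarrow> 's multiset \<Rightarrow> 'k, 'm) module" and f g h
    using that by (intro compose_assoc[where B = "carrier X"]) (auto simp: module_homs_def)
  moreover have "compose (carrier X) f (\<lambda>v\<in>carrier X. v) = f \<and> compose (carrier X) (\<lambda>v\<in>carrier Y. v) f = f"
    if f: "f \<in> module_homs R X Y" for X Y :: "('g \<Rightarrow> 's multiset \<Rightarrow> 'k, 'm) module" and f
  proof -
    have "f \<in> carrier X \<rightarrow> carrier Y" "f \<in> extensional (carrier X)"
      using f by (auto simp: module_homs_def PiE_iff)
    then show ?thesis by (simp del: restrict_apply)
  qed
  ultimately show ?thesis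
    unfolding is_category_def discrete_module_category_def by (auto simp del: restrict_apply)
qed

lemma identity_isomorphism:
  assumes X: "discrete_module k S G \<phi> X" and Y: "discrete_module k S G \<phi> Y"
    and carrier: "carrier Y = carrier X"
    and add: "\<And>x y. x \<in> carrier X \<Longrightarrow> y \<in> carrier X \<Longrightarrow> x \<oplus>\<^bsub>Y\<^esub> y = x \<oplus>\<^bsub>X\<^esub> y"
    and scale: "\<And>p x. p \<in> carrier P \<Longrightarrow> x \<in> carrier X \<Longrightarrow>
      scalar_action k S G Y p x = scalar_action k S G X p x"
    and act: "\<And>g x. g \<in> carrier G \<Longrightarrow> x \<in> carrier X \<Longrightarrow>
      group_elem_action k S Y g x = group_elem_action k S X g x"
  shows "is_isomorphism category X Y (\<lambda>v\<in>carrier X. v)"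
    and "is_isomorphism category Y X (\<lambda>v\<in>carrier X. v)"
proof -
  interpret X: polynomial_skew_module k S G \<phi> X by (rule polynomial_skew_module_if_discrete[OF X])
  have "(\<lambda>v\<in>carrier X. v) \<in> module_homs R X Y"
    by (simp add: discrete_module_homs_iff[OF X Y] carrier add scale act X.scale_closed X.act_closed)
  moreover have "(\<lambda>v\<in>carrier X. v) \<in> module_homs R Y X"
    by (simp add: discrete_module_homs_iff[OF Y X] carrier add scale act X.scale_closed X.act_closed)
  moreover have "compose (carrier X) (\<lambda>v\<in>carrier X. v) (\<lambda>v\<in>carrier X. v) = (\<lambda>v\<in>carrier X. v)"
    by (auto simp: compose_def)
  ultimately show "is_isomorphism category X Y (\<lambda>v\<in>carrier X. v)"
      "is_isomorphism category Y X (\<lambda>v\<in>carrier X. v)"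
    by (simp_all add: is_isomorphism_def discrete_module_category_def carrier del: restrict_apply) blast+
qed

end

lemma naturally_isomorphic_identity:
  fixes C :: "(('r, 'm, 'e) module_scheme, 'm \<Rightarrow> 'm) category"
  assumes Comp: "Comp C = (\<lambda>U V W g f. compose (carrier U) g f)"
    and iso: "\<And>X. X \<in> Obj C \<Longrightarrow> is_isomorphism C (F X) (H X) (\<lambda>v\<in>carrier (F X). v)"
    and f: "\<And>X Y f. f \<in> Hom C X Y \<Longrightarrow> X \<in> Obj C \<Longrightarrow> Y \<in> Obj C \<Longrightarrow>
      Fm X Y f = f \<and> Hm X Y f = f \<and> f \<in> carrier (F X) \<rightarrow>\<^sub>E carrier (F Y)"
  shows "naturally_isomorphic C C F Fm H Hm"
  unfolding naturally_isomorphic_def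
proof (intro exI[of _ "\<lambda>X. \<lambda>v\<in>carrier (F X). v"] conjI ballI)
  fix X assume X: "X \<in> Obj C"
  show "is_isomorphism C (F X) (H X) (\<lambda>v\<in>carrier (F X). v)" by (rule iso[OF X])
  fix Y f assume Y: "Y \<in> Obj C" and "f \<in> Hom C X Y"
  then have "Fm X Y f = f" "Hm X Y f = f" "f \<in> carrier (F X) \<rightarrow> carrier (F Y)" "f \<in> extensional (carrier (F X))"
    using f[OF _ X Y] by (auto simp: PiE_iff)
  then show "Comp C (F X) (F Y) (H Y) (\<lambda>v\<in>carrier (F Y). v) (Fm X Y f) =
      Comp C (F X) (H X) (H Y) (Hm X Y f) (\<lambda>v\<in>carrier (F X). v)"
    by (simp add: Comp del: restrict_apply)
qed

text \<open>Both functors are the identity on morphisms. A homomorphism of discrete \<open>G\<close>-modules commutes with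
  the extended action since \<open>\<sigma>\<close> acts on \<open>x\<close> and on its image through the same \<open>g\<close>, once
  \<open>g\<close> agrees with \<open>\<sigma>\<close> on a set supporting both.\<close>

theorem equivalence_of_discrete_modules:
  fixes k :: "('k, 'c) ring_scheme" and S :: "'s set" and G :: "('g, 'd) monoid_scheme"
  assumes "polynomial_action k S G \<phi>" and ht: "highly_transitive S G \<phi>"
  shows "equivalent_categories
      (discrete_module_category k S G \<phi> :: (('g \<Rightarrow> 's multiset \<Rightarrow> 'k, 'm) module, 'm \<Rightarrow> 'm) category)
      (discrete_module_category k S (BijGroup S) (\<lambda>\<sigma>. \<sigma>) ::
        ((('s \<Rightarrow> 's) \<Rightarrow> 's multiset \<Rightarrow> 'k, 'm) module, 'm \<Rightarrow> 'm) category)"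
proof -
  interpret A: polynomial_action k S G \<phi> by fact
  interpret B: polynomial_action k S "BijGroup S" "\<lambda>\<sigma>. \<sigma>"
    by (rule polynomial_action_BijGroup[OF A.k.cring_axioms])
  let ?C = "discrete_module_category k S G \<phi> :: (('g \<Rightarrow> 's multiset \<Rightarrow> 'k, 'm) module, 'm \<Rightarrow> 'm) category"
  let ?D = "discrete_module_category k S (BijGroup S) (\<lambda>\<sigma>. \<sigma>) ::
        ((('s \<Rightarrow> 's) \<Rightarrow> 's multiset \<Rightarrow> 'k, 'm) module, 'm \<Rightarrow> 'm) category"
  let ?F = "extension_module k S G \<phi> :: ('g \<Rightarrow> 's multiset \<Rightarrow> 'k, 'm) module \<Rightarrow> _"
  let ?H = "restriction_module k S \<phi> :: (('s \<Rightarrow> 's) \<Rightarrow> 's multiset \<Rightarrow> 'k, 'm) module \<Rightarrow> ('g \<Rightarrow> 's multiset \<Rightarrow> 'k, 'm) module"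
  have C_simps: "Obj ?C = {X. discrete_module k S G \<phi> X}"
      "Hom ?C = module_homs A.R" "Ident ?C = (\<lambda>V. \<lambda>v\<in>carrier V. v)"
      "Comp ?C = (\<lambda>U V W g f. compose (carrier U) g f)"
    by (auto simp: discrete_module_category_def)
  have D_simps: "Obj ?D = {Y. discrete_module k S (BijGroup S) (\<lambda>\<sigma>. \<sigma>) Y}"
      "Hom ?D = module_homs B.R" "Ident ?D = (\<lambda>V. \<lambda>v\<in>carrier V. v)"
      "Comp ?D = (\<lambda>U V W g f. compose (carrier U) g f)"
    by (auto simp: discrete_module_category_def)
  have module: "highly_transitive_module k S G \<phi> X" if "discrete_module k S G \<phi> X" for X
    using that ht A.polynomial_skew_module_if_discrete
    by (simp add: highly_transitive_module_def highly_transitive_module_axioms_def)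
  have F_obj: "discrete_module k S (BijGroup S) (\<lambda>\<sigma>. \<sigma>) (?F X)" if "discrete_module k S G \<phi> X" for X
    by (rule highly_transitive_module.discrete_extension[OF module[OF that]])
  note sB = B.polynomial_skew_module_if_discrete and sA = A.polynomial_skew_module_if_discrete
  have H_obj: "discrete_module k S G \<phi> (?H Y)" if "discrete_module k S (BijGroup S) (\<lambda>\<sigma>. \<sigma>) Y" for Y
    by (rule A.discrete_restriction[OF sB[OF that] that])
  have F_hom: "f \<in> module_homs B.R (?F X) (?F Y)"
    if f: "f \<in> module_homs A.R X Y" and X: "discrete_module k S G \<phi> X" and Y: "discrete_module k S G \<phi> Y" for X Y f
  proof -
    interpret X: highly_transitive_module k S G \<phi> X by (rule module[OF X])
    interpret Y: highly_transitive_module k S G \<phi> Y by (rule module[OF Y])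
    note hom = f[unfolded A.discrete_module_homs_iff[OF X Y]]
    have closed: "f x \<in> carrier Y" if "x \<in> carrier X" for x using hom that by auto
    have "f (X.ext_act \<sigma> x) = Y.ext_act \<sigma> (f x)" if \<sigma>: "\<sigma> \<in> Bij S" and x: "x \<in> carrier X" for \<sigma> x
    proof -
      obtain T where T: "X.fixed_by T x" using X.ex_fixed_by[OF x] by blast
      then have T': "finite T" "T \<subseteq> S" by (simp_all add: X.fixed_by_def)
      obtain U g where U: "T \<subseteq> U" "Y.fixed_by U (f x)" and g: "g \<in> carrier G" "\<forall>t\<in>U. \<phi> g t = \<sigma> t"
        using Y.ex_agreeing[OF \<sigma> closed[OF x] T'] by (elim exE conjE)
      have "X.ext_act \<sigma> x = X.act g x" by (rule X.ext_act_eq[OF \<sigma> x T g(1)]) (use U g in blast)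
      moreover have "Y.ext_act \<sigma> (f x) = Y.act g (f x)"
        by (rule Y.ext_act_eq[OF \<sigma> closed[OF x] U(2) g(1)]) (use g in blast)
      ultimately show ?thesis using hom g(1) x by simp
    qed
    then show ?thesis
      unfolding B.discrete_module_homs_iff[OF F_obj[OF X] F_obj[OF Y]]
      using hom closed
      by (simp add: X.extension_act Y.extension_act X.extension_scale Y.extension_scale BijGroup_simps(1))
  qed
  have H_hom: "f \<in> module_homs A.R (?H X) (?H Y)"
    if f: "f \<in> module_homs B.R X Y" and X: "discrete_module k S (BijGroup S) (\<lambda>\<sigma>. \<sigma>) X"
      and Y: "discrete_module k S (BijGroup S) (\<lambda>\<sigma>. \<sigma>) Y" for X Y f
  proof -
    note hom = f[unfolded B.discrete_module_homs_iff[OF X Y]]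
    have closed: "f x \<in> carrier Y" if "x \<in> carrier X" for x using hom that by auto
    show ?thesis
      unfolding A.discrete_module_homs_iff[OF H_obj[OF X] H_obj[OF Y]]
      using hom closed A.perm_Bij
      by (simp add: A.restriction_act[OF sB[OF X]] A.restriction_act[OF sB[OF Y]]
        A.restriction_scale[OF sB[OF X]] A.restriction_scale[OF sB[OF Y]] BijGroup_simps(1))
  qed
  have unit: "is_isomorphism ?C X (?H (?F X)) (\<lambda>v\<in>carrier X. v)" if X: "discrete_module k S G \<phi> X" for X
  proof -
    interpret X: highly_transitive_module k S G \<phi> X by (rule module[OF X])
    show ?thesis
      by (rule A.identity_isomorphism(1)[OF X H_obj[OF F_obj[OF X]]])
        (simp_all add: A.restriction_act[OF X.extension] A.restriction_scale[OF X.extension]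
          X.extension_act X.extension_scale A.perm_Bij X.ext_act_perm)
  qed
  have counit: "is_isomorphism ?D (?F (?H Y)) Y (\<lambda>v\<in>carrier Y. v)"
    if Y: "discrete_module k S (BijGroup S) (\<lambda>\<sigma>. \<sigma>) Y" for Y
  proof -
    note sY = sB[OF Y]
    interpret Y: polynomial_skew_module k S "BijGroup S" "\<lambda>\<sigma>. \<sigma>" Y by (rule sY)
    interpret HY: highly_transitive_module k S G \<phi> "?H Y" by (rule module[OF H_obj[OF Y]])
    have "HY.ext_act \<sigma> y = Y.act \<sigma> y" if \<sigma>: "\<sigma> \<in> Bij S" and y: "y \<in> carrier Y" for \<sigma> y
    proof -
      have y': "y \<in> carrier (?H Y)" using y by simp
      obtain T where T: "Y.fixed_by T y" using Y y Y.discrete_module_iff by blast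
      then have T': "finite T" "T \<subseteq> S" by (simp_all add: Y.fixed_by_def)
      obtain g where g: "g \<in> carrier G" "\<forall>t\<in>T. \<phi> g t = \<sigma> t"
        using A.agreeing_element[OF ht \<sigma> T'] by blast
      have "HY.ext_act \<sigma> y = HY.act g y"
        by (rule HY.ext_act_eq[OF \<sigma> y' A.fixed_by_restriction[OF sY T y] g])
      also have "\<dots> = Y.act (\<phi> g) y" by (rule A.restriction_act[OF sY g(1) y])
      also have "\<dots> = Y.act \<sigma> y"
        by (rule Y.act_eq_if_agree[OF T y]) (use g \<sigma> A.perm_Bij in \<open>auto simp: BijGroup_simps(1)\<close>)
      finally show ?thesis .
    qed
    then show ?thesis
      using B.identity_isomorphism(2)[OF Y F_obj[OF H_obj[OF Y]]]
      by (simp add: HY.extension_act HY.extension_scale A.restriction_scale[OF sY] BijGroup_simps(1)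
          del: restrict_apply)
  qed
  have "is_functor ?C ?D ?F (\<lambda>X Y f. f)"
    unfolding is_functor_def C_simps D_simps using F_obj F_hom by simp
  moreover have "is_functor ?D ?C ?H (\<lambda>X Y f. f)"
    unfolding is_functor_def C_simps D_simps using H_obj H_hom by simp
  moreover have "naturally_isomorphic ?C ?C (\<lambda>X. X) (\<lambda>X Y f. f) (\<lambda>X. ?H (?F X)) (\<lambda>X Y f. f)"
    by (rule naturally_isomorphic_identity) (auto simp: C_simps unit module_homs_def)
  moreover have "naturally_isomorphic ?D ?D (\<lambda>X. ?F (?H X)) (\<lambda>X Y f. f) (\<lambda>X. X) (\<lambda>X Y f. f)"
    by (rule naturally_isomorphic_identity) (auto simp: D_simps counit module_homs_def)
  ultimately show ?thesis
    unfolding equivalent_categories_def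
    using A.is_category_discrete B.is_category_discrete by blast
qed

section \<open>Labelled words\<close>

lemma lex_iff_nth:
  "(xs, ys) \<in> lex r \<longleftrightarrow> length xs = length ys \<and>
    (\<exists>i<length xs. (\<forall>q<i. xs ! q = ys ! q) \<and> (xs ! i, ys ! i) \<in> r)"
proof -
  have "take i xs = take i ys \<longleftrightarrow> (\<forall>q<i. xs ! q = ys ! q)"
    if "length xs = length ys" "i < length xs" for i
    using that by (auto simp: list_eq_iff_nth_eq)
  then show ?thesis
    by (auto simp: lexord_lex lexord_take_index_conv)
qed

lemma list_emb_positions:
  assumes "list_emb P u w"
  shows "\<exists>f. strict_mono_on {..<length u} f \<and> (\<forall>p<length u. f p < length w \<and> P (u ! p) (w ! f p))"
  using assms
proof induction
  case (list_emb_Nil ys)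
  then show ?case by (simp add: strict_mono_on_def)
next
  case (list_emb_Cons xs ys y)
  then obtain f where "strict_mono_on {..<length xs} f"
      "\<forall>p<length xs. f p < length ys \<and> P (xs ! p) (ys ! f p)" by blast
  then show ?case
    by (intro exI[of _ "\<lambda>p. Suc (f p)"]) (simp add: strict_mono_on_def)
next
  case (list_emb_Cons2 x y xs ys)
  then obtain f where "strict_mono_on {..<length xs} f"
      "\<forall>p<length xs. f p < length ys \<and> P (xs ! p) (ys ! f p)" by blast
  then show ?case
    using list_emb_Cons2
    by (intro exI[of _ "\<lambda>p. case p of 0 \<Rightarrow> 0 | Suc p \<Rightarrow> Suc (f p)"])
      (auto simp: strict_mono_on_def less_Suc_eq_0_disj split: nat.splits)
qed

text \<open>A letter \<open>(l, e)\<close> at position \<open>p\<close> of a word stands for the exponent \<open>e\<close> of the point at position \<open>p\<close>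
  of a list of points, and for the label \<open>l\<close> of that point, where \<open>l = 0\<close> means that it has none.\<close>

definition letter_less :: "((nat \<times> nat) \<times> nat \<times> nat) set"
  where "letter_less = less_than <*lex*> less_than"

definition word_le :: "(nat \<times> nat) list \<Rightarrow> (nat \<times> nat) list \<Rightarrow> bool"
  where "word_le = list_emb (\<lambda>x y. fst x = fst y \<and> snd x \<le> snd y)"

definition labelled :: "nat \<Rightarrow> (nat \<times> nat) list \<Rightarrow> bool"
  where "labelled n u \<longleftrightarrow> (\<forall>p<length u. fst (u ! p) \<le> n) \<and>
    (\<forall>l\<in>{1..n}. \<exists>!p. p < length u \<and> fst (u ! p) = l)"

definition exponents :: "'s list \<Rightarrow> (nat \<times> nat) list \<Rightarrow> 's multiset"
  where "exponents D u = (\<Sum>p<length u. replicate_mset (snd (u ! p)) (D ! p))"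

lemma almost_full_on_words: "almost_full_on word_le {u. labelled n u}"
proof -
  have "almost_full_on (\<lambda>x y. fst x = fst y \<and> snd x \<le> snd y) ({..n} \<times> (UNIV :: nat set))"
    by (rule almost_full_on_times) (simp_all add: almost_full_on_finite almost_full_on_nat)
  then have "almost_full_on word_le (lists ({..n} \<times> UNIV))"
    unfolding word_le_def by (rule higman)
  moreover have "{u. labelled n u} \<subseteq> lists ({..n} \<times> UNIV)"
    unfolding labelled_def in_lists_conv_set by (auto simp: mem_Times_iff) (metis fst_conv in_set_conv_nth)
  ultimately show ?thesis by (rule almost_full_on_mono)
qed

lemma letter_less_iff:
  "(x, y) \<in> letter_less \<longleftrightarrow> fst x < fst y \<or> fst x = fst y \<and> snd x < snd y"
  by (cases x; cases y) (auto simp: letter_less_def)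

lemma letter_less_total: "x = y \<or> (x, y) \<in> letter_less \<or> (y, x) \<in> letter_less"
  by (cases x; cases y) (auto simp: letter_less_def)

lemma trans_letter_less: "trans letter_less"
  by (auto simp: letter_less_def)

lemma wf_letter_less: "wf letter_less"
  by (auto simp: letter_less_def)

lemma lex_letter_less_total:
  assumes "length u = length w"
  shows "u = w \<or> (u, w) \<in> lex letter_less \<or> (w, u) \<in> lex letter_less"
proof -
  have "total (lenlex letter_less)"
    by (rule total_lenlex) (use letter_less_total in \<open>auto simp: total_on_def\<close>)
  then have "u \<noteq> w \<Longrightarrow> (u, w) \<in> lenlex letter_less \<or> (w, u) \<in> lenlex letter_less"
    by (simp add: total_on_def)
  then show ?thesis using assms by (auto simp: lenlex_conv)
qed

lemma trans_lex_letter_less: "trans (lex letter_less)"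
proof (rule transI)
  fix u v w assume uv: "(u, v) \<in> lex letter_less" and vw: "(v, w) \<in> lex letter_less"
  then have "length u = length v" "length v = length w" by (simp_all add: lex_iff_nth)
  moreover from this have "(u, w) \<in> lenlex letter_less"
    using transD[OF lenlex_transI[OF trans_letter_less], of u v w] uv vw by (simp add: lenlex_conv)
  ultimately show "(u, w) \<in> lex letter_less" by (auto simp: lenlex_conv)
qed

text \<open>The positions of \<open>u\<close> are embedded into those of \<open>u'\<close>. The embedding acts on all labelled words of the
  length of \<open>u\<close>, by \<open>stretch\<close>: letters are moved along \<open>f\<close>, exponents are
  raised by \<open>excess\<close>, which depends only on \<open>u\<close> and \<open>u'\<close>, and the other positions are filled with the letters of
  \<open>u'\<close>. In terms of polynomials, indeterminates are renamed and then a fixed monomial is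
  multiplied on; it is chosen so that \<open>u\<close> goes to \<open>u'\<close>.\<close>

locale word_embedding =
  fixes n :: nat and u u' :: "(nat \<times> nat) list" and f :: "nat \<Rightarrow> nat"
  assumes labelled: "labelled n u" "labelled n u'"
    and mono: "strict_mono_on {..<length u} f"
    and bound: "\<And>p. p < length u \<Longrightarrow> f p < length u'"
    and letters: "\<And>p. p < length u \<Longrightarrow> fst (u ! p) = fst (u' ! f p) \<and> snd (u ! p) \<le> snd (u' ! f p)"
begin

lemma inj: "inj_on f {..<length u}"
  using mono by (rule strict_mono_on_imp_inj_on)

lemma inv: "p < length u \<Longrightarrow> inv_into {..<length u} f (f p) = p"
  using inv_into_f_f[OF inj] by simp

definition excess :: "nat \<Rightarrow> nat"
  where "excess q = (if q \<in> f ` {..<length u} then snd (u' ! q) - snd (u ! inv_into {..<length u} f q)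
    else snd (u' ! q))"

definition stretch :: "(nat \<times> nat) list \<Rightarrow> (nat \<times> nat) list"
  where "stretch w = map (\<lambda>q. if q \<in> f ` {..<length u}
    then (fst (w ! inv_into {..<length u} f q), snd (w ! inv_into {..<length u} f q) + excess q)
    else u' ! q) [0..<length u']"

lemma length_stretch [simp]: "length (stretch w) = length u'"
  by (simp add: stretch_def)

lemma stretch_at: "p < length u \<Longrightarrow> stretch w ! f p = (fst (w ! p), snd (w ! p) + excess (f p))"
  using bound[of p] by (simp add: stretch_def inv)

lemma stretch_off: "q < length u' \<Longrightarrow> q \<notin> f ` {..<length u} \<Longrightarrow> stretch w ! q = u' ! q"
  by (simp add: stretch_def)

lemma excess_at: "p < length u \<Longrightarrow> excess (f p) = snd (u' ! f p) - snd (u ! p)"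
  by (simp add: excess_def inv)

lemma position_cases [consumes 1]:
  assumes "q < length u'"
  obtains p where "p < length u" "q = f p" | "q < length u'" "q \<notin> f ` {..<length u}"
  using assms by auto

text \<open>As both words carry every label exactly once, only blank letters remain unmatched.\<close>

lemma unmatched_blank:
  assumes q: "q < length u'" "q \<notin> f ` {..<length u}"
  shows "fst (u' ! q) = 0"
proof (rule ccontr)
  assume "fst (u' ! q) \<noteq> 0"
  then have l: "fst (u' ! q) \<in> {1..n}" using labelled(2) q by (auto simp: labelled_def)
  then obtain p where p: "p < length u" "fst (u ! p) = fst (u' ! q)"
    using labelled(1) unfolding labelled_def by blast
  then have "fst (u' ! f p) = fst (u' ! q)" using letters by simp
  then have "f p = q" using labelled(2) l q(1) bound[OF p(1)] unfolding labelled_def by blast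
  then show False using q(2) p(1) by blast
qed

lemma stretch_self: "stretch u = u'"
proof (rule nth_equalityI)
  fix q assume "q < length (stretch u)"
  then have "q < length u'" by simp
  then show "stretch u ! q = u' ! q"
    by (cases rule: position_cases[of q])
      (use letters in \<open>auto simp: stretch_at stretch_off excess_at prod_eq_iff\<close>)
qed simp

lemma labelled_stretch:
  assumes w: "labelled n w" "length w = length u"
  shows "labelled n (stretch w)"
  unfolding labelled_def
proof (intro conjI ballI allI impI)
  fix q assume "q < length (stretch w)"
  then have "q < length u'" by simp
  then show "fst (stretch w ! q) \<le> n"
    by (cases rule: position_cases[of q])
      (use w unmatched_blank in \<open>auto simp: labelled_def stretch_at stretch_off\<close>)
next
  fix l assume l: "l \<in> {1..n}"
  then obtain p where p: "p < length u" "fst (w ! p) = l" and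
      unique: "\<And>p'. p' < length u \<Longrightarrow> fst (w ! p') = l \<Longrightarrow> p' = p"
    using w unfolding labelled_def by metis
  show "\<exists>!q. q < length (stretch w) \<and> fst (stretch w ! q) = l"
  proof (rule ex1I[of _ "f p"])
    show "f p < length (stretch w) \<and> fst (stretch w ! f p) = l"
      using p bound by (simp add: stretch_at)
    fix q assume q: "q < length (stretch w) \<and> fst (stretch w ! q) = l"
    then have "q < length u'" by simp
    then show "q = f p"
      by (cases rule: position_cases[of q])
        (use q l unique unmatched_blank in \<open>auto simp: stretch_at stretch_off\<close>)
  qed
qed

text \<open>As \<open>f\<close> is increasing, the first difference of two words stays the first difference of their images.\<close>

lemma stretch_lex:
  assumes wv: "(w, v) \<in> lex letter_less" and v: "length v = length u"
  shows "(stretch w, stretch v) \<in> lex letter_less"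
proof -
  obtain i where i: "i < length u" "\<forall>p<i. w ! p = v ! p" "(w ! i, v ! i) \<in> letter_less"
    using wv v by (auto simp: lex_iff_nth)
  have "stretch w ! q = stretch v ! q" if q: "q < f i" for q
  proof -
    have "q < length u'" using q bound[OF i(1)] by simp
    then show ?thesis
    proof (cases rule: position_cases[of q])
      case (1 p)
      have "p < i"
      proof (rule ccontr)
        assume "\<not> p < i"
        then have "f i \<le> f p"
          using mono 1 i(1) by (cases "p = i") (auto simp: strict_mono_on_def less_imp_le)
        then show False using 1 q by simp
      qed
      then show ?thesis using 1 i(2) by (simp add: stretch_at)
    qed (simp add: stretch_off)
  qed
  moreover have "(stretch w ! f i, stretch v ! f i) \<in> letter_less"
    using i by (auto simp: stretch_at letter_less_iff)
  ultimately show ?thesis using bound[OF i(1)] by (auto simp: lex_iff_nth)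
qed

lemma exponents_stretch:
  assumes w: "length w = length u"
  shows "exponents D (stretch w) = (\<Sum>q<length u'. replicate_mset (excess q) (D ! q)) +
    (\<Sum>p<length u. replicate_mset (snd (w ! p)) (D ! f p))"
proof -
  let ?m = "\<lambda>q. if q \<in> f ` {..<length u} then replicate_mset (snd (w ! inv_into {..<length u} f q)) (D ! q) else {#}"
  have "replicate_mset (snd (stretch w ! q)) (D ! q) = replicate_mset (excess q) (D ! q) + ?m q"
    if "q < length u'" for q
    using that
    by (cases rule: position_cases[of q])
      (simp_all add: stretch_at stretch_off inv excess_def multiset_eq_iff)
  then have "exponents D (stretch w) = (\<Sum>q<length u'. replicate_mset (excess q) (D ! q) + ?m q)"
    by (simp add: exponents_def)
  also have "(\<Sum>q<length u'. ?m q) = (\<Sum>q\<in>f ` {..<length u}. ?m q)"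
    using bound by (intro sum.mono_neutral_right) auto
  then have "(\<Sum>q<length u'. ?m q) = (\<Sum>p<length u. replicate_mset (snd (w ! p)) (D ! f p))"
    by (simp add: sum.reindex[OF inj] inv)
  then have "(\<Sum>q<length u'. replicate_mset (excess q) (D ! q) + ?m q) =
      (\<Sum>q<length u'. replicate_mset (excess q) (D ! q)) +
      (\<Sum>p<length u. replicate_mset (snd (w ! p)) (D ! f p))"
    by (simp only: sum.distrib)
  finally show ?thesis .
qed

end

lemma word_le_embedding:
  assumes "word_le u u'" "labelled n u" "labelled n u'"
  shows "\<exists>f. word_embedding n u u' f"
  using list_emb_positions[OF assms(1)[unfolded word_le_def]] assms(2,3)
  by (auto simp: word_embedding_def)

section \<open>Finitely generated discrete modules are Noetherian\<close>

context polynomial_skew_module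
begin

text \<open>The skew monomial \<open>a x\<^sup>m g\<close>.\<close>

definition mon :: "'k \<Rightarrow> 's multiset \<Rightarrow> 'g \<Rightarrow> 'g \<Rightarrow> 's multiset \<Rightarrow> 'k"
  where "mon a m g = skew_elem P (poly_monom k a m) g"

lemma mon_closed: "a \<in> carrier k \<Longrightarrow> set_mset m \<subseteq> S \<Longrightarrow> g \<in> carrier G \<Longrightarrow> mon a m g \<in> carrier R"
  by (simp add: mon_def single_closed k.poly_monom_closed)

lemma mon_mult:
  assumes "a \<in> carrier k" "b \<in> carrier k" "set_mset m \<subseteq> S" "set_mset l \<subseteq> S" "g \<in> carrier G" "h \<in> carrier G"
  shows "mon a m g \<otimes>\<^bsub>R\<^esub> mon b l h = mon (a \<otimes>\<^bsub>k\<^esub> b) (m + image_mset (\<phi> g) l) (g \<otimes>\<^bsub>G\<^esub> h)"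
  using assms
  by (simp add: mon_def single_mult k.poly_monom_closed perm_poly_monom perm_Bij k.poly_monom_mult)

lemma mon_smult: "a \<in> carrier k \<Longrightarrow> set_mset m \<subseteq> S \<Longrightarrow> g \<in> carrier G \<Longrightarrow> v \<in> carrier V \<Longrightarrow>
    mon a m g \<odot>\<^bsub>V\<^esub> v = scale (poly_monom k a m) (act g v)"
  by (simp add: mon_def single_smult k.poly_monom_closed)

lemma mon_one: "mon \<one>\<^bsub>k\<^esub> {#} \<one>\<^bsub>G\<^esub> = \<one>\<^bsub>R\<^esub>"
  by (simp add: mon_def R_eq skew.one_eq k.poly_one_eq)

definition const :: "'k \<Rightarrow> 'g \<Rightarrow> 's multiset \<Rightarrow> 'k"
  where "const a = mon a {#} \<one>\<^bsub>G\<^esub>"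

lemma ring_hom_const: "ring_hom_ring k R const"
proof (rule ring_hom_ringI)
  fix a b assume a: "a \<in> carrier k" and b: "b \<in> carrier k"
  have "poly_monom k (a \<oplus>\<^bsub>k\<^esub> b) {#} = poly_monom k a {#} \<oplus>\<^bsub>P\<^esub> poly_monom k b {#}"
    using finitely_supported.add_single[OF k.finitely_supported_poly_ring a b]
    by (simp add: poly_monom_eq_skew_elem)
  then show "const (a \<oplus>\<^bsub>k\<^esub> b) = const a \<oplus>\<^bsub>R\<^esub> const b"
    using a b by (simp add: const_def mon_def R_eq skew.RG.add_single k.poly_monom_closed)
qed (simp_all add: k.ring_axioms R.ring_axioms const_def mon_closed mon_mult mon_one)

lemma mon_const_commute: "a \<in> carrier k \<Longrightarrow> set_mset m \<subseteq> S \<Longrightarrow> g \<in> carrier G \<Longrightarrow>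
    mon \<one>\<^bsub>k\<^esub> m g \<otimes>\<^bsub>R\<^esub> const a = const a \<otimes>\<^bsub>R\<^esub> mon \<one>\<^bsub>k\<^esub> m g"
  by (simp add: const_def mon_mult perm_one multiset.map_ident_strong subset_iff)

lemma mon_eq_const_mult: "a \<in> carrier k \<Longrightarrow> set_mset m \<subseteq> S \<Longrightarrow> g \<in> carrier G \<Longrightarrow>
    mon a m g = const a \<otimes>\<^bsub>R\<^esub> mon \<one>\<^bsub>k\<^esub> m g"
  by (simp add: const_def mon_mult perm_one multiset.map_ident_strong subset_iff)

text \<open>A polynomial is a sum of monomials, so the skew group ring is additively generated by skew
  monomials.\<close>

lemma mon_induct [consumes 1, case_names mon zero add]:
  assumes r: "r \<in> carrier R"
    and mon: "\<And>a m g. a \<in> carrier k \<Longrightarrow> set_mset m \<subseteq> S \<Longrightarrow> g \<in> carrier G \<Longrightarrow> Q (mon a m g)"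
    and zero: "Q \<zero>\<^bsub>R\<^esub>"
    and add: "\<And>r s. r \<in> carrier R \<Longrightarrow> s \<in> carrier R \<Longrightarrow> Q r \<Longrightarrow> Q s \<Longrightarrow> Q (r \<oplus>\<^bsub>R\<^esub> s)"
  shows "Q r"
  using r unfolding R_eq
proof (induction rule: skew.RG.single_induct)
  case (single p g)
  from single(1) show ?case
  proof (induction rule: k.poly_induct)
    case (monom a m)
    then show ?case using mon[OF _ _ single(2)] by (simp add: mon_def)
  next
    case zero
    then show ?case using assms(3) by (simp add: skew.RG.zero_single R_eq)
  next
    case (add p q)
    then show ?case
      using assms(4)[of "skew_elem P p g" "skew_elem P q g"] single(2)
      by (simp add: skew.RG.add_single single_closed flip: R_eq)
  qed
qed (use zero add in \<open>simp_all add: R_eq\<close>)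

end

text \<open>Finitely many vectors have a common finite support, so one list \<open>ts\<close> serves all generators.\<close>

locale finitely_generated_discrete_module = highly_transitive_module k S G \<phi> V + k: noetherian_ring k
  for k :: "('k, 'c) ring_scheme" and S :: "'s set" and G :: "('g, 'd) monoid_scheme"
    and \<phi> :: "'g \<Rightarrow> 's \<Rightarrow> 's" and V :: "('g \<Rightarrow> 's multiset \<Rightarrow> 'k, 'm, 'e) module_scheme" (structure) +
  fixes vs :: "'m list" and ts :: "'s list"
  assumes vs_closed: "set vs \<subseteq> carrier V"
    and generated: "carrier V = generated_submodule R V (set vs)"
    and ts: "distinct ts"
    and fixed: "v \<in> set vs \<Longrightarrow> fixed_by (set ts) v"
    and ts_S: "set ts \<subseteq> S"
begin

text \<open>The group element carries \<open>ts ! l\<close> to the entry of \<open>D\<close> with label \<open>Suc l\<close>; labels are shifted by one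
  because \<open>0\<close> marks a point without label.\<close>

definition placement :: "'s list \<Rightarrow> (nat \<times> nat) list \<Rightarrow> 'g \<Rightarrow> bool"
  where "placement D u g \<longleftrightarrow> g \<in> carrier G \<and>
    (\<forall>p<length u. fst (u ! p) \<noteq> 0 \<longrightarrow> \<phi> g (ts ! (fst (u ! p) - 1)) = D ! p)"

text \<open>The symbol \<open>(D, i, u)\<close> encodes the element \<open>x\<^sup>m g v\<^sub>i\<close> where the word \<open>u\<close> describes \<open>m\<close> and the images of
  the support under \<open>g\<close> relative to the list of points \<open>D\<close>.\<close>

definition symbols :: "('s list \<times> nat \<times> (nat \<times> nat) list) set"
  where "symbols = {(D, i, u). distinct D \<and> set D \<subseteq> S \<and> length D = length u \<and> i < length vs \<and>
    labelled (length ts) u}"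

definition hat :: "'s list \<times> nat \<times> (nat \<times> nat) list \<Rightarrow> 'm"
  where "hat = (\<lambda>(D, i, u). mon \<one>\<^bsub>k\<^esub> (exponents D u) (SOME g. placement D u g) \<odot> (vs ! i))"

text \<open>Only symbols over the same list of points are comparable, whereas \<open>symbol_le\<close> below relates symbols
  over different lists.\<close>

definition symbol_less where
  "symbol_less x y \<longleftrightarrow> (case (x, y) of ((D, i, u), (D', i', u')) \<Rightarrow>
    D = D' \<and> ((i, u), (i', u')) \<in> less_than <*lex*> lex letter_less)"

definition symbol_le where
  "symbol_le (x :: 's list \<times> nat \<times> (nat \<times> nat) list) (y :: 's list \<times> nat \<times> (nat \<times> nat) list) \<longleftrightarrow>
    fst (snd x) = fst (snd y) \<and> word_le (snd (snd x)) (snd (snd y))"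

lemma exponents_subset: "set D \<subseteq> S \<Longrightarrow> length D = length u \<Longrightarrow> set_mset (exponents D u) \<subseteq> S"
  by (auto simp: exponents_def set_mset_sum split: if_splits)

lemma vs_nth_closed: "i < length vs \<Longrightarrow> vs ! i \<in> carrier V"
  using vs_closed by (auto simp: subset_iff)

lemma ex_placement:
  assumes D: "distinct D" "set D \<subseteq> S" "length D = length u" and u: "labelled (length ts) u"
  shows "\<exists>g. placement D u g"
proof -
  define pos where "pos l = (THE p. p < length u \<and> fst (u ! p) = Suc l)" for l
  have pos: "pos l < length u \<and> fst (u ! pos l) = Suc l" if "l < length ts" for l
  proof -
    have "\<exists>!p. p < length u \<and> fst (u ! p) = Suc l" using u that by (simp add: labelled_def)
    then show ?thesis unfolding pos_def by (rule theI')
  qed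
  have pos_eq: "pos l = p" if "p < length u" "fst (u ! p) = Suc l" for l p
  proof -
    have "l < length ts" using u that by (fastforce simp: labelled_def)
    then have "\<exists>!p. p < length u \<and> fst (u ! p) = Suc l" using u by (simp add: labelled_def)
    then show ?thesis unfolding pos_def using that by (intro the1_equality) auto
  qed
  let ?ss = "map (\<lambda>l. D ! pos l) [0..<length ts]"
  have "inj_on (\<lambda>l. D ! pos l) {0..<length ts}"
  proof (rule inj_onI)
    fix l l' assume l: "l \<in> {0..<length ts}" "l' \<in> {0..<length ts}" and eq: "D ! pos l = D ! pos l'"
    then have "pos l = pos l'" using D pos by (simp add: nth_eq_iff_index_eq)
    then show "l = l'" using pos l by (metis atLeastLessThan_iff nat.inject)
  qed
  then have "distinct ?ss" by (simp add: distinct_map)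
  moreover have "set ?ss \<subseteq> S" using D pos by (auto simp: subset_iff)
  ultimately obtain g where g: "g \<in> carrier G" "map (\<phi> g) ts = ?ss"
    using highly_transitive ts ts_S unfolding highly_transitive_def by (metis length_map length_upt minus_nat.diff_0)
  have "\<phi> g (ts ! (fst (u ! p) - 1)) = D ! p" if p: "p < length u" "fst (u ! p) \<noteq> 0" for p
  proof -
    obtain l where l: "fst (u ! p) = Suc l" using p(2) not0_implies_Suc by blast
    then have "l < length ts" using u p(1) by (fastforce simp: labelled_def)
    then have "\<phi> g (ts ! l) = D ! pos l"
      using arg_cong[OF g(2), of "\<lambda>xs. xs ! l"] by simp
    then show ?thesis using pos_eq[OF p(1) l] l by simp
  qed
  then show ?thesis using g(1) by (auto simp: placement_def)
qed

text \<open>The choice of \<open>g\<close> is immaterial, since \<open>vs ! i\<close> is fixed by the stabilizer of \<open>ts\<close> and every label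
  occurs in \<open>u\<close>.\<close>

lemma hat_eq:
  assumes x: "(D, i, u) \<in> symbols" and g: "placement D u g"
  shows "hat (D, i, u) = mon \<one>\<^bsub>k\<^esub> (exponents D u) g \<odot> (vs ! i)"
proof -
  define h where "h = (SOME g. placement D u g)"
  have h: "placement D u h" unfolding h_def using g by (rule someI)
  have u: "labelled (length ts) u" and i: "i < length vs" using x by (auto simp: symbols_def)
  have "act h (vs ! i) = act g (vs ! i)"
  proof (rule act_eq_if_agree[OF fixed vs_nth_closed[OF i]])
    fix t assume "t \<in> set ts"
    then obtain l where l: "l < length ts" "t = ts ! l" by (auto simp: in_set_conv_nth)
    then have "Suc l \<in> {1..length ts}" by simp
    then obtain p where "p < length u" "fst (u ! p) = Suc l"
      using u unfolding labelled_def by blast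
    then have "\<phi> g' t = D ! p" if "placement D u g'" for g'
      using that unfolding placement_def l(2) by (metis diff_Suc_1 nat.simps(3))
    then show "\<phi> h t = \<phi> g t" using g h by simp
  qed (use g h i in \<open>auto simp: placement_def\<close>)
  moreover have "set_mset (exponents D u) \<subseteq> S" using x by (intro exponents_subset) (auto simp: symbols_def)
  moreover have "g \<in> carrier G" "h \<in> carrier G" using g h by (simp_all add: placement_def)
  moreover have "hat (D, i, u) = mon \<one>\<^bsub>k\<^esub> (exponents D u) h \<odot> (vs ! i)" by (simp add: hat_def h_def)
  ultimately show ?thesis using i by (simp add: mon_smult vs_nth_closed)
qed

lemma hat_closed: "x \<in> symbols \<Longrightarrow> hat x \<in> carrier V"
proof -
  assume x: "x \<in> symbols"
  obtain D i u where D: "x = (D, i, u)" by (cases x)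
  obtain g where g: "placement D u g" using ex_placement[of D u] x by (auto simp: D symbols_def)
  have "set_mset (exponents D u) \<subseteq> S" "i < length vs"
    using x by (auto simp: D symbols_def intro: exponents_subset[THEN subsetD])
  then show "hat x \<in> carrier V"
    using hat_eq[of D i u g] x g
    by (simp add: D smult_closed mon_closed vs_nth_closed placement_def)
qed

lemma symbol_less_trans: "symbol_less x y \<Longrightarrow> symbol_less y z \<Longrightarrow> symbol_less x z"
  using transD[OF trans_lex_letter_less]
  by (auto simp: symbol_less_def split: prod.splits)

lemma wf_symbol_less: "wfP symbol_less"
proof -
  have "wf (inv_image (less_than <*lex*> lex letter_less) snd)"
    by (intro wf_inv_image wf_lex_prod wf_less_than wf_lex wf_letter_less)
  then have "wf {(x, y). symbol_less x y}"
    by (rule wf_subset) (auto simp: symbol_less_def split: prod.splits)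
  then show ?thesis by (simp add: wfp_def)
qed

lemma symbol_less_total:
  assumes "x \<in> symbols" "y \<in> symbols" "fst x = fst y"
  shows "x = y \<or> symbol_less x y \<or> symbol_less y x"
  using assms lex_letter_less_total[of "snd (snd x)" "snd (snd y)"]
  by (auto simp: symbols_def symbol_less_def)

lemma symbol_less_fst: "symbol_less x y \<Longrightarrow> fst x = fst y"
  by (auto simp: symbol_less_def split: prod.splits)

lemma almost_full_on_symbols: "almost_full_on symbol_le symbols"
  unfolding almost_full_on_def
proof (intro allI impI)
  fix x :: "nat \<Rightarrow> 's list \<times> nat \<times> (nat \<times> nat) list" assume x: "\<forall>m. x m \<in> symbols"
  have "almost_full_on (\<lambda>a b. fst a = fst b \<and> word_le (snd a) (snd b)) ({..<length vs} \<times> {u. labelled (length ts) u})"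
    by (intro almost_full_on_times almost_full_on_finite almost_full_on_words) simp
  moreover have "snd (x m) \<in> {..<length vs} \<times> {u. labelled (length ts) u}" for m
    using x[rule_format, of m] by (auto simp: symbols_def)
  ultimately obtain m m' where "m < m'" "fst (snd (x m)) = fst (snd (x m')) \<and> word_le (snd (snd (x m))) (snd (snd (x m')))"
    by (rule almost_full_onD)
  then show "\<exists>m m'. m < m' \<and> symbol_le (x m) (x m')"
    by (auto simp: symbol_le_def)
qed

text \<open>By high transitivity some \<open>h \<in> G\<close> carries the points of \<open>D\<close> to the points of \<open>D'\<close> at the positions
  given by the embedding of words. Multiplication by \<open>h\<close>, and then by the monomial with the excess
  exponents, stretches all words over \<open>D\<close>.\<close>

lemma symbol_multiplier:
  assumes x: "x \<in> symbols" and y: "y \<in> symbols" and le: "symbol_le x y"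
  shows "\<exists>r\<in>carrier R. (\<forall>a\<in>carrier k. r \<otimes>\<^bsub>R\<^esub> const a = const a \<otimes>\<^bsub>R\<^esub> r) \<and> r \<odot> hat x = hat y \<and>
    (\<forall>z\<in>symbols. symbol_less z x \<longrightarrow> (\<exists>z'\<in>symbols. symbol_less z' y \<and> r \<odot> hat z = hat z'))"
proof -
  obtain D i u where x_eq: "x = (D, i, u)" by (cases x)
  obtain D' i' u' where "y = (D', i', u')" by (cases y)
  then have y_eq: "y = (D', i, u')" and uu': "word_le u u'" using le by (simp_all add: symbol_le_def x_eq)
  have D: "distinct D" "set D \<subseteq> S" "length D = length u" "labelled (length ts) u"
    and D': "distinct D'" "set D' \<subseteq> S" "length D' = length u'" "labelled (length ts) u'"
    using x y by (auto simp: x_eq y_eq symbols_def)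
  obtain f where "word_embedding (length ts) u u' f" using word_le_embedding[OF uu' D(4) D'(4)] by blast
  then interpret word_embedding "length ts" u u' f .
  have "distinct (map (\<lambda>p. D' ! f p) [0..<length u])"
    using inj D' bound by (auto simp: distinct_map inj_on_def nth_eq_iff_index_eq)
  moreover have "set (map (\<lambda>p. D' ! f p) [0..<length u]) \<subseteq> S"
    using D' bound by (auto simp: subset_iff)
  ultimately obtain h where h: "h \<in> carrier G" "map (\<phi> h) D = map (\<lambda>p. D' ! f p) [0..<length u]"
    using highly_transitive D unfolding highly_transitive_def
    by (metis length_map length_upt minus_nat.diff_0)
  have h_nth: "\<phi> h (D ! p) = D' ! f p" if "p < length u" for p
    using arg_cong[OF h(2), of "\<lambda>xs. xs ! p"] that D(3) by simp
  define c where "c = (\<Sum>q<length u'. replicate_mset (excess q) (D' ! q))"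
  have c: "set_mset c \<subseteq> S"
    using D' by (auto simp: c_def set_mset_sum split: if_splits)
  define r where "r = mon \<one>\<^bsub>k\<^esub> c h"
  have r_hat: "(D', j, stretch w) \<in> symbols \<and> r \<odot> hat (D, j, w) = hat (D', j, stretch w)"
    if z: "(D, j, w) \<in> symbols" for j w
  proof -
    have w: "length w = length u" "labelled (length ts) w" "j < length vs"
      using z D by (auto simp: symbols_def)
    have z': "(D', j, stretch w) \<in> symbols"
      using D' w labelled_stretch by (simp add: symbols_def)
    obtain g where g: "placement D w g" using ex_placement[OF D(1,2)] w D(3) by metis
    then have gG: "g \<in> carrier G" by (simp add: placement_def)
    have "\<phi> (h \<otimes>\<^bsub>G\<^esub> g) (ts ! (fst (stretch w ! q) - 1)) = D' ! q"
      if "q < length u'" "fst (stretch w ! q) \<noteq> 0" for q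
      using that
    proof (cases rule: position_cases)
      case (1 p)
      then have p: "p < length w" "fst (w ! p) \<noteq> 0" using that w by (simp_all add: stretch_at)
      then have "fst (w ! p) - 1 < length ts"
        using w(2) by (fastforce simp: labelled_def)
      then have "ts ! (fst (w ! p) - 1) \<in> S" using ts_S by (auto simp: subset_iff)
      moreover have "\<phi> g (ts ! (fst (w ! p) - 1)) = D ! p" using g p by (simp add: placement_def)
      ultimately show ?thesis using 1 h(1) gG h_nth by (simp add: composition_rule stretch_at)
    next
      case 2
      then show ?thesis using that unmatched_blank by (simp add: stretch_off)
    qed
    then have hg: "placement D' (stretch w) (h \<otimes>\<^bsub>G\<^esub> g)"
      using h(1) gG by (simp add: placement_def)
    have "image_mset (\<phi> h) (exponents D w) = (\<Sum>p<length u. image_mset (\<phi> h) (replicate_mset (snd (w ! p)) (D ! p)))"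
      using sum_comp_morphism[of "image_mset (\<phi> h)" "\<lambda>p. replicate_mset (snd (w ! p)) (D ! p)" "{..<length u}"]
      by (simp add: exponents_def w o_def)
    also have "\<dots> = (\<Sum>p<length u. replicate_mset (snd (w ! p)) (D' ! f p))"
      by (rule sum.cong) (simp_all add: h_nth)
    finally have expo: "exponents D' (stretch w) = c + image_mset (\<phi> h) (exponents D w)"
      using exponents_stretch[OF w(1), of D'] by (simp add: c_def)
    have "set_mset (exponents D w) \<subseteq> S" using exponents_subset[of D w] D w by simp
    then have "r \<odot> hat (D, j, w) = mon \<one>\<^bsub>k\<^esub> (exponents D' (stretch w)) (h \<otimes>\<^bsub>G\<^esub> g) \<odot> (vs ! j)"
      using c h(1) gG w(3) by (simp add: hat_eq[OF z g] r_def expo mon_closed mon_mult vs_nth_closed flip: smult_assoc)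
    then show ?thesis using hat_eq[OF z' hg] z' by simp
  qed
  show ?thesis
  proof (intro bexI[of _ r] conjI ballI impI)
    show "r \<in> carrier R" using c h by (simp add: r_def mon_closed)
    show "r \<otimes>\<^bsub>R\<^esub> const a = const a \<otimes>\<^bsub>R\<^esub> r" if "a \<in> carrier k" for a
      using mon_const_commute[OF that c h(1)] by (simp add: r_def)
    show "r \<odot> hat x = hat y" using r_hat[of i u] x by (simp add: x_eq y_eq stretch_self)
    fix z assume z: "z \<in> symbols" "symbol_less z x"
    obtain j w where z_eq: "z = (D, j, w)" and less: "j < i \<or> j = i \<and> (w, u) \<in> lex letter_less"
      using z(2) by (cases z) (auto simp: symbol_less_def x_eq)
    have "j < i \<or> j = i \<and> (stretch w, u') \<in> lex letter_less"
      using less stretch_lex[of w u] by (auto simp: stretch_self)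
    then have "symbol_less (D', j, stretch w) y" by (auto simp: symbol_less_def y_eq)
    then show "\<exists>z'\<in>symbols. symbol_less z' y \<and> r \<odot> hat z = hat z'"
      using r_hat[of j w] z(1) by (auto simp: z_eq)
  qed
qed

text \<open>The elements \<open>x\<^sup>m g v\<^sub>i\<close> that involve only points of \<open>U\<close>.\<close>

definition terms :: "'s set \<Rightarrow> 'm set"
  where "terms U = {mon \<one>\<^bsub>k\<^esub> m g \<odot> v | m g v. set_mset m \<subseteq> U \<and> g \<in> carrier G \<and> \<phi> g ` set ts \<subseteq> U \<and> v \<in> set vs}"

lemma terms_closed: "U \<subseteq> S \<Longrightarrow> terms U \<subseteq> carrier V"
  using vs_closed by (auto simp: terms_def subset_iff intro!: smult_closed mon_closed)

lemma terms_mono: "U \<subseteq> U' \<Longrightarrow> terms U \<subseteq> terms U'"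
  by (fastforce simp: terms_def)

lemma const_closed: "const ` carrier k \<subseteq> carrier R"
  by (auto simp: const_def mon_closed)

lemma const_mult_closed:
  assumes "c \<in> const ` carrier k" "d \<in> const ` carrier k"
  shows "c \<otimes>\<^bsub>R\<^esub> d \<in> const ` carrier k"
proof -
  obtain a b where ab: "a \<in> carrier k" "b \<in> carrier k" "c = const a" "d = const b" using assms by blast
  then have "c \<otimes>\<^bsub>R\<^esub> d = const (a \<otimes>\<^bsub>k\<^esub> b)" by (simp add: const_def mon_mult)
  then show ?thesis using ab by simp
qed

abbreviation "span_terms U \<equiv> scalar_span V (const ` carrier k) (terms U)"

text \<open>A skew monomial \<open>a x\<^sup>m g\<close> carries terms over \<open>U\<close> to terms over \<open>g U\<close> enlarged by the indeterminates of
  \<open>m\<close>.\<close>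

lemma smult_span_terms:
  assumes U: "finite U" "U \<subseteq> S" and x: "x \<in> span_terms U" and r: "r \<in> carrier R"
  shows "\<exists>U'. finite U' \<and> U' \<subseteq> S \<and> r \<odot> x \<in> span_terms U'"
  using r
proof (induction rule: mon_induct)
  case (mon a m g)
  let ?U = "set_mset m \<union> \<phi> g ` U"
  have US: "?U \<subseteq> S" using mon U image_closed by auto
  have xV: "x \<in> carrier V" by (rule scalar_span_closed[OF const_closed terms_closed[OF U(2)] x])
  have maps: "mon \<one>\<^bsub>k\<^esub> m g \<odot> t \<in> terms ?U" if t: "t \<in> terms U" for t
  proof -
    obtain l h v where l: "t = mon \<one>\<^bsub>k\<^esub> l h \<odot> v" "set_mset l \<subseteq> U" "h \<in> carrier G" "\<phi> h ` set ts \<subseteq> U" "v \<in> set vs"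
      using t by (auto simp: terms_def)
    have "set_mset l \<subseteq> S" "v \<in> carrier V" using l U vs_closed by auto
    then have "mon \<one>\<^bsub>k\<^esub> m g \<odot> t = mon \<one>\<^bsub>k\<^esub> (m + image_mset (\<phi> g) l) (g \<otimes>\<^bsub>G\<^esub> h) \<odot> v"
      using l mon by (simp add: mon_closed mon_mult flip: smult_assoc)
    moreover have "set_mset (m + image_mset (\<phi> g) l) \<subseteq> ?U" using l by auto
    moreover have "\<phi> (g \<otimes>\<^bsub>G\<^esub> h) ` set ts \<subseteq> ?U"
      using l mon ts_S by (auto simp: composition_rule subset_iff)
    ultimately show ?thesis using l mon G.m_closed unfolding terms_def by blast
  qed
  have *: "mon \<one>\<^bsub>k\<^esub> m g \<odot> x \<in> span_terms ?U"
    by (rule scalar_span_smult[OF const_closed terms_closed[OF U(2)] terms_closed[OF US] _ _ maps x])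
      (use mon mon_const_commute in \<open>auto simp: mon_closed\<close>)
  have "const a \<in> const ` carrier k" using mon by simp
  then have "const a \<odot> (mon \<one>\<^bsub>k\<^esub> m g \<odot> x) \<in> span_terms ?U"
    using scalar_span_scalar[OF const_closed terms_closed[OF US] const_mult_closed _ *] by blast
  then have "mon a m g \<odot> x \<in> span_terms ?U"
    using mon xV const_closed by (simp add: mon_eq_const_mult[of a] smult_assoc mon_closed image_subset_iff)
  moreover have "finite ?U" using U by simp
  ultimately show ?case using US by blast
next
  case zero
  have "x \<in> carrier V" by (rule scalar_span_closed[OF const_closed terms_closed[OF U(2)] x])
  then show ?case by (intro exI[of _ "{}"]) (simp add: scalar_span.zero)
next
  case (add r s)
  then obtain U1 U2 where *: "finite U1" "U1 \<subseteq> S" "finite U2" "U2 \<subseteq> S"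
      "r \<odot> x \<in> span_terms U1" "s \<odot> x \<in> span_terms U2" by blast
  have US: "U1 \<union> U2 \<subseteq> S" using * by blast
  have xV: "x \<in> carrier V" by (rule scalar_span_closed[OF const_closed terms_closed[OF U(2)] x])
  have "r \<odot> x \<in> span_terms (U1 \<union> U2)" "s \<odot> x \<in> span_terms (U1 \<union> U2)"
    using * scalar_span_mono[OF terms_mono] by blast+
  then have "(r \<oplus>\<^bsub>R\<^esub> s) \<odot> x \<in> span_terms (U1 \<union> U2)"
    using add xV scalar_span_add[OF const_closed terms_closed[OF US]] by (simp add: smult_l_distr)
  moreover have "finite (U1 \<union> U2)" using * by simp
  ultimately show ?case using US by blast
qed

lemma ex_span_terms:
  assumes "x \<in> carrier V"
  shows "\<exists>U. finite U \<and> U \<subseteq> S \<and> x \<in> span_terms U"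
proof -
  let ?N = "{x \<in> carrier V. \<exists>U. finite U \<and> U \<subseteq> S \<and> x \<in> span_terms U}"
  have "submodule ?N R V"
  proof (rule submoduleI)
    show "\<zero> \<in> ?N" by (auto intro: scalar_span.zero)
    fix x y assume xy: "x \<in> ?N" "y \<in> ?N"
    then obtain U1 U2 where *: "finite U1" "U1 \<subseteq> S" "finite U2" "U2 \<subseteq> S" "x \<in> span_terms U1" "y \<in> span_terms U2"
      by blast
    have US: "U1 \<union> U2 \<subseteq> S" using * by blast
    have "x \<in> span_terms (U1 \<union> U2)" "y \<in> span_terms (U1 \<union> U2)"
      using * scalar_span_mono[OF terms_mono] by blast+
    then have "x \<oplus> y \<in> span_terms (U1 \<union> U2)"
      using scalar_span_add[OF const_closed terms_closed[OF US]] by blast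
    moreover have "finite (U1 \<union> U2)" "x \<oplus> y \<in> carrier V" using xy * by auto
    ultimately show "x \<oplus> y \<in> ?N" using US by blast
  next
    fix r x assume "r \<in> carrier R" "x \<in> ?N"
    then show "r \<odot> x \<in> ?N" using smult_span_terms smult_closed by blast
  qed blast
  moreover have "set vs \<subseteq> ?N"
  proof
    fix v assume v: "v \<in> set vs"
    then have vV: "v \<in> carrier V" using vs_closed by blast
    have "\<phi> \<one>\<^bsub>G\<^esub> ` set ts \<subseteq> set ts" using ts_S by (auto simp: perm_one)
    then have "mon \<one>\<^bsub>k\<^esub> {#} \<one>\<^bsub>G\<^esub> \<odot> v \<in> terms (set ts)" using v unfolding terms_def by fastforce
    then have "v \<in> terms (set ts)" using vV by (simp add: mon_one smult_one)
    then have "const \<one>\<^bsub>k\<^esub> \<odot> v \<oplus> \<zero> \<in> span_terms (set ts)"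
      by (intro scalar_span.add scalar_span.zero) auto
    then have "v \<in> span_terms (set ts)" using vV by (simp add: const_def mon_one smult_one)
    then show "v \<in> ?N" using vV ts_S finite_set[of ts] by blast
  qed
  ultimately have "carrier V \<subseteq> ?N" unfolding generated by (rule generated_minimal)
  then show ?thesis using assms by blast
qed

text \<open>The word of a term over \<open>D\<close> is read off from \<open>m\<close> and \<open>g\<close>; each label occurs exactly once because
  \<open>g\<close> is injective and the entries of \<open>D\<close> are distinct.\<close>

lemma terms_subset_hat:
  assumes D: "distinct D" "set D \<subseteq> S"
  shows "terms (set D) \<subseteq> hat ` {x \<in> symbols. fst x = D}"
proof
  fix x assume "x \<in> terms (set D)"
  then obtain m g v where x: "x = mon \<one>\<^bsub>k\<^esub> m g \<odot> v" and m: "set_mset m \<subseteq> set D" and g: "g \<in> carrier G"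
      "\<phi> g ` set ts \<subseteq> set D" and v: "v \<in> set vs"
    by (auto simp: terms_def)
  obtain i where i: "i < length vs" "v = vs ! i" using v by (auto simp: in_set_conv_nth)
  define label where "label s = (if \<exists>l<length ts. \<phi> g (ts ! l) = s
    then Suc (SOME l. l < length ts \<and> \<phi> g (ts ! l) = s) else 0)" for s
  have label_Suc: "label s = Suc l \<longleftrightarrow> l < length ts \<and> \<phi> g (ts ! l) = s" for s l
  proof
    assume "label s = Suc l"
    then have "\<exists>l<length ts. \<phi> g (ts ! l) = s" "l = (SOME l. l < length ts \<and> \<phi> g (ts ! l) = s)"
      by (auto simp: label_def split: if_splits)
    then show "l < length ts \<and> \<phi> g (ts ! l) = s"
      using someI_ex[of "\<lambda>l. l < length ts \<and> \<phi> g (ts ! l) = s"] by simp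
  next
    assume l: "l < length ts \<and> \<phi> g (ts ! l) = s"
    then have "\<exists>l. l < length ts \<and> \<phi> g (ts ! l) = s" by blast
    moreover from this have some: "(SOME l. l < length ts \<and> \<phi> g (ts ! l) = s) < length ts \<and>
        \<phi> g (ts ! (SOME l. l < length ts \<and> \<phi> g (ts ! l) = s)) = s"
      by (rule someI_ex)
    then have "ts ! (SOME l. l < length ts \<and> \<phi> g (ts ! l) = s) = ts ! l"
      using l inj_onD[OF inj_prop[OF g(1)]] ts_S by (metis nth_mem subsetD)
    then have "(SOME l. l < length ts \<and> \<phi> g (ts ! l) = s) = l"
      using l some ts by (simp add: nth_eq_iff_index_eq)
    ultimately show "label s = Suc l" by (auto simp: label_def)
  qed
  define u where "u = map (\<lambda>s. (label s, count m s)) D"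
  have u: "length u = length D" "\<And>p. p < length D \<Longrightarrow> u ! p = (label (D ! p), count m (D ! p))"
    by (simp_all add: u_def)
  have "labelled (length ts) u"
    unfolding labelled_def
  proof (intro conjI allI impI ballI)
    have "label s \<le> length ts" for s
      using label_Suc[of s "label s - 1"] by (cases "label s") auto
    then show "fst (u ! p) \<le> length ts" if "p < length u" for p using that u by simp
  next
    fix l assume "l \<in> {1..length ts}"
    then obtain l' where l': "l = Suc l'" "l' < length ts" by (cases l) auto
    then have "\<phi> g (ts ! l') \<in> set D" using g(2) by auto
    then obtain p where "p < length D" "D ! p = \<phi> g (ts ! l')" by (auto simp: in_set_conv_nth)
    then show "\<exists>!p. p < length u \<and> fst (u ! p) = l"
      using l' u D(1) by (intro ex1I[of _ p]) (auto simp: label_Suc nth_eq_iff_index_eq)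
  qed
  then have symbol: "(D, i, u) \<in> symbols" using D i u by (simp add: symbols_def)
  moreover have "placement D u g"
    unfolding placement_def
  proof (intro conjI allI impI)
    fix p assume p: "p < length u" "fst (u ! p) \<noteq> 0"
    then have "label (D ! p) \<noteq> 0" using u by simp
    then obtain l where l: "label (D ! p) = Suc l" using not0_implies_Suc by blast
    then have "fst (u ! p) - 1 = l" using p u by simp
    then show "\<phi> g (ts ! (fst (u ! p) - 1)) = D ! p" using label_Suc l by blast
  qed (rule g(1))
  moreover have "exponents D u = m"
  proof (rule multiset_eqI)
    fix s
    have "(\<Sum>p<length D. if s = D ! p then count m (D ! p) else 0) = (\<Sum>s'\<in>set D. if s = s' then count m s' else 0)"
      by (rule sum.reindex_bij_betw[OF bij_betw_nth[OF D(1) refl refl]])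
    also have "\<dots> = count m s" using m by (auto simp: not_in_iff)
    finally show "count (exponents D u) s = count m s"
      using u by (simp add: exponents_def count_sum)
  qed
  ultimately have "hat (D, i, u) = x" by (simp add: hat_eq x i)
  then show "x \<in> hat ` {x \<in> symbols. fst x = D}" using symbol by force
qed

lemma symbols_spanning:
  assumes "x \<in> carrier V"
  shows "\<exists>X\<subseteq>symbols. totalp_on X symbol_less \<and> x \<in> scalar_span V (const ` carrier k) (hat ` X)"
proof -
  obtain U where U: "finite U" "U \<subseteq> S" "x \<in> span_terms U" using ex_span_terms[OF assms] by blast
  obtain D where D: "set D = U" "distinct D" using finite_distinct_list[OF U(1)] by blast
  have "terms U \<subseteq> hat ` {x \<in> symbols. fst x = D}"
    using terms_subset_hat[OF D(2)] U(2) D(1) by simp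
  then have "x \<in> scalar_span V (const ` carrier k) (hat ` {x \<in> symbols. fst x = D})"
    using U(3) by (rule scalar_span_mono)
  moreover have "totalp_on {x \<in> symbols. fst x = D} symbol_less"
  proof (rule totalp_onI)
    fix x y assume "x \<in> {x \<in> symbols. fst x = D}" "y \<in> {x \<in> symbols. fst x = D}" "x \<noteq> y"
    then show "symbol_less x y \<or> symbol_less y x" using symbol_less_total[of x y] by simp
  qed
  moreover have "{x \<in> symbols. fst x = D} \<subseteq> symbols" by simp
  ultimately show ?thesis by (intro exI[of _ "{x \<in> symbols. fst x = D}"] conjI)
qed

lemma symbol_less_total_below:
  assumes "x \<in> symbols" "y \<in> symbols" "symbol_less x z" "symbol_less y z"
  shows "x = y \<or> symbol_less x y \<or> symbol_less y x"
proof -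
  have "fst x = fst y" using assms(3,4)[THEN symbol_less_fst] by simp
  then show ?thesis by (rule symbol_less_total[OF assms(1,2)])
qed

lemma ordered_spanning_family:
  "ordered_spanning_family R V k const symbols hat symbol_less symbol_le"
proof (intro ordered_spanning_family.intro ordered_spanning_family_axioms.intro)
  show "left_module R V" by (rule left_module_axioms)
  show "cring k" by (rule k.cring_axioms)
  show "noetherian_ring k" by (rule k.noetherian_ring_axioms)
  show "ring_hom_ring k R const" by (rule ring_hom_const)
  show "hat x \<in> carrier V" if "x \<in> symbols" for x by (rule hat_closed[OF that])
  show "symbol_less x z" if "symbol_less x y" "symbol_less y z" for x y z
    by (rule symbol_less_trans[OF that])
  show "wfP symbol_less" by (rule wf_symbol_less)
  show "almost_full_on symbol_le symbols" by (rule almost_full_on_symbols)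
  show "x = y \<or> symbol_less x y \<or> symbol_less y x"
    if "x \<in> symbols" "y \<in> symbols" "z \<in> symbols" "symbol_less x z" "symbol_less y z" for x y z
    by (rule symbol_less_total_below[OF that(1,2,4,5)])
qed (rule symbols_spanning symbol_multiplier; assumption)+

lemma noetherian: "noetherian_module R V"
  using left_module_axioms ordered_spanning_family.submodule_finitely_generated[OF ordered_spanning_family]
  by (rule noetherian_moduleI)

end

lemma (in highly_transitive_module) finitely_generated_imp_noetherian:
  assumes "noetherian_ring k" and "fin_gen_module R V"
  shows "noetherian_module R V"
proof -
  obtain A where A: "A \<subseteq> carrier V" "finite A" "carrier V = generated_submodule R V A"
    using assms(2) by (auto simp: fin_gen_module_def)
  obtain vs where vs: "set vs = A" using finite_list[OF A(2)] by blast
  have "\<exists>T. fixed_by T v" if "v \<in> A" for v using ex_fixed_by A(1) that by blast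
  then obtain T where T: "\<And>v. v \<in> A \<Longrightarrow> fixed_by (T v) v" by metis
  have fin: "finite (\<Union>(T ` A))" "\<Union>(T ` A) \<subseteq> S"
    using T A(2) by (auto simp: fixed_by_def)
  obtain ts where ts: "set ts = \<Union>(T ` A)" "distinct ts"
    using finite_distinct_list[OF fin(1)] by blast
  have "fixed_by (set ts) v" if "v \<in> set vs" for v
    by (rule fixed_by_mono[OF T]) (use that vs ts fin in auto)
  then have "finitely_generated_discrete_module k S G \<phi> V vs ts"
    using highly_transitive_module_axioms assms(1) A vs ts fin
    by (simp add: finitely_generated_discrete_module_def finitely_generated_discrete_module_axioms_def)
  then show ?thesis by (rule finitely_generated_discrete_module.noetherian)
qed

section \<open>The polynomial ring as a discrete module\<close>

context polynomial_action
begin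

lemma skew_poly_module_simps:
  "carrier (skew_poly_module k S \<phi>) = carrier P"
  "\<zero>\<^bsub>skew_poly_module k S \<phi>\<^esub> = \<zero>\<^bsub>P\<^esub>"
  "x \<oplus>\<^bsub>skew_poly_module k S \<phi>\<^esub> y = x \<oplus>\<^bsub>P\<^esub> y"
  "finsum (skew_poly_module k S \<phi>) = finsum P"
  by (simp_all add: skew_poly_module_def skew_regular_module_def finsum_def finprod_def fun_eq_iff)

lemma
  shows skew_poly_module: "polynomial_skew_module k S G \<phi> (skew_poly_module k S \<phi>)"
    and skew_poly_module_single: "p \<in> carrier P \<Longrightarrow> g \<in> carrier G \<Longrightarrow> q \<in> carrier P \<Longrightarrow>
      skew_elem P p g \<odot>\<^bsub>skew_poly_module k S \<phi>\<^esub> q = p \<otimes>\<^bsub>P\<^esub> perm_poly k S (\<phi> g) q"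
proof -
  let ?M = "skew_poly_module k S \<phi>"
  have "abelian_group ?M"
    by (rule abelian_groupI)
      (auto simp: skew_poly_module_simps P.a_ac intro!: bexI[where x = "\<ominus>\<^bsub>P\<^esub> x" for x] P.l_neg)
  note * = skew.left_module_if_semilinear_action[OF this,
      where s = "monoid.mult P" and t = "\<lambda>g. perm_poly k S (\<phi> g)"]
  note rules = skew_poly_module_simps P.l_distr P.r_distr P.m_assoc skew.act_add skew.act_comp
    skew.act_unit skew.act_mult
  have "left_module skew.RG ?M"
    by (rule *(1); simp add: rules; simp add: skew_poly_module_def skew_regular_module_def)
  then show "polynomial_skew_module k S G \<phi> ?M"
    by (simp add: polynomial_skew_module_def polynomial_action_axioms R_eq)
  show "skew_elem P p g \<odot>\<^bsub>?M\<^esub> q = p \<otimes>\<^bsub>P\<^esub> perm_poly k S (\<phi> g) q"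
    if "p \<in> carrier P" "g \<in> carrier G" "q \<in> carrier P"
    by (rule *(2); (use that in \<open>simp add: rules\<close>)?; (simp add: skew_poly_module_def skew_regular_module_def)?)
qed

lemma discrete_skew_poly_module: "discrete_module k S G \<phi> (skew_poly_module k S \<phi>)"
proof -
  interpret M: polynomial_skew_module k S G \<phi> "skew_poly_module k S \<phi>" by (rule skew_poly_module)
  have "\<exists>T. M.fixed_by T p" if p: "p \<in> carrier P" for p
  proof -
    obtain T where T: "finite T" "T \<subseteq> S"
        "\<forall>\<sigma>\<in>Bij S. \<forall>\<tau>\<in>Bij S. (\<forall>t\<in>T. \<sigma> t = \<tau> t) \<longrightarrow> perm_poly k S \<sigma> p = perm_poly k S \<tau> p"
      using k.perm_poly_cong_finite[OF p] by blast
    have "M.act g p = p" if g: "g \<in> pointwise_stabilizer G \<phi> T" for g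
    proof -
      have gG: "g \<in> carrier G" using g by (simp add: pointwise_stabilizer_def)
      have "\<forall>t\<in>T. \<phi> g t = \<phi> \<one>\<^bsub>G\<^esub> t"
        using g T(2) by (auto simp: pointwise_stabilizer_def perm_one)
      then have "perm_poly k S (\<phi> g) p = perm_poly k S (\<phi> \<one>\<^bsub>G\<^esub>) p"
        using T(3) perm_Bij[OF gG] perm_Bij[OF G.one_closed] by blast
      then show ?thesis
        using gG p by (simp add: group_elem_action_def skew_poly_module_single skew.act_unit)
    qed
    then show ?thesis using T by (auto simp: M.fixed_by_def)
  qed
  then show ?thesis by (simp add: M.discrete_module_iff skew_poly_module_simps)
qed

lemma fin_gen_skew_poly_module: "fin_gen_module R (skew_poly_module k S \<phi>)"
proof -
  let ?M = "skew_poly_module k S \<phi>"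
  interpret M: polynomial_skew_module k S G \<phi> ?M by (rule skew_poly_module)
  let ?N = "generated_submodule R ?M {\<one>\<^bsub>P\<^esub>}"
  have one: "{\<one>\<^bsub>P\<^esub>} \<subseteq> carrier ?M" by (simp add: skew_poly_module_simps)
  have N: "submodule ?N R ?M" by (rule M.submodule_generated[OF one])
  have "p \<in> ?N" if p: "p \<in> carrier P" for p
  proof -
    have "skew_elem P p \<one>\<^bsub>G\<^esub> \<odot>\<^bsub>?M\<^esub> \<one>\<^bsub>P\<^esub> \<in> ?N"
      using M.submoduleD(4)[OF N] M.single_closed[OF p G.one_closed] M.generated_subset[of "{\<one>\<^bsub>P\<^esub>}"] by blast
    then show ?thesis using p by (simp add: skew_poly_module_single skew.act_unit)
  qed
  then have "carrier ?M = ?N"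
    using M.submoduleD(1)[OF N] by (auto simp: skew_poly_module_simps)
  then show ?thesis using one unfolding fin_gen_module_def by blast
qed

end

theorem theorem1p1:
  fixes k :: "('k, 'c) ring_scheme"
    and S :: "'s set"
    and G :: "('g, 'd) monoid_scheme"
    and \<rho> :: "'g \<Rightarrow> 's \<Rightarrow> 's"
  assumes "cring k" and "noetherian_ring k"
    and "group_action G S \<rho>"
    and "highly_transitive S G \<rho>"
  shows "equivalent_categories
      (discrete_module_category k S G \<rho> ::
        (('g \<Rightarrow> 's multiset \<Rightarrow> 'k, 'm) module, 'm \<Rightarrow> 'm) category)
      (discrete_module_category k S (BijGroup S) (\<lambda>\<sigma>. \<sigma>) ::
        ((('s \<Rightarrow> 's) \<Rightarrow> 's multiset \<Rightarrow> 'k, 'm) module, 'm \<Rightarrow> 'm) category) \<and>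
    (\<forall>V :: ('g \<Rightarrow> 's multiset \<Rightarrow> 'k, 'm) module.
      discrete_module k S G \<rho> V \<and> fin_gen_module (skew_poly_ring k S G \<rho>) V \<longrightarrow>
        noetherian_module (skew_poly_ring k S G \<rho>) V) \<and>
    noetherian_module (skew_poly_ring k S G \<rho>) (skew_poly_module k S \<rho>)"
proof (intro conjI allI impI)
  have action: "polynomial_action k S G \<rho>"
    using assms by (simp add: polynomial_action_def)
  then interpret polynomial_action k S G \<rho> .
  show "equivalent_categories
      (discrete_module_category k S G \<rho> ::
        (('g \<Rightarrow> 's multiset \<Rightarrow> 'k, 'm) module, 'm \<Rightarrow> 'm) category)
      (discrete_module_category k S (BijGroup S) (\<lambda>\<sigma>. \<sigma>) ::
        ((('s \<Rightarrow> 's) \<Rightarrow> 's multiset \<Rightarrow> 'k, 'm) module, 'm \<Rightarrow> 'm) category)"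
    by (rule equivalence_of_discrete_modules[OF action assms(4)])
  show "noetherian_module R V" if V: "discrete_module k S G \<rho> V \<and> fin_gen_module R V"
    for V :: "('g \<Rightarrow> 's multiset \<Rightarrow> 'k, 'm) module"
  proof -
    interpret V: highly_transitive_module k S G \<rho> V
      using V assms(4)
      by (simp add: highly_transitive_module_def highly_transitive_module_axioms_def
          polynomial_skew_module_if_discrete)
    show ?thesis by (rule V.finitely_generated_imp_noetherian[OF assms(2) conjunct2[OF V]])
  qed
  interpret M: highly_transitive_module k S G \<rho> "skew_poly_module k S \<rho>"
    using skew_poly_module discrete_skew_poly_module assms(4)
    by (simp add: highly_transitive_module_def highly_transitive_module_axioms_def)
  show "noetherian_module R (skew_poly_module k S \<rho>)"
    by (rule M.finitely_generated_imp_noetherian[OF assms(2) fin_gen_skew_poly_module])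
qed

end
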